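(* Let $A$ be an ordered abelian group. The ring $K^{df}_{\mathbb{Q}}(\Gamma_A)$ is generated as a $\mathbb{Q}$-algebra by the elements $e(a),\iota(a)$ ($a\in\mathbb{Q}\otimes A$) and $\iota(\infty)$. For $a\in A$ we have $\iota(a)=0$. Also $\iota(\infty)^2=\iota(\infty)$. If $A$ is divisible, then $K^{df}_{\mathbb{Q}}(\Gamma_A)\cong\mathbb{Q}^2$.
   Context: $A$ is a base of parameters for the theory DOAG of (nontrivial) divisible ordered abelian groups; $\Gamma$ denotes a sufficiently saturated model of DOAG containing $A$. An object of $\Gamma_A[n]$ is a subset of $\Gamma^n$ defined by (a Boolean combination of) linear equalities and inequalities with $\mathbb{Z}$-coefficients and parameters in $A$. A morphism $X\to Y$ in $\Gamma_A[n]$ is a bijection $f$ for which there are a finite definable partition $X=\bigcup X_i$, $M_i\in GL_n(\mathbb{Z})$ and $a_i\in A^n$ with $f(x)=M_ix+a_i$ for $x\in X_i$. (No boundedness is imposed.) $K_+(\Gamma_A)=\bigoplus_nK_+(\Gamma_A)[n]$ is the graded Grothendieck semiring: $K_+(\Gamma_A)[n]$ is the semigroup generated by objects $[X]_n$ of $\Gamma_A[n]$ subject to $[X_1]+[X_2]=[Z]$ when $Z=Z_1\sqcup Z_2$ with $Z_i$ isomorphic to $X_i$ in $\Gamma_A[n]$; the product is induced by Cartesian product. With $[0]_1$ the class of $\{0\}\subset\Gamma$, $K_+^{df}(\Gamma_A)$ is the degree $0$ part of the localization $K_+(\Gamma_A)[[0]_1^{-1}]$, $K^{df}(\Gamma_A)$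 is the ring obtained by adding additive inverses, and $K^{df}_{\mathbb{Q}}(\Gamma_A)=\mathbb{Q}\otimes K^{df}(\Gamma_A)$. $e(a)=[\{a\}]_1/[0]_1$; $\iota(a)=[[0,a)]_1/[0]_1$ for $a>0$, $\iota(0)=0$, $\iota(a)=-\iota(-a)$ for $a<0$; $\iota(\infty)=[[0,\infty)]_1/[0]_1$. *)

theory Defs
  imports
    "HOL-Library.Multiset"
    "HOL-Library.Poly_Mapping"
    "HOL-Library.Equipollence"
    "HOL-Library.Countable_Set"
    "HOL-Library.Disjoint_Sets"
    "HOL-Algebra.QuotRing"
    "HOL-Algebra.Generated_Rings"
    "HOL-Algebra.Chinese_Remainder"
    "Jordan_Normal_Form.Matrix"
begin

hide_const (open) Multiset.mult

section \<open>Divisible ordered abelian groups and definable sets\<close>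

definition zscale :: "int \<Rightarrow> 'g::ab_group_add \<Rightarrow> 'g" where
  "zscale k x = (if 0 \<le> k then (\<Sum>i<nat k. x) else - (\<Sum>i<nat (- k). x))"

class doag = linordered_ab_group_add +
  assumes nontrivial: "\<exists>x. x \<noteq> 0"
    and divisible: "0 < (n::nat) \<Longrightarrow> \<exists>y. (\<Sum>i<n. y) = x"

definition add_subgroup :: "'g::ab_group_add set \<Rightarrow> bool" where
  "add_subgroup A \<longleftrightarrow> 0 \<in> A \<and> (\<forall>a\<in>A. \<forall>b\<in>A. a + b \<in> A) \<and> (\<forall>a\<in>A. - a \<in> A)"

definition divisible_subgroup :: "'g::ab_group_add set \<Rightarrow> bool" where
  "divisible_subgroup A \<longleftrightarrow> add_subgroup A \<and> (\<forall>a\<in>A. \<forall>n>0. \<exists>b\<in>A. zscale (int n) b = a)"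

text \<open>The copy of \<open>\<rat> \<otimes> A\<close> inside a divisible torsion-free group containing \<open>A\<close>.\<close>

definition div_hull :: "'g::ab_group_add set \<Rightarrow> 'g set" where
  "div_hull A = {x. \<exists>n>0. zscale (int n) x \<in> A}"

definition int_lin :: "int vec \<Rightarrow> 'g::ab_group_add vec \<Rightarrow> 'g" where
  "int_lin k x = (\<Sum>i<dim_vec k. zscale (k $ i) (x $ i))"

definition int_mat_vec :: "int mat \<Rightarrow> 'g::ab_group_add vec \<Rightarrow> 'g vec" where
  "int_mat_vec M x = vec (dim_row M) (\<lambda>i. int_lin (row M i) x)"

definition GL_Z :: "nat \<Rightarrow> int mat set" where
  "GL_Z n = {M \<in> carrier_mat n n. invertible_mat M}"

text \<open>Objects of \<open>\<Gamma>\<^sub>A[n]\<close>; points of \<open>\<Gamma>\<^sup>n\<close> are the elements of \<^term>\<open>carrier_vec n\<close>.\<close>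

inductive_set definable :: "'g::linordered_ab_group_add set \<Rightarrow> nat \<Rightarrow> 'g vec set set"
  for A n where
  lin_eq: "k \<in> carrier_vec n \<Longrightarrow> a \<in> A \<Longrightarrow> {x \<in> carrier_vec n. int_lin k x = a} \<in> definable A n"
| lin_less: "k \<in> carrier_vec n \<Longrightarrow> a \<in> A \<Longrightarrow> {x \<in> carrier_vec n. int_lin k x < a} \<in> definable A n"
| compl: "X \<in> definable A n \<Longrightarrow> carrier_vec n - X \<in> definable A n"
| union: "X \<in> definable A n \<Longrightarrow> Y \<in> definable A n \<Longrightarrow> X \<union> Y \<in> definable A n"

text \<open>\<open>\<kappa>\<close>-saturation of \<open>\<Gamma>\<close> for \<open>\<kappa>\<close> the successor cardinal of \<open>max (card A) \<aleph>\<^sub>0\<close>: every 1-type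
  over at most \<open>max (card A) \<aleph>\<^sub>0\<close> parameters is realised. By quantifier elimination the sets
  in \<^const>\<open>definable\<close> suffice.\<close>

definition saturated_over :: "'g::linordered_ab_group_add set \<Rightarrow> bool" where
  "saturated_over A \<longleftrightarrow>
     (\<forall>(B :: 'g set) F. (countable B \<or> B \<lesssim> A) \<longrightarrow> F \<subseteq> definable B 1 \<longrightarrow>
        (\<forall>F'\<subseteq>F. finite F' \<longrightarrow> carrier_vec 1 \<inter> \<Inter>F' \<noteq> {}) \<longrightarrow>
        carrier_vec 1 \<inter> \<Inter>F \<noteq> {})"

definition morphism ::
    "'g::linordered_ab_group_add set \<Rightarrow> nat \<Rightarrow> 'g vec set \<Rightarrow> 'g vec set \<Rightarrow> ('g vec \<Rightarrow> 'g vec) \<Rightarrow> bool"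
  where
  "morphism A n X Y f \<longleftrightarrow>
     X \<in> definable A n \<and> Y \<in> definable A n \<and> bij_betw f X Y \<and>
     (\<exists>N P M a. X = (\<Union>i<(N::nat). P i) \<and> disjoint_family_on P {..<N} \<and>
        (\<forall>i<N. P i \<in> definable A n \<and> M i \<in> GL_Z n \<and>
               a i \<in> carrier_vec n \<and> (\<forall>j<n. a i $ j \<in> A) \<and>
               (\<forall>x\<in>P i. f x = int_mat_vec (M i) x + a i)))"

text \<open>Inverses of morphisms are morphisms, so a single morphism already is an isomorphism.\<close>

definition isomorphic ::
    "'g::linordered_ab_group_add set \<Rightarrow> nat \<Rightarrow> 'g vec set \<Rightarrow> 'g vec set \<Rightarrow> bool" where
  "isomorphic A n X Y \<longleftrightarrow> (\<exists>f. morphism A n X Y f)"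


section \<open>The graded Grothendieck semiring\<close>

type_synonym 'g obj = "nat \<times> 'g vec set"

definition objects :: "'g::linordered_ab_group_add set \<Rightarrow> 'g obj set" where
  "objects A = (SIGMA n:UNIV. definable A n)"

text \<open>Elements of \<open>K\<^sub>+(\<Gamma>\<^sub>A)\<close> are represented by multisets of objects tagged with their degree (formal
  sums), so that the direct sum over all degrees is built in. In the semigroup
  \<open>K\<^sub>+(\<Gamma>\<^sub>A)[n]\<close> the defining relations make \<open>[\<emptyset>]\<^sub>n\<close> neutral (split \<open>Z\<close> as \<open>Z \<squnion> \<emptyset>\<close>); clause
  \<open>empty\<close> identifies it with the empty formal sum, the zero of the direct sum.\<close>

inductive kplus_eq :: "'g::linordered_ab_group_add set \<Rightarrow> 'g obj multiset \<Rightarrow> 'g obj multiset \<Rightarrow> bool"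
  for A where
  refl: "set_mset a \<subseteq> objects A \<Longrightarrow> kplus_eq A a a"
| sym: "kplus_eq A a b \<Longrightarrow> kplus_eq A b a"
| trans: "kplus_eq A a b \<Longrightarrow> kplus_eq A b c \<Longrightarrow> kplus_eq A a c"
| add: "kplus_eq A a b \<Longrightarrow> set_mset c \<subseteq> objects A \<Longrightarrow> kplus_eq A (a + c) (b + c)"
| empty: "kplus_eq A {#(n, {})#} {#}"
| split: "Z \<in> definable A n \<Longrightarrow> Z\<^sub>1 \<in> definable A n \<Longrightarrow> Z\<^sub>2 \<in> definable A n \<Longrightarrow>
    Z = Z\<^sub>1 \<union> Z\<^sub>2 \<Longrightarrow> Z\<^sub>1 \<inter> Z\<^sub>2 = {} \<Longrightarrow> isomorphic A n Z\<^sub>1 X\<^sub>1 \<Longrightarrow> isomorphic A n Z\<^sub>2 X\<^sub>2 \<Longrightarrow>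
    kplus_eq A {#(n, X\<^sub>1), (n, X\<^sub>2)#} {#(n, Z)#}"

definition kplus_rel :: "'g::linordered_ab_group_add set \<Rightarrow> ('g obj multiset \<times> 'g obj multiset) set" where
  "kplus_rel A = {(a, b). kplus_eq A a b}"

definition obj_times :: "'g obj \<Rightarrow> 'g obj \<Rightarrow> 'g obj" where
  "obj_times p q = (fst p + fst q, {x @\<^sub>v y | x y. x \<in> snd p \<and> y \<in> snd q})"

definition mset_times :: "'g obj multiset \<Rightarrow> 'g obj multiset \<Rightarrow> 'g obj multiset" where
  "mset_times a b = (\<Sum>p\<in>#a. image_mset (obj_times p) b)"

definition Kplus :: "'g::linordered_ab_group_add set \<Rightarrow> 'g obj multiset set ring" where
  "Kplus A = \<lparr>
     carrier = {a. set_mset a \<subseteq> objects A} // kplus_rel A,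
     mult = (\<lambda>X Y. \<Union>a\<in>X. \<Union>b\<in>Y. kplus_rel A `` {mset_times a b}),
     one = kplus_rel A `` {{#(0, carrier_vec 0)#}},
     zero = kplus_rel A `` {{#}},
     add = (\<lambda>X Y. \<Union>a\<in>X. \<Union>b\<in>Y. kplus_rel A `` {a + b})\<rparr>"

definition kplus_class :: "'g::linordered_ab_group_add set \<Rightarrow> nat \<Rightarrow> 'g vec set \<Rightarrow> 'g obj multiset set" where
  "kplus_class A n X = kplus_rel A `` {{#(n, X)#}}"

definition Kplus_degree :: "'g::linordered_ab_group_add set \<Rightarrow> nat \<Rightarrow> 'g obj multiset set set" where
  "Kplus_degree A n = {kplus_rel A `` {a} | a. set_mset a \<subseteq> {n} \<times> definable A n}"


section \<open>Localization, ring completion and tensoring with the rationals\<close>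

text \<open>Localization of a commutative semiring at the powers of \<open>s\<close>; the pair \<open>(a, k)\<close> stands for
  the fraction \<open>a / s\<^sup>k\<close>.\<close>

definition loc_rel :: "('k, 'm) ring_scheme \<Rightarrow> 'k \<Rightarrow> (('k \<times> nat) \<times> ('k \<times> nat)) set" where
  "loc_rel R s = {((a, k), (b, l)) | a k b l. a \<in> carrier R \<and> b \<in> carrier R \<and>
     (\<exists>m::nat. a \<otimes>\<^bsub>R\<^esub> s [^]\<^bsub>R\<^esub> (l + m) = b \<otimes>\<^bsub>R\<^esub> s [^]\<^bsub>R\<^esub> (k + m))}"

definition fraction :: "('k, 'm) ring_scheme \<Rightarrow> 'k \<Rightarrow> 'k \<Rightarrow> nat \<Rightarrow> ('k \<times> nat) set" where
  "fraction R s a k = loc_rel R s `` {(a, k)}"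

definition localization :: "('k, 'm) ring_scheme \<Rightarrow> 'k \<Rightarrow> ('k \<times> nat) set ring" where
  "localization R s = \<lparr>
     carrier = (carrier R \<times> UNIV) // loc_rel R s,
     mult = (\<lambda>X Y. \<Union>(a, k)\<in>X. \<Union>(b, l)\<in>Y. fraction R s (a \<otimes>\<^bsub>R\<^esub> b) (k + l)),
     one = fraction R s \<one>\<^bsub>R\<^esub> 0,
     zero = fraction R s \<zero>\<^bsub>R\<^esub> 0,
     add = (\<lambda>X Y. \<Union>(a, k)\<in>X. \<Union>(b, l)\<in>Y.
              fraction R s (a \<otimes>\<^bsub>R\<^esub> s [^]\<^bsub>R\<^esub> l \<oplus>\<^bsub>R\<^esub> b \<otimes>\<^bsub>R\<^esub> s [^]\<^bsub>R\<^esub> k) (k + l))\<rparr>"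

text \<open>The ring obtained from a commutative semiring by adjoining additive inverses; the pair
  \<open>(a, b)\<close> stands for \<open>a - b\<close>.\<close>

definition compl_rel :: "('k, 'm) ring_scheme \<Rightarrow> (('k \<times> 'k) \<times> ('k \<times> 'k)) set" where
  "compl_rel R = {((a, b), (c, d)) | a b c d.
     a \<in> carrier R \<and> b \<in> carrier R \<and> c \<in> carrier R \<and> d \<in> carrier R \<and>
     (\<exists>k\<in>carrier R. (a \<oplus>\<^bsub>R\<^esub> d) \<oplus>\<^bsub>R\<^esub> k = (c \<oplus>\<^bsub>R\<^esub> b) \<oplus>\<^bsub>R\<^esub> k)}"

definition formal_diff :: "('k, 'm) ring_scheme \<Rightarrow> 'k \<Rightarrow> 'k \<Rightarrow> ('k \<times> 'k) set" where
  "formal_diff R a b = compl_rel R `` {(a, b)}"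

definition ring_completion :: "('k, 'm) ring_scheme \<Rightarrow> ('k \<times> 'k) set ring" where
  "ring_completion R = \<lparr>
     carrier = (carrier R \<times> carrier R) // compl_rel R,
     mult = (\<lambda>X Y. \<Union>(a, b)\<in>X. \<Union>(c, d)\<in>Y.
               formal_diff R (a \<otimes>\<^bsub>R\<^esub> c \<oplus>\<^bsub>R\<^esub> b \<otimes>\<^bsub>R\<^esub> d) (a \<otimes>\<^bsub>R\<^esub> d \<oplus>\<^bsub>R\<^esub> b \<otimes>\<^bsub>R\<^esub> c)),
     one = formal_diff R \<one>\<^bsub>R\<^esub> \<zero>\<^bsub>R\<^esub>,
     zero = formal_diff R \<zero>\<^bsub>R\<^esub> \<zero>\<^bsub>R\<^esub>,
     add = (\<lambda>X Y. \<Union>(a, b)\<in>X. \<Union>(c, d)\<in>Y. formal_diff R (a \<oplus>\<^bsub>R\<^esub> c) (b \<oplus>\<^bsub>R\<^esub> d))\<rparr>"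

text \<open>\<open>\<rat> \<otimes>\<^sub>\<int> R\<close> as the free abelian group on \<open>\<rat> \<times> R\<close>, multiplied by
  \<open>(q, x) (r, y) = (q r, x y)\<close>, modulo the bilinearity relations. The subgroup generated by these
  relations is already an ideal.\<close>

definition rat_free_ring :: "('k, 'm) ring_scheme \<Rightarrow> ((rat \<times> 'k) \<Rightarrow>\<^sub>0 int) ring" where
  "rat_free_ring R = \<lparr>
     carrier = {c. Poly_Mapping.keys c \<subseteq> UNIV \<times> carrier R},
     mult = (\<lambda>c d. frag_extend (\<lambda>(q, x). frag_extend (\<lambda>(r, y). frag_of (q * r, x \<otimes>\<^bsub>R\<^esub> y)) d) c),
     one = frag_of (1, \<one>\<^bsub>R\<^esub>),
     zero = 0,
     add = (+)\<rparr>"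

definition bilinear_relations :: "('k, 'm) ring_scheme \<Rightarrow> ((rat \<times> 'k) \<Rightarrow>\<^sub>0 int) set" where
  "bilinear_relations R =
     {frag_of (q + r, x) - frag_of (q, x) - frag_of (r, x) | q r x. x \<in> carrier R} \<union>
     {frag_of (q, x \<oplus>\<^bsub>R\<^esub> y) - frag_of (q, x) - frag_of (q, y) | q x y.
        x \<in> carrier R \<and> y \<in> carrier R}"

definition rat_tensor :: "('k, 'm) ring_scheme \<Rightarrow> ((rat \<times> 'k) \<Rightarrow>\<^sub>0 int) set ring" where
  "rat_tensor R = rat_free_ring R Quot (Idl\<^bsub>rat_free_ring R\<^esub> (bilinear_relations R))"

definition pure_tensor :: "('k, 'm) ring_scheme \<Rightarrow> rat \<Rightarrow> 'k \<Rightarrow> ((rat \<times> 'k) \<Rightarrow>\<^sub>0 int) set" where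
  "pure_tensor R q x =
     (Idl\<^bsub>rat_free_ring R\<^esub> (bilinear_relations R)) +>\<^bsub>rat_free_ring R\<^esub> frag_of (q, x)"

text \<open>The \<open>\<rat>\<close>-subalgebra of \<open>\<rat> \<otimes> R\<close> generated by \<open>S\<close>: the subring generated by \<open>S\<close> and the
  image of \<open>\<rat>\<close>.\<close>

definition rat_subalgebra ::
    "('k, 'm) ring_scheme \<Rightarrow> ((rat \<times> 'k) \<Rightarrow>\<^sub>0 int) set set \<Rightarrow> ((rat \<times> 'k) \<Rightarrow>\<^sub>0 int) set set" where
  "rat_subalgebra R S = generate_ring (rat_tensor R) (range (\<lambda>q. pure_tensor R q \<one>\<^bsub>R\<^esub>) \<union> S)"

definition rat_ring :: "rat ring" where
  "rat_ring = \<lparr>carrier = UNIV, mult = (*), one = 1, zero = 0, add = (+)\<rparr>"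


section \<open>The dimension-free Grothendieck ring\<close>

definition point0 :: "'g::linordered_ab_group_add set \<Rightarrow> 'g obj multiset set" where
  "point0 A = kplus_class A 1 {x \<in> carrier_vec 1. x $ 0 = 0}"

definition Kplus_df :: "'g::linordered_ab_group_add set \<Rightarrow> ('g obj multiset set \<times> nat) set ring" where
  "Kplus_df A = (localization (Kplus A) (point0 A))
     \<lparr>carrier := {fraction (Kplus A) (point0 A) a n | a n. a \<in> Kplus_degree A n}\<rparr>"

type_synonym 'g kdf = "(('g obj multiset set \<times> nat) set \<times> ('g obj multiset set \<times> nat) set) set"

definition Kdf :: "'g::linordered_ab_group_add set \<Rightarrow> 'g kdf ring" where
  "Kdf A = ring_completion (Kplus_df A)"

definition KdfQ :: "'g::linordered_ab_group_add set \<Rightarrow> ((rat \<times> 'g kdf) \<Rightarrow>\<^sub>0 int) set ring" where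
  "KdfQ A = rat_tensor (Kdf A)"

text \<open>The image in \<open>K\<^sup>d\<^sup>f\<^sub>\<rat>(\<Gamma>\<^sub>A)\<close> of \<open>[X]\<^sub>1 / [0]\<^sub>1\<close>, where \<open>X\<close> consists of the points with
  coordinate in \<open>S\<close>.\<close>

definition df_class1 :: "'g::linordered_ab_group_add set \<Rightarrow> 'g set \<Rightarrow> ((rat \<times> 'g kdf) \<Rightarrow>\<^sub>0 int) set" where
  "df_class1 A S = pure_tensor (Kdf A) 1
     (formal_diff (Kplus_df A)
        (fraction (Kplus A) (point0 A) (kplus_class A 1 {x \<in> carrier_vec 1. x $ 0 \<in> S}) 1)
        \<zero>\<^bsub>Kplus_df A\<^esub>)"

definition e_class :: "'g::linordered_ab_group_add set \<Rightarrow> 'g \<Rightarrow> ((rat \<times> 'g kdf) \<Rightarrow>\<^sub>0 int) set" where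
  "e_class A a = df_class1 A {a}"

definition iota :: "'g::linordered_ab_group_add set \<Rightarrow> 'g \<Rightarrow> ((rat \<times> 'g kdf) \<Rightarrow>\<^sub>0 int) set" where
  "iota A a =
     (if a > 0 then df_class1 A {0..<a}
      else if a = 0 then \<zero>\<^bsub>KdfQ A\<^esub>
      else \<ominus>\<^bsub>KdfQ A\<^esub> df_class1 A {0..<- a})"

definition iota_inf :: "'g::linordered_ab_group_add set \<Rightarrow> ((rat \<times> 'g kdf) \<Rightarrow>\<^sub>0 int) set" where
  "iota_inf A = df_class1 A {0..}"

end

theory Submission
  imports Defs "Jordan_Normal_Form.Gauss_Jordan_Elimination"
begin

text \<open>Two half-spaces \<open>l\<^sub>1 \<ge> b\<^sub>1\<close> and \<open>l\<^sub>2 \<ge> b\<^sub>2\<close> can be traded, by a relation between indicator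
  functions, for pairs that involve a prescribed positive combination of \<open>l\<^sub>1\<close> and \<open>l\<^sub>2\<close>. Together with
  Euclid's algorithm this form of Fourier-Motzkin elimination writes every definable set as an
  alternating combination of images of coordinate boxes under shears and reflections, the bounds of
  the boxes being in \<open>\<rat> \<otimes> A\<close>. The class of a box is a product of classes of lines and rays, which
  are expressed by \<open>e\<close>, \<open>\<iota>\<close> and \<open>\<iota>(\<infinity>)\<close>. Translating the ray \<open>[0, \<infinity>)\<close> by \<open>a \<in> A\<close> gives
  \<open>\<iota>(a) = 0\<close>, and cutting the quadrant along its diagonal gives \<open>\<iota>(\<infinity>)\<^sup>2 = \<iota>(\<infinity>)\<close>. If \<open>A\<close> is
  divisible, the ring is thus spanned over \<open>\<rat>\<close> by 1 and the idempotent \<open>\<iota>(\<infinity>)\<close>. These are separated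
  by two Euler characteristics, one equal to 1 on nonempty closed polyhedra and the other to
  \<open>(-1)\<^sup>n\<close> on nonempty open ones; both are well defined because a linear relation between indicator
  functions of polyhedra is inherited by their projections along a coordinate.\<close>

section \<open>Commutative semirings and their quotient constructions\<close>

text \<open>Objects are identified only by maps from GL_n(Z) with translations in \<open>A\<close>,
  so coordinates cannot be rescaled. A simplicial cone is in general no unimodular image of an
  orthant, which is why elimination has to be joined with Euclid's algorithm on the coefficients. A
  point with coordinate in \<rat> \<otimes> A need not be a translate of the origin either, which is
  why e(a) and \<iota>(a) for such a stay among the generators. Signed combinations of indicator
  functions occur in two encodings: as differences of nested sets where classes are computed, so
  that every intermediate term is itself a definable set, and as weighted lists of polyhedra where
  numerical invariants are computed. An invariant has to pass through four quotients (formal sums,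
  fractions, formal differences, tensors), and \<open>character\<close> is the notion carried
  through them. Both Euler characteristics come from a single argument with a Boolean parameter for
  strictness: if all inequalities of a polyhedron are of the same kind, its projections are again of
  that kind, and counting nonempty polyhedra becomes consistent.\<close>

lemma UN2_const:
  assumes "X \<noteq> {}" "Y \<noteq> {}" "\<And>a k b l. (a, k) \<in> X \<Longrightarrow> (b, l) \<in> Y \<Longrightarrow> F a k b l = C"
  shows "(\<Union>(a, k)\<in>X. \<Union>(b, l)\<in>Y. F a k b l) = C"
  using assms by fastforce

text \<open>Every rational-valued map on a quotient below is defined as the common value of a
  function on an equivalence class; this reads the value off.\<close>

lemma the_elem_image_const:
  assumes "x \<in> X" "\<And>y. y \<in> X \<Longrightarrow> f y = c"
  shows "the_elem (f ` X) = c"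
proof -
  have "f ` X = {c}" using assms by force
  then show ?thesis by simp
qed

locale csemiring = semiring R + comm_monoid R for R (structure)

lemma csemiringI:
  fixes R (structure)
  assumes "\<zero> \<in> carrier R" "\<one> \<in> carrier R"
    and "\<And>x y. \<lbrakk>x \<in> carrier R; y \<in> carrier R\<rbrakk> \<Longrightarrow> x \<oplus> y \<in> carrier R"
    and "\<And>x y. \<lbrakk>x \<in> carrier R; y \<in> carrier R\<rbrakk> \<Longrightarrow> x \<otimes> y \<in> carrier R"
    and "\<And>x y z. \<lbrakk>x \<in> carrier R; y \<in> carrier R; z \<in> carrier R\<rbrakk> \<Longrightarrow> (x \<oplus> y) \<oplus> z = x \<oplus> (y \<oplus> z)"
    and "\<And>x y z. \<lbrakk>x \<in> carrier R; y \<in> carrier R; z \<in> carrier R\<rbrakk> \<Longrightarrow> (x \<otimes> y) \<otimes> z = x \<otimes> (y \<otimes> z)"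
    and "\<And>x y. \<lbrakk>x \<in> carrier R; y \<in> carrier R\<rbrakk> \<Longrightarrow> x \<oplus> y = y \<oplus> x"
    and "\<And>x y. \<lbrakk>x \<in> carrier R; y \<in> carrier R\<rbrakk> \<Longrightarrow> x \<otimes> y = y \<otimes> x"
    and "\<And>x. x \<in> carrier R \<Longrightarrow> \<zero> \<oplus> x = x"
    and "\<And>x. x \<in> carrier R \<Longrightarrow> \<one> \<otimes> x = x"
    and "\<And>x. x \<in> carrier R \<Longrightarrow> \<zero> \<otimes> x = \<zero>"
    and "\<And>x y z. \<lbrakk>x \<in> carrier R; y \<in> carrier R; z \<in> carrier R\<rbrakk> \<Longrightarrow> (x \<oplus> y) \<otimes> z = x \<otimes> z \<oplus> y \<otimes> z"
  shows "csemiring R"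
proof -
  interpret a: abelian_monoid R
    by (rule abelian_monoidI) (use assms in auto)
  interpret m: comm_monoid R
    by (rule comm_monoidI) (use assms in auto)
  show ?thesis
  proof
    fix x y z assume "x \<in> carrier R" "y \<in> carrier R" "z \<in> carrier R"
    then show "z \<otimes> (x \<oplus> y) = z \<otimes> x \<oplus> z \<otimes> y"
      using assms by (metis m.m_comm)
  next
    fix x assume "x \<in> carrier R"
    then show "x \<otimes> \<zero> = \<zero>" using assms by (metis m.m_comm)
  qed (use assms in auto)
qed

text \<open>The degree 0 part of the localization keeps the operations and only shrinks the carrier,
  so closure is all that has to be checked for it.\<close>

lemma (in csemiring) csemiring_carrier_update:
  assumes "S \<subseteq> carrier R" "\<zero> \<in> S" "\<one> \<in> S"
    "\<And>x y. x \<in> S \<Longrightarrow> y \<in> S \<Longrightarrow> x \<oplus> y \<in> S" "\<And>x y. x \<in> S \<Longrightarrow> y \<in> S \<Longrightarrow> x \<otimes> y \<in> S"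
  shows "csemiring (R\<lparr>carrier := S\<rparr>)"
  by (rule csemiringI)
    (use assms in \<open>auto simp: subset_iff a_assoc m_assoc l_distr intro: a_comm m_comm\<close>)

text \<open>The target is the type \<open>rat\<close> instead of a ring record, so that values are
  computed with ordinary arithmetic. Values outside the carrier are unconstrained.\<close>

definition character :: "('k, 'm) ring_scheme \<Rightarrow> ('k \<Rightarrow> rat) \<Rightarrow> bool" where
  "character R \<phi> \<longleftrightarrow> \<phi> \<zero>\<^bsub>R\<^esub> = 0 \<and> \<phi> \<one>\<^bsub>R\<^esub> = 1 \<and>
     (\<forall>x\<in>carrier R. \<forall>y\<in>carrier R. \<phi> (x \<oplus>\<^bsub>R\<^esub> y) = \<phi> x + \<phi> y \<and> \<phi> (x \<otimes>\<^bsub>R\<^esub> y) = \<phi> x * \<phi> y)"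

lemma character_pow:
  assumes "monoid R" "character R \<phi>" "x \<in> carrier R"
  shows "\<phi> (x [^]\<^bsub>R\<^esub> (n::nat)) = \<phi> x ^ n"
proof -
  interpret monoid R by fact
  show ?thesis
    using assms by (induction n) (auto simp: character_def)
qed

subsection \<open>Localization\<close>

locale localized = csemiring +
  fixes s assumes s [simp]: "s \<in> carrier R"
begin

lemma loc_rel_iff: "((a, k), (b, l)) \<in> loc_rel R s \<longleftrightarrow> a \<in> carrier R \<and> b \<in> carrier R \<and>
     (\<exists>m::nat. a \<otimes> s [^] (l + m) = b \<otimes> s [^] (k + m))"
  by (auto simp: loc_rel_def)

lemma loc_relI: "a \<in> carrier R \<Longrightarrow> b \<in> carrier R \<Longrightarrow> a \<otimes> s [^] (l + m) = b \<otimes> s [^] (k + (m::nat))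
    \<Longrightarrow> ((a, k), (b, l)) \<in> loc_rel R s"
  by (auto simp: loc_rel_iff)

lemma equiv_loc_rel: "equiv (carrier R \<times> UNIV) (loc_rel R s)"
proof (rule equivI)
  show "loc_rel R s \<subseteq> (carrier R \<times> UNIV) \<times> carrier R \<times> UNIV" by (auto simp: loc_rel_def)
  show "refl_on (carrier R \<times> UNIV) (loc_rel R s)"
    by (auto simp: refl_on_def loc_rel_iff)
  show "sym (loc_rel R s)" unfolding sym_def by (auto simp: loc_rel_iff) metis+
  show "trans (loc_rel R s)"
  proof (rule transI)
    fix x y z assume xy: "(x, y) \<in> loc_rel R s" and yz: "(y, z) \<in> loc_rel R s"
    obtain a k b l c p where [simp]: "x = (a, k)" "y = (b, l)" "z = (c, p)"
      by (metis surj_pair)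
    from xy yz obtain m m' :: nat where 1: "a \<otimes> s [^] (l + m) = b \<otimes> s [^] (k + m)"
      and 2: "b \<otimes> s [^] (p + m') = c \<otimes> s [^] (l + m')"
      and [simp]: "a \<in> carrier R" "b \<in> carrier R" "c \<in> carrier R"
      by (auto simp: loc_rel_iff)
    \<comment> \<open>\<open>s\<close> need not be cancellable, so the middle denominator cannot be
      removed; it goes into the free exponent of the relation together with \<open>m\<close> and
      \<open>m'\<close>.\<close>
    have "a \<otimes> s [^] (p + (l + m + m')) = (a \<otimes> s [^] (l + m)) \<otimes> s [^] (p + m')"
      by (simp add: nat_pow_mult m_assoc add_ac)
    also have "\<dots> = (b \<otimes> s [^] (p + m')) \<otimes> s [^] (k + m)"
      unfolding 1 by (simp add: m_ac)
    also have "\<dots> = (c \<otimes> s [^] (l + m')) \<otimes> s [^] (k + m)"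
      by (simp only: 2)
    also have "\<dots> = c \<otimes> s [^] (k + (l + m + m'))"
      by (simp add: nat_pow_mult m_assoc add_ac)
    finally show "(x, z) \<in> loc_rel R s" by (auto intro: loc_relI)
  qed
qed

lemma fraction_eqI:
  "a \<in> carrier R \<Longrightarrow> b \<in> carrier R \<Longrightarrow> a \<otimes> s [^] (l + m) = b \<otimes> s [^] (k + (m::nat))
    \<Longrightarrow> fraction R s a k = fraction R s b l"
  unfolding fraction_def by (rule equiv_class_eq[OF equiv_loc_rel]) (rule loc_relI)

lemma fraction_pow:
  "a \<in> carrier R \<Longrightarrow> fraction R s (a \<otimes> s [^] m) (k + m) = fraction R s a k"
  by (rule fraction_eqI[where m = 0]) (simp_all add: m_assoc nat_pow_mult add_ac)

lemma fraction_self: "a \<in> carrier R \<Longrightarrow> (a, k) \<in> fraction R s a k"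
  unfolding fraction_def by (rule equiv_class_self[OF equiv_loc_rel]) auto

lemma fraction_memE:
  assumes "(b, l) \<in> fraction R s a k"
  obtains m :: nat where "a \<in> carrier R" "b \<in> carrier R" "a \<otimes> s [^] (l + m) = b \<otimes> s [^] (k + m)"
  using assms unfolding fraction_def by (auto simp: loc_rel_iff)

abbreviation "L \<equiv> localization R s"

lemma carrier_L: "carrier L = {fraction R s a k | a k. a \<in> carrier R}"
  by (auto simp: localization_def quotient_def fraction_def)

lemma fraction_in_L [intro]: "a \<in> carrier R \<Longrightarrow> fraction R s a k \<in> carrier L"
  unfolding carrier_L by blast

lemma L_mult:
  assumes [simp]: "a \<in> carrier R" "b \<in> carrier R"
  shows "fraction R s a k \<otimes>\<^bsub>L\<^esub> fraction R s b l = fraction R s (a \<otimes> b) (k + l)"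
  unfolding localization_def monoid.simps
proof (rule UN2_const)
  fix a' k' b' l' assume "(a', k') \<in> fraction R s a k" "(b', l') \<in> fraction R s b l"
  then obtain m n :: nat where [simp]: "a' \<in> carrier R" "b' \<in> carrier R" and
    1: "a \<otimes> s [^] (k' + m) = a' \<otimes> s [^] (k + m)" and 2: "b \<otimes> s [^] (l' + n) = b' \<otimes> s [^] (l + n)"
    by (meson fraction_memE)
  have "(a' \<otimes> b') \<otimes> s [^] (k + l + (m + n)) = (a' \<otimes> s [^] (k + m)) \<otimes> (b' \<otimes> s [^] (l + n))"
    by (simp add: m_ac flip: nat_pow_mult)
  also have "\<dots> = (a \<otimes> b) \<otimes> s [^] (k' + l' + (m + n))"
    unfolding 1[symmetric] 2[symmetric] by (simp add: m_ac flip: nat_pow_mult)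
  finally show "fraction R s (a' \<otimes> b') (k' + l') = fraction R s (a \<otimes> b) (k + l)"
    by (intro fraction_eqI) auto
qed (use fraction_self[of a k] fraction_self[of b l] assms in blast)+

lemma L_add:
  assumes [simp]: "a \<in> carrier R" "b \<in> carrier R"
  shows "fraction R s a k \<oplus>\<^bsub>L\<^esub> fraction R s b l
    = fraction R s (a \<otimes> s [^] l \<oplus> b \<otimes> s [^] k) (k + l)"
  unfolding localization_def ring_record_simps
proof (rule UN2_const)
  fix a' k' b' l' assume "(a', k') \<in> fraction R s a k" "(b', l') \<in> fraction R s b l"
  then obtain m n :: nat where [simp]: "a' \<in> carrier R" "b' \<in> carrier R" and
    1: "a \<otimes> s [^] (k' + m) = a' \<otimes> s [^] (k + m)" and 2: "b \<otimes> s [^] (l' + n) = b' \<otimes> s [^] (l + n)"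
    by (meson fraction_memE)
  have "(a' \<otimes> s [^] l' \<oplus> b' \<otimes> s [^] k') \<otimes> s [^] (k + l + (m + n))
      = (a' \<otimes> s [^] (k + m)) \<otimes> s [^] (l' + l + n) \<oplus> (b' \<otimes> s [^] (l + n)) \<otimes> s [^] (k' + k + m)"
    by (simp add: l_distr r_distr m_ac flip: nat_pow_mult)
  also have "\<dots> = (a \<otimes> s [^] l \<oplus> b \<otimes> s [^] k) \<otimes> s [^] (k' + l' + (m + n))"
    unfolding 1[symmetric] 2[symmetric] by (simp add: l_distr r_distr m_ac flip: nat_pow_mult)
  finally show "fraction R s (a' \<otimes> s [^] l' \<oplus> b' \<otimes> s [^] k') (k' + l')
      = fraction R s (a \<otimes> s [^] l \<oplus> b \<otimes> s [^] k) (k + l)"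
    by (intro fraction_eqI) auto
qed (use fraction_self[of a k] fraction_self[of b l] assms in blast)+

lemma L_add_same:
  assumes [simp]: "a \<in> carrier R" "b \<in> carrier R"
  shows "fraction R s a k \<oplus>\<^bsub>L\<^esub> fraction R s b k = fraction R s (a \<oplus> b) k"
  using fraction_pow[of "a \<oplus> b" k k] by (simp add: L_add l_distr)

lemma L_zero: "\<zero>\<^bsub>L\<^esub> = fraction R s \<zero> k"
  by (simp add: localization_def) (rule fraction_eqI, auto)

lemma L_one: "\<one>\<^bsub>L\<^esub> = fraction R s \<one> 0"
  by (simp add: localization_def)

lemma csemiring_L: "csemiring L"
proof (rule csemiringI)
  show "\<zero>\<^bsub>L\<^esub> \<in> carrier L" using L_zero[of 0] by (auto simp: carrier_L)
  show "\<one>\<^bsub>L\<^esub> \<in> carrier L" using L_one by (auto simp: carrier_L)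
next
  fix x y z assume "x \<in> carrier L" "y \<in> carrier L" "z \<in> carrier L"
  then obtain a k b l c p where [simp]: "x = fraction R s a k" "y = fraction R s b l"
    "z = fraction R s c p" "a \<in> carrier R" "b \<in> carrier R" "c \<in> carrier R"
    by (auto simp: carrier_L)
  show "x \<oplus>\<^bsub>L\<^esub> y \<oplus>\<^bsub>L\<^esub> z = x \<oplus>\<^bsub>L\<^esub> (y \<oplus>\<^bsub>L\<^esub> z)"
    by (simp add: L_add l_distr r_distr m_ac a_ac add_ac flip: nat_pow_mult)
  show "x \<otimes>\<^bsub>L\<^esub> y \<otimes>\<^bsub>L\<^esub> z = x \<otimes>\<^bsub>L\<^esub> (y \<otimes>\<^bsub>L\<^esub> z)"
    by (simp add: L_mult m_ac add_ac)
  \<comment> \<open>Adding over the common denominator counts \<open>s [^] p\<close> twice; the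
    surplus factor is cancelled by \<open>fraction_pow\<close>.\<close>
  have "x \<otimes>\<^bsub>L\<^esub> z \<oplus>\<^bsub>L\<^esub> y \<otimes>\<^bsub>L\<^esub> z
      = fraction R s (((a \<otimes> s [^] l \<oplus> b \<otimes> s [^] k) \<otimes> c) \<otimes> s [^] p) ((k + l + p) + p)"
    by (simp add: L_add L_mult l_distr r_distr m_ac add_ac flip: nat_pow_mult)
  also have "\<dots> = (x \<oplus>\<^bsub>L\<^esub> y) \<otimes>\<^bsub>L\<^esub> z"
    by (subst fraction_pow) (simp_all add: L_add L_mult)
  finally show "(x \<oplus>\<^bsub>L\<^esub> y) \<otimes>\<^bsub>L\<^esub> z = x \<otimes>\<^bsub>L\<^esub> z \<oplus>\<^bsub>L\<^esub> y \<otimes>\<^bsub>L\<^esub> z" ..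
next
  fix x y assume "x \<in> carrier L" "y \<in> carrier L"
  then obtain a k b l where [simp]: "x = fraction R s a k" "y = fraction R s b l"
    "a \<in> carrier R" "b \<in> carrier R"
    by (auto simp: carrier_L)
  show "x \<oplus>\<^bsub>L\<^esub> y \<in> carrier L" "x \<otimes>\<^bsub>L\<^esub> y \<in> carrier L"
    unfolding carrier_L by (auto simp: L_add L_mult)
  show "x \<oplus>\<^bsub>L\<^esub> y = y \<oplus>\<^bsub>L\<^esub> x" by (simp add: L_add a_ac add_ac)
  show "x \<otimes>\<^bsub>L\<^esub> y = y \<otimes>\<^bsub>L\<^esub> x" by (simp add: L_mult m_ac add_ac)
next
  fix x assume "x \<in> carrier L"
  then obtain a k where [simp]: "x = fraction R s a k" "a \<in> carrier R"
    by (auto simp: carrier_L)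
  show "\<zero>\<^bsub>L\<^esub> \<oplus>\<^bsub>L\<^esub> x = x" by (simp add: L_zero[of 0] L_add)
  show "\<one>\<^bsub>L\<^esub> \<otimes>\<^bsub>L\<^esub> x = x" by (simp add: L_one L_mult)
  show "\<zero>\<^bsub>L\<^esub> \<otimes>\<^bsub>L\<^esub> x = \<zero>\<^bsub>L\<^esub>" by (simp add: L_zero[of k] L_mult) (rule fraction_eqI, auto)
qed

text \<open>The denominator is ignored, which is consistent for a character with value 1 on the
  inverted element.\<close>

definition loc_lift :: "('a \<Rightarrow> rat) \<Rightarrow> ('a \<times> nat) set \<Rightarrow> rat" where
  "loc_lift \<phi> X = the_elem ((\<phi> \<circ> fst) ` X)"

lemma loc_lift_fraction:
  assumes "character R \<phi>" "\<phi> s = 1" "a \<in> carrier R"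
  shows "loc_lift \<phi> (fraction R s a k) = \<phi> a"
  unfolding loc_lift_def
proof (rule the_elem_image_const)
  show "(a, k) \<in> fraction R s a k" using assms by (simp add: fraction_self)
  fix y assume "y \<in> fraction R s a k"
  then obtain b l m where [simp]: "y = (b, l)" and b: "b \<in> carrier R"
    and eq: "a \<otimes> s [^] (l + m) = b \<otimes> s [^] (k + (m::nat))"
    by (metis fraction_memE surj_pair)
  from eq have "\<phi> (a \<otimes> s [^] (l + m)) = \<phi> (b \<otimes> s [^] (k + m))" by simp
  then show "(\<phi> \<circ> fst) y = \<phi> a"
    using assms b character_pow[OF monoid_axioms assms(1) s] by (simp add: character_def)
qed

lemma character_loc_lift:
  assumes \<phi>: "character R \<phi>" and s1: "\<phi> s = 1"
  shows "character L (loc_lift \<phi>)"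
proof -
  have p: "\<phi> (s [^] (n::nat)) = 1" for n
    using character_pow[OF monoid_axioms \<phi> s] s1 by simp
  have "loc_lift \<phi> (x \<oplus>\<^bsub>L\<^esub> y) = loc_lift \<phi> x + loc_lift \<phi> y \<and> loc_lift \<phi> (x \<otimes>\<^bsub>L\<^esub> y) = loc_lift \<phi> x * loc_lift \<phi> y"
    if "x \<in> carrier L" "y \<in> carrier L" for x y
    using that p \<phi> by (auto simp: carrier_L L_add L_mult loc_lift_fraction[OF \<phi> s1] character_def)
  then show ?thesis
    using \<phi> unfolding character_def
    by (auto simp: L_zero[of 0] L_one loc_lift_fraction[OF \<phi> s1])
qed

end

lemma (in csemiring) localizedI: "s \<in> carrier R \<Longrightarrow> localized R s"
  by unfold_locales

subsection \<open>Additive inverses\<close>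

context csemiring
begin

abbreviation "C \<equiv> ring_completion R"

lemma compl_rel_iff: "((a, b), (c, d)) \<in> compl_rel R \<longleftrightarrow>
   a \<in> carrier R \<and> b \<in> carrier R \<and> c \<in> carrier R \<and> d \<in> carrier R \<and>
   (\<exists>k\<in>carrier R. (a \<oplus> d) \<oplus> k = (c \<oplus> b) \<oplus> k)"
  by (auto simp: compl_rel_def)

lemma equiv_compl_rel: "equiv (carrier R \<times> carrier R) (compl_rel R)"
proof (rule equivI)
  show "compl_rel R \<subseteq> (carrier R \<times> carrier R) \<times> carrier R \<times> carrier R" by (auto simp: compl_rel_def)
  show "refl_on (carrier R \<times> carrier R) (compl_rel R)"
    by (auto simp: refl_on_def compl_rel_iff)
  show "sym (compl_rel R)" unfolding sym_def by (auto simp: compl_rel_iff) metis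
  show "trans (compl_rel R)"
  proof (rule transI)
    fix x y z assume xy: "(x, y) \<in> compl_rel R" and yz: "(y, z) \<in> compl_rel R"
    obtain a b c d e f where [simp]: "x = (a, b)" "y = (c, d)" "z = (e, f)"
      by (metis surj_pair)
    from xy yz obtain k k' where 1: "(a \<oplus> d) \<oplus> k = (c \<oplus> b) \<oplus> k"
      and 2: "(c \<oplus> f) \<oplus> k' = (e \<oplus> d) \<oplus> k'"
      and [simp]: "a \<in> carrier R" "b \<in> carrier R" "c \<in> carrier R" "d \<in> carrier R" "e \<in> carrier R"
        "f \<in> carrier R" "k \<in> carrier R" "k' \<in> carrier R"
      by (auto simp: compl_rel_iff)
    \<comment> \<open>Sums cannot be cancelled in a semiring: the middle pair \<open>c\<close>,
      \<open>d\<close> is absorbed in the auxiliary summand of the relation.\<close>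
    have "(a \<oplus> f) \<oplus> (c \<oplus> d \<oplus> k \<oplus> k') = ((a \<oplus> d) \<oplus> k) \<oplus> ((c \<oplus> f) \<oplus> k')"
      by (simp add: a_ac)
    also have "\<dots> = (e \<oplus> b) \<oplus> (c \<oplus> d \<oplus> k \<oplus> k')"
      unfolding 1 2 by (simp add: a_ac)
    finally have "\<exists>k\<in>carrier R. (a \<oplus> f) \<oplus> k = (e \<oplus> b) \<oplus> k" by (rule bexI) simp
    then show "(x, z) \<in> compl_rel R" by (simp add: compl_rel_iff)
  qed
qed

lemma formal_diff_eqI:
  assumes "a \<in> carrier R" "b \<in> carrier R" "c \<in> carrier R" "d \<in> carrier R" "k \<in> carrier R"
    "(a \<oplus> d) \<oplus> k = (c \<oplus> b) \<oplus> k"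
  shows "formal_diff R a b = formal_diff R c d"
  unfolding formal_diff_def
  by (rule equiv_class_eq[OF equiv_compl_rel]) (use assms in \<open>auto simp: compl_rel_iff\<close>)

lemma formal_diff_eqI':
  assumes "a \<in> carrier R" "b \<in> carrier R" "c \<in> carrier R" "d \<in> carrier R"
    "a \<oplus> d = c \<oplus> b"
  shows "formal_diff R a b = formal_diff R c d"
  by (rule formal_diff_eqI[of _ _ _ _ \<zero>]) (use assms in auto)

lemma formal_diff_self: "a \<in> carrier R \<Longrightarrow> b \<in> carrier R \<Longrightarrow> (a, b) \<in> formal_diff R a b"
  unfolding formal_diff_def by (rule equiv_class_self[OF equiv_compl_rel]) auto

lemma formal_diff_memE:
  assumes "(c, d) \<in> formal_diff R a b"
  obtains k where "a \<in> carrier R" "b \<in> carrier R" "c \<in> carrier R" "d \<in> carrier R"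
    "k \<in> carrier R" "(a \<oplus> d) \<oplus> k = (c \<oplus> b) \<oplus> k"
  using assms unfolding formal_diff_def by (auto simp: compl_rel_iff)

lemma carrier_C: "carrier C = {formal_diff R a b | a b. a \<in> carrier R \<and> b \<in> carrier R}"
  by (auto simp: ring_completion_def quotient_def formal_diff_def)

lemma formal_diff_in_C [intro]:
  "a \<in> carrier R \<Longrightarrow> b \<in> carrier R \<Longrightarrow> formal_diff R a b \<in> carrier C"
  unfolding carrier_C by blast

lemma C_add:
  assumes [simp]: "a \<in> carrier R" "b \<in> carrier R" "c \<in> carrier R" "d \<in> carrier R"
  shows "formal_diff R a b \<oplus>\<^bsub>C\<^esub> formal_diff R c d = formal_diff R (a \<oplus> c) (b \<oplus> d)"
  unfolding ring_completion_def ring_record_simps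
proof (rule UN2_const)
  fix a' b' c' d' assume "(a', b') \<in> formal_diff R a b" "(c', d') \<in> formal_diff R c d"
  then obtain k l where [simp]: "a' \<in> carrier R" "b' \<in> carrier R" "c' \<in> carrier R" "d' \<in> carrier R"
    "k \<in> carrier R" "l \<in> carrier R"
    and 1: "(a \<oplus> b') \<oplus> k = (a' \<oplus> b) \<oplus> k" and 2: "(c \<oplus> d') \<oplus> l = (c' \<oplus> d) \<oplus> l"
    by (meson formal_diff_memE)
  have "(a' \<oplus> c') \<oplus> (b \<oplus> d) \<oplus> (k \<oplus> l) = ((a' \<oplus> b) \<oplus> k) \<oplus> ((c' \<oplus> d) \<oplus> l)" by (simp add: a_ac)
  also have "\<dots> = (a \<oplus> c) \<oplus> (b' \<oplus> d') \<oplus> (k \<oplus> l)"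
    unfolding 1[symmetric] 2[symmetric] by (simp add: a_ac)
  finally show "formal_diff R (a' \<oplus> c') (b' \<oplus> d') = formal_diff R (a \<oplus> c) (b \<oplus> d)"
    by (intro formal_diff_eqI) auto
qed (use formal_diff_self[of a b] formal_diff_self[of c d] assms in blast)+

lemma C_mult:
  assumes [simp]: "a \<in> carrier R" "b \<in> carrier R" "c \<in> carrier R" "d \<in> carrier R"
  shows "formal_diff R a b \<otimes>\<^bsub>C\<^esub> formal_diff R c d
    = formal_diff R (a \<otimes> c \<oplus> b \<otimes> d) (a \<otimes> d \<oplus> b \<otimes> c)"
  unfolding ring_completion_def monoid.simps
proof (rule UN2_const)
  fix a' b' c' d' assume "(a', b') \<in> formal_diff R a b" "(c', d') \<in> formal_diff R c d"
  then obtain k l where [simp]: "a' \<in> carrier R" "b' \<in> carrier R" "c' \<in> carrier R" "d' \<in> carrier R"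
    "k \<in> carrier R" "l \<in> carrier R"
    and 1: "(a \<oplus> b') \<oplus> k = (a' \<oplus> b) \<oplus> k" and 2: "(c \<oplus> d') \<oplus> l = (c' \<oplus> d) \<oplus> l"
    by (meson formal_diff_memE)
  \<comment> \<open>Representatives are changed one factor at a time. The relation of the first pair
    is multiplied by \<open>c'\<close> and its mirror image by \<open>d'\<close>, which explains the
    auxiliary summand \<open>k \<otimes> c' \<oplus> k \<otimes> d'\<close>.\<close>
  have "(a' \<otimes> c' \<oplus> b' \<otimes> d') \<oplus> (a \<otimes> d' \<oplus> b \<otimes> c') \<oplus> (k \<otimes> c' \<oplus> k \<otimes> d')
      = (a' \<oplus> b \<oplus> k) \<otimes> c' \<oplus> (a \<oplus> b' \<oplus> k) \<otimes> d'" by (simp add: l_distr a_ac)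
  then have "(a' \<otimes> c' \<oplus> b' \<otimes> d') \<oplus> (a \<otimes> d' \<oplus> b \<otimes> c') \<oplus> (k \<otimes> c' \<oplus> k \<otimes> d')
      = (a \<oplus> b' \<oplus> k) \<otimes> c' \<oplus> (a' \<oplus> b \<oplus> k) \<otimes> d'" by (simp only: 1)
  then have "(a' \<otimes> c' \<oplus> b' \<otimes> d') \<oplus> (a \<otimes> d' \<oplus> b \<otimes> c') \<oplus> (k \<otimes> c' \<oplus> k \<otimes> d')
      = (a \<otimes> c' \<oplus> b \<otimes> d') \<oplus> (a' \<otimes> d' \<oplus> b' \<otimes> c') \<oplus> (k \<otimes> c' \<oplus> k \<otimes> d')"
    by (simp add: l_distr a_ac)
  then have "formal_diff R (a' \<otimes> c' \<oplus> b' \<otimes> d') (a' \<otimes> d' \<oplus> b' \<otimes> c')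
      = formal_diff R (a \<otimes> c' \<oplus> b \<otimes> d') (a \<otimes> d' \<oplus> b \<otimes> c')"
    by (intro formal_diff_eqI) auto
  also have "\<dots> = formal_diff R (a \<otimes> c \<oplus> b \<otimes> d) (a \<otimes> d \<oplus> b \<otimes> c)"
  proof -
    have "(a \<otimes> c' \<oplus> b \<otimes> d') \<oplus> (a \<otimes> d \<oplus> b \<otimes> c) \<oplus> (a \<otimes> l \<oplus> b \<otimes> l)
        = a \<otimes> (c' \<oplus> d \<oplus> l) \<oplus> b \<otimes> (c \<oplus> d' \<oplus> l)" by (simp add: r_distr a_ac)
    then have "(a \<otimes> c' \<oplus> b \<otimes> d') \<oplus> (a \<otimes> d \<oplus> b \<otimes> c) \<oplus> (a \<otimes> l \<oplus> b \<otimes> l)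
        = a \<otimes> (c \<oplus> d' \<oplus> l) \<oplus> b \<otimes> (c' \<oplus> d \<oplus> l)" by (simp only: 2)
    then have "(a \<otimes> c' \<oplus> b \<otimes> d') \<oplus> (a \<otimes> d \<oplus> b \<otimes> c) \<oplus> (a \<otimes> l \<oplus> b \<otimes> l)
        = (a \<otimes> c \<oplus> b \<otimes> d) \<oplus> (a \<otimes> d' \<oplus> b \<otimes> c') \<oplus> (a \<otimes> l \<oplus> b \<otimes> l)" by (simp add: r_distr a_ac)
    then show ?thesis
      by (intro formal_diff_eqI[where k = "a \<otimes> l \<oplus> b \<otimes> l"]) auto
  qed
  finally show "formal_diff R (a' \<otimes> c' \<oplus> b' \<otimes> d') (a' \<otimes> d' \<oplus> b' \<otimes> c')
     = formal_diff R (a \<otimes> c \<oplus> b \<otimes> d) (a \<otimes> d \<oplus> b \<otimes> c)" .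
qed (use formal_diff_self[of a b] formal_diff_self[of c d] assms in blast)+

lemma C_zero: "\<zero>\<^bsub>C\<^esub> = formal_diff R \<zero> \<zero>"
  by (simp add: ring_completion_def)

lemma C_one: "\<one>\<^bsub>C\<^esub> = formal_diff R \<one> \<zero>"
  by (simp add: ring_completion_def)

lemma cring_C: "cring C"
proof (rule cringI)
  show "abelian_group C"
  proof (rule abelian_groupI)
    show "\<zero>\<^bsub>C\<^esub> \<in> carrier C" by (auto simp: C_zero)
    fix x assume "x \<in> carrier C"
    then obtain a b where [simp]: "x = formal_diff R a b" "a \<in> carrier R" "b \<in> carrier R"
      by (auto simp: carrier_C)
    show "\<zero>\<^bsub>C\<^esub> \<oplus>\<^bsub>C\<^esub> x = x" by (simp add: C_zero C_add)
    show "\<exists>y\<in>carrier C. y \<oplus>\<^bsub>C\<^esub> x = \<zero>\<^bsub>C\<^esub>"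
    proof (rule bexI)
      show "formal_diff R b a \<oplus>\<^bsub>C\<^esub> x = \<zero>\<^bsub>C\<^esub>"
        by (simp add: C_zero C_add, rule formal_diff_eqI') (simp_all add: a_comm)
      show "formal_diff R b a \<in> carrier C" by auto
    qed
    fix y assume "y \<in> carrier C"
    then obtain c d where [simp]: "y = formal_diff R c d" "c \<in> carrier R" "d \<in> carrier R"
      by (auto simp: carrier_C)
    show "x \<oplus>\<^bsub>C\<^esub> y \<in> carrier C" by (auto simp: C_add)
    show "x \<oplus>\<^bsub>C\<^esub> y = y \<oplus>\<^bsub>C\<^esub> x" by (simp add: C_add a_comm)
    fix z assume "z \<in> carrier C"
    then obtain e f where [simp]: "z = formal_diff R e f" "e \<in> carrier R" "f \<in> carrier R"
      by (auto simp: carrier_C)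
    show "x \<oplus>\<^bsub>C\<^esub> y \<oplus>\<^bsub>C\<^esub> z = x \<oplus>\<^bsub>C\<^esub> (y \<oplus>\<^bsub>C\<^esub> z)" by (simp add: C_add a_assoc)
  qed
  show "comm_monoid C"
  proof (rule comm_monoidI)
    show "\<one>\<^bsub>C\<^esub> \<in> carrier C" by (auto simp: C_one)
    fix x assume "x \<in> carrier C"
    then obtain a b where [simp]: "x = formal_diff R a b" "a \<in> carrier R" "b \<in> carrier R"
      by (auto simp: carrier_C)
    show "\<one>\<^bsub>C\<^esub> \<otimes>\<^bsub>C\<^esub> x = x" by (simp add: C_one C_mult)
    fix y assume "y \<in> carrier C"
    then obtain c d where [simp]: "y = formal_diff R c d" "c \<in> carrier R" "d \<in> carrier R"
      by (auto simp: carrier_C)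
    show "x \<otimes>\<^bsub>C\<^esub> y \<in> carrier C" by (auto simp: C_mult)
    show "x \<otimes>\<^bsub>C\<^esub> y = y \<otimes>\<^bsub>C\<^esub> x" by (simp add: C_mult a_ac m_ac)
    fix z assume "z \<in> carrier C"
    then obtain e f where [simp]: "z = formal_diff R e f" "e \<in> carrier R" "f \<in> carrier R"
      by (auto simp: carrier_C)
    show "x \<otimes>\<^bsub>C\<^esub> y \<otimes>\<^bsub>C\<^esub> z = x \<otimes>\<^bsub>C\<^esub> (y \<otimes>\<^bsub>C\<^esub> z)"
      by (simp add: C_mult a_ac m_ac l_distr r_distr)
  qed
  fix x y z assume "x \<in> carrier C" "y \<in> carrier C" "z \<in> carrier C"
  then obtain a b c d e f where [simp]: "x = formal_diff R a b" "a \<in> carrier R" "b \<in> carrier R"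
    "y = formal_diff R c d" "c \<in> carrier R" "d \<in> carrier R"
    "z = formal_diff R e f" "e \<in> carrier R" "f \<in> carrier R"
    by (auto simp: carrier_C)
  show "(x \<oplus>\<^bsub>C\<^esub> y) \<otimes>\<^bsub>C\<^esub> z = x \<otimes>\<^bsub>C\<^esub> z \<oplus>\<^bsub>C\<^esub> y \<otimes>\<^bsub>C\<^esub> z"
    by (simp add: C_mult C_add a_ac l_distr)
qed

lemma C_uminus:
  assumes "a \<in> carrier R" "b \<in> carrier R"
  shows "\<ominus>\<^bsub>C\<^esub> formal_diff R a b = formal_diff R b a"
proof -
  interpret C: cring C by (rule cring_C)
  show ?thesis
  proof (rule C.minus_equality)
    show "formal_diff R b a \<oplus>\<^bsub>C\<^esub> formal_diff R a b = \<zero>\<^bsub>C\<^esub>"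
      using assms by (simp add: C_zero C_add, intro formal_diff_eqI') (simp_all add: a_comm)
  qed (use assms in auto)
qed

definition compl_lift :: "('a \<Rightarrow> rat) \<Rightarrow> ('a \<times> 'a) set \<Rightarrow> rat" where
  "compl_lift \<phi> X = the_elem ((\<lambda>(a, b). \<phi> a - \<phi> b) ` X)"

lemma compl_lift_formal_diff:
  assumes "character R \<phi>" "a \<in> carrier R" "b \<in> carrier R"
  shows "compl_lift \<phi> (formal_diff R a b) = \<phi> a - \<phi> b"
  unfolding compl_lift_def
proof (rule the_elem_image_const)
  show "(a, b) \<in> formal_diff R a b" using assms by (simp add: formal_diff_self)
  fix y assume "y \<in> formal_diff R a b"
  then obtain c d k where [simp]: "y = (c, d)" and c: "c \<in> carrier R" "d \<in> carrier R" "k \<in> carrier R"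
    and eq: "(a \<oplus> d) \<oplus> k = (c \<oplus> b) \<oplus> k"
    by (metis formal_diff_memE surj_pair)
  from eq have "\<phi> ((a \<oplus> d) \<oplus> k) = \<phi> ((c \<oplus> b) \<oplus> k)" by simp
  then show "(\<lambda>(a, b). \<phi> a - \<phi> b) y = \<phi> a - \<phi> b"
    using assms c by (simp add: character_def)
qed

lemma character_compl_lift:
  assumes \<phi>: "character R \<phi>"
  shows "character C (compl_lift \<phi>)"
proof -
  note [simp] = compl_lift_formal_diff[OF \<phi>]
  have "compl_lift \<phi> (x \<oplus>\<^bsub>C\<^esub> y) = compl_lift \<phi> x + compl_lift \<phi> y
      \<and> compl_lift \<phi> (x \<otimes>\<^bsub>C\<^esub> y) = compl_lift \<phi> x * compl_lift \<phi> y"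
    if "x \<in> carrier C" "y \<in> carrier C" for x y
    using that \<phi> by (auto simp: carrier_C C_add C_mult character_def algebra_simps)
  then show ?thesis
    using \<phi> unfolding character_def by (auto simp: C_zero C_one)
qed

end

subsection \<open>Tensoring with the rationals\<close>

context cring
begin

abbreviation "F \<equiv> rat_free_ring R"
abbreviation "T \<equiv> rat_tensor R"

lemma F_simps:
  "carrier F = {c. Poly_Mapping.keys c \<subseteq> UNIV \<times> carrier R}"
  "\<zero>\<^bsub>F\<^esub> = 0" "\<one>\<^bsub>F\<^esub> = frag_of (1, \<one>)" "c \<oplus>\<^bsub>F\<^esub> d = c + d"
  by (simp_all add: rat_free_ring_def)

lemma F_mult_of: "frag_of (q, x) \<otimes>\<^bsub>F\<^esub> frag_of (r, y) = frag_of (q * r, x \<otimes> y)"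
  by (simp add: rat_free_ring_def)

lemma F_mult_diff_l: "(a - b) \<otimes>\<^bsub>F\<^esub> c = a \<otimes>\<^bsub>F\<^esub> c - b \<otimes>\<^bsub>F\<^esub> c"
  by (simp add: rat_free_ring_def frag_extend_diff)

lemma F_mult_zero_l: "0 \<otimes>\<^bsub>F\<^esub> c = 0"
  by (simp add: rat_free_ring_def)

lemma F_mult_diff_r: "c \<otimes>\<^bsub>F\<^esub> (a - b) = c \<otimes>\<^bsub>F\<^esub> a - c \<otimes>\<^bsub>F\<^esub> b"
proof -
  have "Poly_Mapping.keys c \<subseteq> UNIV" by simp
  then show ?thesis
    by (induction c rule: frag_induction)
      (auto simp: rat_free_ring_def frag_extend_diff)
qed

lemma F_mult_zero_r: "c \<otimes>\<^bsub>F\<^esub> 0 = 0"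
  using F_mult_diff_r[of c 0 0] by simp

lemma F_of_closed [simp]: "x \<in> carrier R \<Longrightarrow> frag_of (q, x) \<in> carrier F"
  by (simp add: F_simps)

lemma F_diff_closed: "c \<in> carrier F \<Longrightarrow> d \<in> carrier F \<Longrightarrow> c - d \<in> carrier F"
  unfolding F_simps using keys_diff[of c d] by blast

text \<open>The product is biadditive, so the ring laws have to be tested on generators only.
  Differences suffice as induction step because they produce all integer combinations from 0 and the
  generators.\<close>

lemma F_induct [consumes 1, case_names zero of diff]:
  assumes "c \<in> carrier F" "P 0" "\<And>q x. x \<in> carrier R \<Longrightarrow> P (frag_of (q, x))"
    "\<And>a b. a \<in> carrier F \<Longrightarrow> b \<in> carrier F \<Longrightarrow> P a \<Longrightarrow> P b \<Longrightarrow> P (a - b)"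
  shows "P c"
proof -
  from assms(1) have "Poly_Mapping.keys c \<subseteq> UNIV \<times> carrier R" by (simp add: F_simps)
  then have "c \<in> carrier F \<and> P c"
    by (induction c rule: frag_induction) (use assms F_diff_closed in \<open>auto simp: F_simps\<close>)
  then show ?thesis ..
qed

lemma F_mult_closed: "c \<in> carrier F \<Longrightarrow> d \<in> carrier F \<Longrightarrow> c \<otimes>\<^bsub>F\<^esub> d \<in> carrier F"
proof (induction c rule: F_induct)
  case (of q x)
  from of(2,1) show ?case
    by (induction d rule: F_induct)
      (simp_all add: F_mult_zero_r F_mult_of F_mult_diff_r F_diff_closed, simp add: F_simps)
qed (simp_all add: F_mult_zero_l F_mult_diff_l F_diff_closed, simp add: F_simps)

lemma F_mult_comm: "c \<in> carrier F \<Longrightarrow> d \<in> carrier F \<Longrightarrow> c \<otimes>\<^bsub>F\<^esub> d = d \<otimes>\<^bsub>F\<^esub> c"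
proof (induction c rule: F_induct)
  case (of q x)
  from of(2,1) show ?case
    by (induction d rule: F_induct)
      (simp_all add: F_mult_zero_r F_mult_zero_l F_mult_of F_mult_diff_r F_mult_diff_l m_comm mult.commute)
qed (simp_all add: F_mult_zero_l F_mult_zero_r F_mult_diff_l F_mult_diff_r)

lemma F_mult_assoc:
  assumes "c \<in> carrier F" "d \<in> carrier F" "e \<in> carrier F"
  shows "c \<otimes>\<^bsub>F\<^esub> d \<otimes>\<^bsub>F\<^esub> e = c \<otimes>\<^bsub>F\<^esub> (d \<otimes>\<^bsub>F\<^esub> e)"
  using assms
proof (induction c rule: F_induct)
  case (of q x)
  from of(2,3,1) show ?case
  proof (induction d rule: F_induct)
    case (of r y)
    from of(2,1,3) show ?case
      by (induction e rule: F_induct)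
        (simp_all add: F_mult_zero_r F_mult_of F_mult_diff_r m_assoc mult.assoc)
  qed (simp_all add: F_mult_zero_l F_mult_zero_r F_mult_diff_l F_mult_diff_r)
qed (simp_all add: F_mult_zero_l F_mult_zero_r F_mult_diff_l F_mult_diff_r)

lemma cring_F: "cring F"
proof (rule cringI)
  have neg: "- c \<in> carrier F" if "c \<in> carrier F" for c using that by (simp add: F_simps)
  have add: "c + d \<in> carrier F" if "c \<in> carrier F" "d \<in> carrier F" for c d
    using F_diff_closed[OF that(1) neg[OF that(2)]] by simp
  show "abelian_group F"
  proof (rule abelian_groupI)
    fix c assume "c \<in> carrier F"
    then show "\<exists>d\<in>carrier F. d \<oplus>\<^bsub>F\<^esub> c = \<zero>\<^bsub>F\<^esub>"
      by (intro bexI[of _ "- c"] neg) (simp_all add: F_simps)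
  qed (use add in \<open>auto simp: F_simps add_ac\<close>)
  show "comm_monoid F"
  proof (rule comm_monoidI)
    fix c assume "c \<in> carrier F"
    then show "\<one>\<^bsub>F\<^esub> \<otimes>\<^bsub>F\<^esub> c = c"
      by (induction c rule: F_induct) (simp_all add: F_simps(3) F_mult_zero_r F_mult_of F_mult_diff_r)
  qed (use F_mult_assoc F_mult_comm F_mult_closed in \<open>auto simp: F_simps(3)\<close>)
  fix x y z
  \<comment> \<open>Biadditivity is available in the form of differences, hence the sum is written
    as one.\<close>
  have "(x - (0 - y)) \<otimes>\<^bsub>F\<^esub> z = x \<otimes>\<^bsub>F\<^esub> z - (0 \<otimes>\<^bsub>F\<^esub> z - y \<otimes>\<^bsub>F\<^esub> z)"
    by (simp only: F_mult_diff_l)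
  then show "(x \<oplus>\<^bsub>F\<^esub> y) \<otimes>\<^bsub>F\<^esub> z = x \<otimes>\<^bsub>F\<^esub> z \<oplus>\<^bsub>F\<^esub> y \<otimes>\<^bsub>F\<^esub> z"
    by (simp add: F_simps F_mult_zero_l)
qed

section \<open>The ideal of bilinear relations and pure tensors\<close>

abbreviation "I \<equiv> Idl\<^bsub>F\<^esub> (bilinear_relations R)"

lemma bilinear_subset: "bilinear_relations R \<subseteq> carrier F"
  unfolding bilinear_relations_def by (auto intro!: F_diff_closed)

lemma ideal_I: "ideal I F"
  by (rule ring.genideal_ideal[OF cring.axioms(1)[OF cring_F] bilinear_subset])

lemma F_minus: "c \<in> carrier F \<Longrightarrow> d \<in> carrier F \<Longrightarrow> c \<ominus>\<^bsub>F\<^esub> d = c - d"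
proof -
  assume c: "c \<in> carrier F" "d \<in> carrier F"
  interpret F: cring F by (rule cring_F)
  have "\<ominus>\<^bsub>F\<^esub> d = - d"
    by (rule F.minus_equality) (use c in \<open>auto simp: F_simps\<close>)
  then show ?thesis by (simp add: a_minus_def F_simps)
qed

lemma cring_T: "cring T"
  unfolding rat_tensor_def by (rule ideal.quotient_is_cring[OF ideal_I cring_F])

definition proj :: "((rat \<times> 'a) \<Rightarrow>\<^sub>0 int) \<Rightarrow> ((rat \<times> 'a) \<Rightarrow>\<^sub>0 int) set" where
  "proj c = I +>\<^bsub>F\<^esub> c"

lemma proj_hom: "ring_hom_ring F T proj"
  using ideal.rcos_ring_hom_ring[OF ideal_I] unfolding rat_tensor_def proj_def .

lemma proj_eqI: "c \<in> carrier F \<Longrightarrow> d \<in> carrier F \<Longrightarrow> c - d \<in> I \<Longrightarrow> proj c = proj d"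
  unfolding proj_def
  using ring.quotient_eq_iff_same_a_r_cos[OF cring.axioms(1)[OF cring_F] ideal_I, of c d] by (simp add: F_minus)

lemma carrier_T: "carrier T = proj ` carrier F"
  unfolding rat_tensor_def proj_def FactRing_def A_RCOSETS_def' by auto

lemma pure_tensor_proj: "pure_tensor R q x = proj (frag_of (q, x))"
  by (simp add: pure_tensor_def proj_def)

lemma pure_tensor_closed [simp, intro]: "x \<in> carrier R \<Longrightarrow> pure_tensor R q x \<in> carrier T"
  by (simp add: pure_tensor_proj carrier_T)

lemma pure_tensor_mult:
  "x \<in> carrier R \<Longrightarrow> y \<in> carrier R \<Longrightarrow>
    pure_tensor R q x \<otimes>\<^bsub>T\<^esub> pure_tensor R r y = pure_tensor R (q * r) (x \<otimes> y)"
  by (simp add: pure_tensor_proj F_mult_of flip: ring_hom_mult[OF ring_hom_ring.homh[OF proj_hom]])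

lemma pure_tensor_one: "pure_tensor R 1 \<one> = \<one>\<^bsub>T\<^esub>"
  unfolding pure_tensor_proj using ring_hom_one[OF ring_hom_ring.homh[OF proj_hom]] by (simp add: F_simps)

lemma
  assumes "x \<in> carrier R"
  shows pure_tensor_add_l:
      "pure_tensor R (q + r) x = pure_tensor R q x \<oplus>\<^bsub>T\<^esub> pure_tensor R r x"
    and pure_tensor_add_r:
      "y \<in> carrier R \<Longrightarrow> pure_tensor R q (x \<oplus> y) = pure_tensor R q x \<oplus>\<^bsub>T\<^esub> pure_tensor R q y"
proof -
  interpret F: cring F by (rule cring_F)
  have I: "c \<in> I" if "c \<in> bilinear_relations R" for c
    using F.genideal_self[OF bilinear_subset] that by blast
  have eq: "proj a = proj b \<oplus>\<^bsub>T\<^esub> proj c"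
    if "a \<in> carrier F" "b \<in> carrier F" "c \<in> carrier F" "a - b - c \<in> I" for a b c
  proof -
    have "proj a = proj (b \<oplus>\<^bsub>F\<^esub> c)"
      by (rule proj_eqI) (use that in \<open>auto simp: F_simps(4) diff_diff_eq F.a_closed[unfolded F_simps(4)]\<close>)
    then show ?thesis
      using that ring_hom_add[OF ring_hom_ring.homh[OF proj_hom]] by simp
  qed
  show "pure_tensor R (q + r) x = pure_tensor R q x \<oplus>\<^bsub>T\<^esub> pure_tensor R r x"
    unfolding pure_tensor_proj
  proof (rule eq)
    show "frag_of (q + r, x) - frag_of (q, x) - frag_of (r, x) \<in> I"
      by (rule I) (use assms in \<open>unfold bilinear_relations_def, blast\<close>)
  qed (use assms in auto)
  assume "y \<in> carrier R"
  then show "pure_tensor R q (x \<oplus> y) = pure_tensor R q x \<oplus>\<^bsub>T\<^esub> pure_tensor R q y"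
    unfolding pure_tensor_proj
  proof (intro eq)
    show "frag_of (q, x \<oplus> y) - frag_of (q, x) - frag_of (q, y) \<in> I"
      by (rule I) (use assms \<open>y \<in> carrier R\<close> in \<open>unfold bilinear_relations_def, blast\<close>)
  qed (use assms in auto)
qed

lemma pure_tensor_zero_l: "x \<in> carrier R \<Longrightarrow> pure_tensor R 0 x = \<zero>\<^bsub>T\<^esub>"
proof -
  assume x: "x \<in> carrier R"
  interpret T: cring T by (rule cring_T)
  show ?thesis
    using pure_tensor_add_l[OF x, of 0 0] x T.add.r_cancel_one'[of "pure_tensor R 0 x" "pure_tensor R 0 x"]
    by simp
qed

lemma pure_tensor_zero_r: "pure_tensor R q \<zero> = \<zero>\<^bsub>T\<^esub>"
proof -
  interpret T: cring T by (rule cring_T)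
  show ?thesis
    using pure_tensor_add_r[of \<zero> \<zero> q] T.add.r_cancel_one'[of "pure_tensor R q \<zero>" "pure_tensor R q \<zero>"]
    by simp
qed

lemma pure_tensor_uminus_l: "x \<in> carrier R \<Longrightarrow> pure_tensor R (- q) x = \<ominus>\<^bsub>T\<^esub> pure_tensor R q x"
proof -
  assume x: "x \<in> carrier R"
  interpret T: cring T by (rule cring_T)
  have "pure_tensor R (- q) x \<oplus>\<^bsub>T\<^esub> pure_tensor R q x = \<zero>\<^bsub>T\<^esub>"
    using pure_tensor_add_l[OF x, of "- q" q] x by (simp add: pure_tensor_zero_l)
  then show ?thesis using x by (simp add: T.minus_equality)
qed

lemma pure_tensor_uminus_r: "x \<in> carrier R \<Longrightarrow> pure_tensor R q (\<ominus> x) = \<ominus>\<^bsub>T\<^esub> pure_tensor R q x"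
proof -
  assume x: "x \<in> carrier R"
  interpret T: cring T by (rule cring_T)
  have "pure_tensor R q (\<ominus> x) \<oplus>\<^bsub>T\<^esub> pure_tensor R q x = \<zero>\<^bsub>T\<^esub>"
    using pure_tensor_add_r[of "\<ominus> x" x q] x by (simp add: pure_tensor_zero_r l_neg)
  then show ?thesis using x by (simp add: T.minus_equality)
qed

text \<open>A pure tensor of q and x is the product of the scalar q \<otimes> 1 and of 1 \<otimes>
  x, and the scalars lie in every rational subalgebra by definition. So only the tensors 1 \<otimes>
  x have to be reached.\<close>

lemma rat_subalgebra_eqI:
  assumes S: "S \<subseteq> carrier T" and gen: "\<And>x. x \<in> carrier R \<Longrightarrow> pure_tensor R 1 x \<in> rat_subalgebra R S"
  shows "rat_subalgebra R S = carrier T"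
proof
  interpret T: cring T by (rule cring_T)
  have S': "range (\<lambda>q. pure_tensor R q \<one>) \<union> S \<subseteq> carrier T" using S by auto
  interpret A: subring "rat_subalgebra R S" T
    unfolding rat_subalgebra_def by (rule T.generate_ring_is_subring[OF S'])
  show "rat_subalgebra R S \<subseteq> carrier T" by (rule A.subset)
  have pt: "pure_tensor R q x \<in> rat_subalgebra R S" if x: "x \<in> carrier R" for q x
  proof -
    have "pure_tensor R q \<one> \<in> rat_subalgebra R S"
      unfolding rat_subalgebra_def by (rule generate_ring.incl) auto
    with gen[OF x] have "pure_tensor R q \<one> \<otimes>\<^bsub>T\<^esub> pure_tensor R 1 x \<in> rat_subalgebra R S"
      by (rule A.m_closed[rotated])
    then show ?thesis using x by (simp add: pure_tensor_mult)
  qed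
  have "proj c \<in> rat_subalgebra R S" if "c \<in> carrier F" for c
    using that
  proof (induction c rule: F_induct)
    case zero
    then show ?case
      using ring_hom_zero[OF ring_hom_ring.homh[OF proj_hom] cring.axioms(1)[OF cring_F] T.ring_axioms] pt[of \<one> 0]
      by (simp add: F_simps pure_tensor_zero_l)
  next
    case (diff a b)
    interpret p: ring_hom_ring F T proj by (rule proj_hom)
    have "proj (a - b) = proj a \<ominus>\<^bsub>T\<^esub> proj b"
      using diff by (simp add: a_minus_def F_minus[symmetric])
    then show ?case
      using diff subringE(5,7)[OF A.subring_axioms] by (simp add: a_minus_def)
  qed (simp add: pt flip: pure_tensor_proj)
  then show "carrier T \<subseteq> rat_subalgebra R S" by (auto simp: carrier_T)
qed

section \<open>Characters of the tensor product\<close>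

definition free_lift :: "('a \<Rightarrow> rat) \<Rightarrow> ((rat \<times> 'a) \<Rightarrow>\<^sub>0 int) \<Rightarrow> rat" where
  "free_lift \<phi> c = (\<Sum>p\<in>Poly_Mapping.keys c. of_int (Poly_Mapping.lookup c p) * (fst p * \<phi> (snd p)))"

lemma free_lift_diff: "free_lift \<phi> (a - b) = free_lift \<phi> a - free_lift \<phi> b"
proof -
  let ?K = "Poly_Mapping.keys a \<union> Poly_Mapping.keys b"
  have *: "free_lift \<phi> c = (\<Sum>p\<in>?K. of_int (Poly_Mapping.lookup c p) * (fst p * \<phi> (snd p)))"
    if "Poly_Mapping.keys c \<subseteq> ?K" for c
    unfolding free_lift_def
    by (rule sum.mono_neutral_left) (use that in \<open>auto simp: in_keys_iff\<close>)
  show ?thesis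
    using keys_diff[of a b]
    by (simp add: * lookup_minus algebra_simps sum_subtractf)
qed

lemma free_lift_of: "free_lift \<phi> (frag_of (q, x)) = q * \<phi> x"
  by (simp add: free_lift_def)

lemma free_lift_zero: "free_lift \<phi> 0 = 0"
  by (simp add: free_lift_def)

lemma free_lift_add: "free_lift \<phi> (a + b) = free_lift \<phi> a + free_lift \<phi> b"
  using free_lift_diff[of \<phi> a "0 - b"] free_lift_diff[of \<phi> 0 b] by (simp add: free_lift_zero)

lemma free_lift_mult:
  assumes \<phi>: "character R \<phi>" and "c \<in> carrier F" "d \<in> carrier F"
  shows "free_lift \<phi> (c \<otimes>\<^bsub>F\<^esub> d) = free_lift \<phi> c * free_lift \<phi> d"
  using assms(2,3)
proof (induction c rule: F_induct)
  case (of q x)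
  from of(2,1) show ?case
    by (induction d rule: F_induct)
      (use \<phi> in \<open>simp_all add: F_mult_zero_r F_mult_of F_mult_diff_r free_lift_diff free_lift_of
         free_lift_zero character_def algebra_simps\<close>)
qed (simp_all add: F_mult_zero_l F_mult_diff_l free_lift_diff free_lift_zero algebra_simps)

text \<open>Multiplicativity of \<open>\<phi>\<close> makes the zero set of
  \<open>free_lift \<phi>\<close> an ideal, and additivity puts the bilinear relations into it;
  hence the value descends to the quotient.\<close>

lemma free_lift_I:
  assumes \<phi>: "character R \<phi>" and c: "c \<in> I"
  shows "free_lift \<phi> c = 0"
proof -
  interpret F: cring F by (rule cring_F)
  let ?K = "{c \<in> carrier F. free_lift \<phi> c = 0}"
  have "ideal ?K F"
  proof (rule idealI)
    have "subgroup ?K (add_monoid F)"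
    proof (rule F.add.subgroupI)
      show "?K \<noteq> {}" using F.zero_closed by (auto simp: F_simps(2) free_lift_zero)
      fix a assume a: "a \<in> ?K"
      then have "\<ominus>\<^bsub>F\<^esub> a = 0 - a" using F_minus[of 0 a] F.zero_closed by (simp add: F_simps(2,4) a_minus_def)
      then show "\<ominus>\<^bsub>F\<^esub> a \<in> ?K" using a F.a_inv_closed[of a]
        by (simp add: free_lift_diff free_lift_zero del: diff_0)
      fix b assume b: "b \<in> ?K"
      show "a \<oplus>\<^bsub>F\<^esub> b \<in> ?K" using a b F.a_closed[of a b] by (simp add: F_simps(4) free_lift_add)
    qed auto
    then show "subgroup ?K (add_monoid F)" .
  qed (use F.ring_axioms in \<open>auto simp: free_lift_mult[OF \<phi>]\<close>)
  moreover have "bilinear_relations R \<subseteq> ?K"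
    using bilinear_subset \<phi>
    by (auto simp: bilinear_relations_def free_lift_diff free_lift_of character_def distrib_left
      distrib_right intro!: F_diff_closed)
  ultimately have "I \<subseteq> ?K" by (rule F.genideal_minimal)
  then show ?thesis using c by auto
qed

definition tensor_lift :: "('a \<Rightarrow> rat) \<Rightarrow> ((rat \<times> 'a) \<Rightarrow>\<^sub>0 int) set \<Rightarrow> rat" where
  "tensor_lift \<phi> X = the_elem (free_lift \<phi> ` X)"

lemma tensor_lift_proj:
  assumes \<phi>: "character R \<phi>" and c: "c \<in> carrier F"
  shows "tensor_lift \<phi> (proj c) = free_lift \<phi> c"
  unfolding tensor_lift_def
proof (rule the_elem_image_const)
  interpret F: cring F by (rule cring_F)
  show "c \<in> proj c" unfolding proj_def
    using additive_subgroup.zero_closed[OF ideal.axioms(1)[OF ideal_I]]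
    by (force simp: a_r_coset_def' F_simps(2,4))
  fix d assume "d \<in> proj c"
  then obtain i where "i \<in> I" "d = i + c"
    by (auto simp: proj_def a_r_coset_def' F_simps(4))
  then show "free_lift \<phi> d = free_lift \<phi> c" using free_lift_I[OF \<phi>] by (simp add: free_lift_add)
qed

lemma tensor_lift_pure: "character R \<phi> \<Longrightarrow> x \<in> carrier R \<Longrightarrow> tensor_lift \<phi> (pure_tensor R q x) = q * \<phi> x"
  by (simp add: pure_tensor_proj tensor_lift_proj free_lift_of)

lemma character_tensor_lift:
  assumes \<phi>: "character R \<phi>"
  shows "character T (tensor_lift \<phi>)"
  unfolding character_def
proof (intro conjI ballI)
  interpret p: ring_hom_ring F T proj by (rule proj_hom)
  show "tensor_lift \<phi> \<zero>\<^bsub>T\<^esub> = 0" using tensor_lift_pure[OF \<phi>, of \<zero> 0] by (simp add: pure_tensor_zero_l)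
  show "tensor_lift \<phi> \<one>\<^bsub>T\<^esub> = 1"
    using tensor_lift_pure[OF \<phi>, of \<one> 1] \<phi> by (simp add: pure_tensor_one character_def)
  fix x y assume "x \<in> carrier T" "y \<in> carrier T"
  then obtain c d where *: "x = proj c" "y = proj d" "c \<in> carrier F" "d \<in> carrier F"
    by (auto simp: carrier_T)
  have "tensor_lift \<phi> (proj (c \<oplus>\<^bsub>F\<^esub> d)) = tensor_lift \<phi> (proj c) + tensor_lift \<phi> (proj d)"
    "tensor_lift \<phi> (proj (c \<otimes>\<^bsub>F\<^esub> d)) = tensor_lift \<phi> (proj c) * tensor_lift \<phi> (proj d)"
    using * p.R.a_closed[of c d] p.R.m_closed[of c d]
    by (simp_all add: tensor_lift_proj[OF \<phi>] free_lift_add free_lift_mult[OF \<phi>] F_simps(4) del: p.hom_mult p.hom_add)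
  then show "tensor_lift \<phi> (x \<oplus>\<^bsub>T\<^esub> y) = tensor_lift \<phi> x + tensor_lift \<phi> y"
    "tensor_lift \<phi> (x \<otimes>\<^bsub>T\<^esub> y) = tensor_lift \<phi> x * tensor_lift \<phi> y"
    using * by simp_all
qed

end

section \<open>Integer linear forms\<close>

lemma zscale_succ: "zscale (k + 1) x = zscale k x + x"
proof (cases "0 \<le> k")
  case True
  then have "nat (k + 1) = Suc (nat k)" by simp
  then show ?thesis using True by (simp add: zscale_def)
next
  case False
  then have *: "nat (- k) = Suc (nat (- (k + 1)))" by simp
  show ?thesis
    using False unfolding zscale_def * by (cases "0 \<le> k + 1") (auto simp: add.commute)
qed

lemma zscale_zero_left: "zscale 0 x = 0"
  by (simp add: zscale_def)

lemma zscale_add_left: "zscale (k + l) x = zscale k x + zscale l x"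
proof (induction l rule: int_induct[where k = 0])
  case (step1 i)
  then show ?case using zscale_succ[of "k + i" x] by (simp add: zscale_succ add.assoc)
next
  case (step2 i)
  then show ?case
    using zscale_succ[of "k + i - 1" x] zscale_succ[of "i - 1" x] by (simp add: algebra_simps)
qed (simp add: zscale_zero_left)

text \<open>The laws follow from the recursion \<open>zscale_succ\<close> by induction over the
  integers in both directions. As a module over the integers, the group inherits the general
  calculus of linear combinations.\<close>

interpretation zscale: Modules.module "zscale :: int \<Rightarrow> 'g \<Rightarrow> 'g::ab_group_add"
proof
  fix k l :: int and x y :: 'g
  show add: "zscale (k + l) x = zscale k x + zscale l x" for k l x by (rule zscale_add_left)
  show "zscale k (x + y) = zscale k x + zscale k y"
    by (simp add: zscale_def sum.distrib)
  show "zscale k (zscale l x) = zscale (k * l) x"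
  proof (induction k rule: int_induct[where k = 0])
    case (step1 i)
    then show ?case using zscale_succ[of i "zscale l x"] by (simp add: distrib_right add[of "i * l" l])
  next
    case (step2 i)
    then show ?case
      using zscale_succ[of "i - 1" "zscale l x"] add[of "(i - 1) * l" l x] by (simp add: algebra_simps)
  qed (simp add: zscale_zero_left)
  show "zscale 1 x = x" by (simp add: zscale_def)
qed

lemma zscale_pos: "0 < k \<Longrightarrow> 0 < x \<Longrightarrow> 0 < zscale k (x :: 'g::linordered_ab_group_add)"
  by (auto simp: zscale_def lessThan_empty_iff bot_nat_def intro!: sum_pos)

lemma zscale_less_iff:
  "0 < k \<Longrightarrow> zscale k x < zscale k y \<longleftrightarrow> x < (y :: 'g::linordered_ab_group_add)"
  using zscale_pos[of k "y - x"] zscale_pos[of k "x - y"]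
  by (cases x y rule: linorder_cases) (auto simp: zscale.scale_right_diff_distrib)

lemma zscale_le_iff:
  "0 < k \<Longrightarrow> zscale k x \<le> zscale k y \<longleftrightarrow> x \<le> (y :: 'g::linordered_ab_group_add)"
  using zscale_less_iff[of k y x] by auto

text \<open>Ordered groups are torsion-free, so division by a positive integer is unique. This is
  what lets \<open>div_hull A\<close> be read as \<rat> \<otimes> A.\<close>

lemma zscale_eq_iff:
  "0 < k \<Longrightarrow> zscale k x = zscale k y \<longleftrightarrow> x = (y :: 'g::linordered_ab_group_add)"
  using zscale_le_iff[of k y x] zscale_le_iff[of k x y] by (auto intro: antisym)

lemma zscale_in_subgroup:
  assumes "add_subgroup A" "a \<in> A" shows "zscale k a \<in> A"
proof (induction k rule: int_induct[where k = 0])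
  case (step1 i) then show ?case using assms by (simp add: zscale_succ add_subgroup_def)
next
  case (step2 i)
  have "zscale (i - 1) a = zscale i a + - a" using zscale_succ[of "i - 1" a] by simp
  with step2 show ?case using assms by (simp only: add_subgroup_def)
qed (use assms in \<open>simp add: add_subgroup_def\<close>)

lemma add_subgroup_diff: "add_subgroup A \<Longrightarrow> a \<in> A \<Longrightarrow> b \<in> A \<Longrightarrow> a - b \<in> A"
  unfolding add_subgroup_def by (metis diff_conv_add_uminus)

lemma add_subgroup_sum: "add_subgroup A \<Longrightarrow> (\<And>i. i \<in> I \<Longrightarrow> f i \<in> A) \<Longrightarrow> sum f I \<in> A"
  by (induction I rule: infinite_finite_induct) (auto simp: add_subgroup_def)

section \<open>Linear forms under concatenation and integer matrices\<close>

lemma int_lin_add_right: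
  "k \<in> carrier_vec n \<Longrightarrow> x \<in> carrier_vec n \<Longrightarrow> y \<in> carrier_vec n \<Longrightarrow>
    int_lin k (x + y) = int_lin k x + int_lin k y"
  by (simp add: int_lin_def zscale.scale_right_distrib sum.distrib)

lemma int_lin_append:
  assumes "k \<in> carrier_vec n" "l \<in> carrier_vec m" "x \<in> carrier_vec n" "y \<in> carrier_vec m"
  shows "int_lin (k @\<^sub>v l) (x @\<^sub>v y) = int_lin k x + int_lin l y"
proof -
  have d: "dim_vec k = n" "dim_vec l = m" "dim_vec x = n" "dim_vec y = m" using assms by auto
  have "int_lin (k @\<^sub>v l) (x @\<^sub>v y) = (\<Sum>i<n + m. zscale ((k @\<^sub>v l) $ i) ((x @\<^sub>v y) $ i))"
    by (simp add: int_lin_def d)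
  also have "\<dots> = (\<Sum>i<n. zscale ((k @\<^sub>v l) $ i) ((x @\<^sub>v y) $ i))
      + (\<Sum>i<m. zscale ((k @\<^sub>v l) $ (n + i)) ((x @\<^sub>v y) $ (n + i)))"
    by (induction m) (simp_all add: add.assoc)
  also have "\<dots> = (\<Sum>i<n. zscale (k $ i) (x $ i)) + (\<Sum>i<m. zscale (l $ i) (y $ i))"
    by (simp add: d)
  finally show ?thesis by (simp add: int_lin_def d)
qed

lemma int_lin_in_subgroup:
  assumes "add_subgroup A" "k \<in> carrier_vec n" "\<forall>j<n. a $ j \<in> A"
  shows "int_lin k a \<in> A"
  unfolding int_lin_def by (rule add_subgroup_sum) (use assms zscale_in_subgroup in auto)

lemma int_lin_zero: "int_lin (0\<^sub>v n) x = 0"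
  by (simp add: int_lin_def)

lemma int_mat_vec_carrier [simp]: "M \<in> carrier_mat n m \<Longrightarrow> int_mat_vec M x \<in> carrier_vec n"
  by (auto simp: int_mat_vec_def)

text \<open>Substituting a matrix into a form acts on the coefficients by the transpose, so integral
  forms stay integral. Definable sets and polyhedra are pulled back along affine maps in this
  way.\<close>

lemma int_lin_mat_vec:
  assumes k: "k \<in> carrier_vec n" and M: "M \<in> carrier_mat n m" and x: "x \<in> carrier_vec m"
  shows "int_lin k (int_mat_vec M x) = int_lin (M\<^sup>T *\<^sub>v k) x"
proof -
  have "int_lin k (int_mat_vec M x) = (\<Sum>i<n. \<Sum>j<m. zscale (k $ i * M $$ (i, j)) (x $ j))"
    using assms by (simp add: int_lin_def int_mat_vec_def zscale.scale_sum_right)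
  also have "\<dots> = (\<Sum>j<m. \<Sum>i<n. zscale (k $ i * M $$ (i, j)) (x $ j))"
    by (rule sum.swap)
  also have "\<dots> = int_lin (M\<^sup>T *\<^sub>v k) x"
    using assms by (simp add: int_lin_def scalar_prod_def zscale.scale_sum_left lessThan_atLeast0 mult.commute)
  finally show ?thesis .
qed

lemma int_mat_vec_mult:
  assumes "M \<in> carrier_mat n m" "N \<in> carrier_mat m p" "x \<in> carrier_vec p"
  shows "int_mat_vec (M * N) x = int_mat_vec M (int_mat_vec N x)"
proof (rule eq_vecI)
  fix i assume "i < dim_vec (int_mat_vec M (int_mat_vec N x))"
  then have i: "i < n" using assms by (simp add: int_mat_vec_def)
  have "row (M * N) i = N\<^sup>T *\<^sub>v row M i"
    using assms i by (intro eq_vecI) (auto simp: comm_scalar_prod[of _ m])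
  then show "int_mat_vec (M * N) x $ i = int_mat_vec M (int_mat_vec N x) $ i"
    using assms i int_lin_mat_vec[of "row M i" m N p x] by (simp add: int_mat_vec_def)
qed (use assms in \<open>simp add: int_mat_vec_def\<close>)

lemma int_mat_vec_add:
  assumes "M \<in> carrier_mat n m" "x \<in> carrier_vec m" "y \<in> carrier_vec m"
  shows "int_mat_vec M (x + y) = int_mat_vec M x + int_mat_vec M y"
  by (rule eq_vecI) (use assms in \<open>auto simp: int_mat_vec_def intro!: int_lin_add_right[of _ m]\<close>)

lemma int_lin_unit:
  assumes "i < n" shows "int_lin (unit_vec n i) x = x $ i"
proof -
  have "int_lin (unit_vec n i) x = (\<Sum>j<n. if j = i then x $ j else 0)"
    unfolding int_lin_def dim_vec index_unit_vec
    by (rule sum.cong) (use assms in \<open>auto simp: index_unit_vec\<close>)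
  then show ?thesis using assms by simp
qed

lemma int_mat_vec_one: "x \<in> carrier_vec n \<Longrightarrow> int_mat_vec (1\<^sub>m n) x = x"
  by (rule eq_vecI) (auto simp: int_mat_vec_def int_lin_unit)

lemma GL_Z_inverse:
  assumes "M \<in> GL_Z n"
  obtains N where "N \<in> GL_Z n" "M \<in> carrier_mat n n" "N \<in> carrier_mat n n" "M * N = 1\<^sub>m n" "N * M = 1\<^sub>m n"
proof -
  from assms have M: "M \<in> carrier_mat n n" "invertible_mat M" by (auto simp: GL_Z_def)
  then obtain N where N: "M * N = 1\<^sub>m n" "N * M = 1\<^sub>m (dim_row N)"
    by (auto simp: invertible_mat_def inverts_mat_def)
  have "dim_row N = n" using arg_cong[OF N(2), of dim_col] M(1) by simp
  moreover have "dim_col N = n" using arg_cong[OF N(1), of dim_col] by simp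
  ultimately have "N \<in> carrier_mat n n" by auto
  then have "N \<in> GL_Z n"
    using M N \<open>dim_row N = n\<close> unfolding GL_Z_def invertible_mat_def inverts_mat_def square_mat.simps by auto
  with N M that \<open>dim_row N = n\<close> \<open>N \<in> carrier_mat n n\<close> show ?thesis by auto
qed

lemma GL_Z_I:
  assumes "M \<in> carrier_mat n n" "N \<in> carrier_mat n n" "M * N = 1\<^sub>m n" "N * M = 1\<^sub>m n"
  shows "M \<in> GL_Z n"
  using assms unfolding GL_Z_def invertible_mat_def inverts_mat_def square_mat.simps by auto

lemma GL_Z_affine_bij:
  assumes M: "M \<in> GL_Z n" and a: "a \<in> carrier_vec n"
  shows "bij_betw (\<lambda>x. int_mat_vec M x + a) (carrier_vec n) (carrier_vec n)"
proof -
  obtain N where N: "M \<in> carrier_mat n n" "N \<in> carrier_mat n n" "M * N = 1\<^sub>m n" "N * M = 1\<^sub>m n"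
    using GL_Z_inverse[OF M] by metis
  show ?thesis
  proof (rule bij_betw_byWitness[where f' = "\<lambda>y. int_mat_vec N (y + - a)"])
    have *: "x + a + - a = x" "x + - a + a = x" if "x \<in> carrier_vec n" for x :: "'a vec"
      using that a by (auto intro!: eq_vecI)
    show "\<forall>x\<in>carrier_vec n. int_mat_vec N (int_mat_vec M x + a + - a) = x"
      using N by (auto simp: * int_mat_vec_one simp flip: int_mat_vec_mult)
    show "\<forall>y\<in>carrier_vec n. int_mat_vec M (int_mat_vec N (y + - a)) + a = y"
      using N a by (auto simp: * int_mat_vec_one simp flip: int_mat_vec_mult[of _ n n _ n])
  qed (use N a in auto)
qed

section \<open>Definable sets\<close>

lemma definable_subset: "X \<in> definable A n \<Longrightarrow> X \<subseteq> carrier_vec n"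
  by (induction rule: definable.induct) auto

definition vprod :: "'g vec set \<Rightarrow> 'g vec set \<Rightarrow> 'g vec set" where
  "vprod X Y = {x @\<^sub>v y | x y. x \<in> X \<and> y \<in> Y}"

lemma obj_times_eq: "obj_times p q = (fst p + fst q, vprod (snd p) (snd q))"
  by (simp add: obj_times_def vprod_def)

locale params =
  fixes A :: "'g::linordered_ab_group_add set"
  assumes A: "add_subgroup A"
begin

lemma zero_in_A: "0 \<in> A"
  using A by (simp add: add_subgroup_def)

lemma definable_empty [simp]: "{} \<in> definable A n"
proof -
  have "{x \<in> carrier_vec n. int_lin (0\<^sub>v n) x < 0} \<in> definable A n"
    by (rule definable.lin_less) (auto simp: zero_in_A)
  then show ?thesis by (simp add: int_lin_zero)
qed

lemma definable_carrier [simp]: "carrier_vec n \<in> definable A n"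
  using definable.compl[OF definable_empty] by simp

lemma definable_diff: "X \<in> definable A n \<Longrightarrow> Y \<in> definable A n \<Longrightarrow> X - Y \<in> definable A n"
proof -
  assume XY: "X \<in> definable A n" "Y \<in> definable A n"
  then have "X - Y = carrier_vec n - ((carrier_vec n - X) \<union> Y)"
    using definable_subset by blast
  then show ?thesis using XY by (metis definable.compl definable.union)
qed

lemma definable_inter: "X \<in> definable A n \<Longrightarrow> Y \<in> definable A n \<Longrightarrow> X \<inter> Y \<in> definable A n"
  using definable_diff[of X n "X - Y"] definable_diff[of X n Y] by (simp add: Diff_Diff_Int)

text \<open>Only the pullbacks of linear forms matter, not the shape of \<open>f\<close>; one
  induction therefore serves affine maps as well as the two projections of a product. The constant
  must lie in \<open>A\<close> because it is moved to the side of the parameter.\<close>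

lemma definable_preimage:
  assumes X: "X \<in> definable A n"
    and f: "\<And>x. x \<in> carrier_vec m \<Longrightarrow> f x \<in> carrier_vec n"
    and lin: "\<And>k. k \<in> carrier_vec n \<Longrightarrow>
      \<exists>k'\<in>carrier_vec m. \<exists>a\<in>A. \<forall>x\<in>carrier_vec m. int_lin k (f x) = int_lin k' x + a"
  shows "{x \<in> carrier_vec m. f x \<in> X} \<in> definable A m"
  using X
proof induction
  case (lin_eq k a)
  then obtain k' b where "k' \<in> carrier_vec m" "b \<in> A"
    "\<forall>x\<in>carrier_vec m. int_lin k (f x) = int_lin k' x + b" using lin by metis
  then have "{x \<in> carrier_vec m. f x \<in> {x \<in> carrier_vec n. int_lin k x = a}}
      = {x \<in> carrier_vec m. int_lin k' x = a - b}" using f by (auto simp: algebra_simps)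
  then show ?case
    using \<open>k' \<in> carrier_vec m\<close> \<open>b \<in> A\<close> lin_eq A by (simp add: definable.lin_eq add_subgroup_diff)
next
  case (lin_less k a)
  then obtain k' b where "k' \<in> carrier_vec m" "b \<in> A"
    "\<forall>x\<in>carrier_vec m. int_lin k (f x) = int_lin k' x + b" using lin by metis
  then have "{x \<in> carrier_vec m. f x \<in> {x \<in> carrier_vec n. int_lin k x < a}}
      = {x \<in> carrier_vec m. int_lin k' x < a - b}" using f by (auto simp: algebra_simps)
  then show ?case
    using \<open>k' \<in> carrier_vec m\<close> \<open>b \<in> A\<close> lin_less A by (simp add: definable.lin_less add_subgroup_diff)
next
  case (compl X)
  have "{x \<in> carrier_vec m. f x \<in> carrier_vec n - X} = carrier_vec m - {x \<in> carrier_vec m. f x \<in> X}"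
    using f by auto
  then show ?case using compl by (simp add: definable.compl)
next
  case (union X Y)
  have "{x \<in> carrier_vec m. f x \<in> X \<union> Y} = {x \<in> carrier_vec m. f x \<in> X} \<union> {x \<in> carrier_vec m. f x \<in> Y}"
    by auto
  then show ?case using union by (simp add: definable.union)
qed

lemma definable_affine_preimage:
  assumes "X \<in> definable A n" "M \<in> carrier_mat n m" "a \<in> carrier_vec n" "\<forall>j<n. a $ j \<in> A"
  shows "{x \<in> carrier_vec m. int_mat_vec M x + a \<in> X} \<in> definable A m"
proof (rule definable_preimage[OF assms(1)])
  fix k :: "int vec" assume k: "k \<in> carrier_vec n"
  show "\<exists>k'\<in>carrier_vec m. \<exists>b\<in>A. \<forall>x\<in>carrier_vec m. int_lin k (int_mat_vec M x + a) = int_lin k' x + b"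
    using assms k A
    by (intro bexI[of _ "M\<^sup>T *\<^sub>v k"] bexI[of _ "int_lin k a"])
      (auto simp: int_lin_add_right[of _ n] int_lin_mat_vec int_lin_in_subgroup)
qed (use assms in auto)

lemma vprod_eq:
  assumes "X \<subseteq> carrier_vec n" "Y \<subseteq> carrier_vec m"
  shows "vprod X Y = {z \<in> carrier_vec (n + m). vec_first z n \<in> X} \<inter> {z \<in> carrier_vec (n + m). vec_last z m \<in> Y}"
proof (intro equalityI subsetI)
  fix z assume "z \<in> vprod X Y"
  then obtain x y where z: "z = x @\<^sub>v y" "x \<in> X" "y \<in> Y" by (auto simp: vprod_def)
  then have c: "x \<in> carrier_vec n" "y \<in> carrier_vec m" using assms by auto
  have "vec_first z n = x" "vec_last z m = y"
    using c z by (auto simp: vec_first_def vec_last_def)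
  then show "z \<in> {z \<in> carrier_vec (n + m). vec_first z n \<in> X} \<inter> {z \<in> carrier_vec (n + m). vec_last z m \<in> Y}"
    using z c by auto
qed (auto simp: vprod_def, metis vec_first_last_append)

lemma definable_vprod:
  assumes X: "X \<in> definable A n" and Y: "Y \<in> definable A m"
  shows "vprod X Y \<in> definable A (n + m)"
proof -
  have z: "z = vec_first z n @\<^sub>v vec_last z m" if "z \<in> carrier_vec (n + m)" for z :: "'g vec"
    using that by simp
  have "{z \<in> carrier_vec (n + m). vec_first z n \<in> X} \<in> definable A (n + m)"
  proof (rule definable_preimage[OF X])
    fix k :: "int vec" assume k: "k \<in> carrier_vec n"
    have "int_lin k (vec_first z n) = int_lin (k @\<^sub>v 0\<^sub>v m) z + 0" if "z \<in> carrier_vec (n + m)" for z :: "'g vec"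
      using int_lin_append[of k n "0\<^sub>v m" m "vec_first z n" "vec_last z m"] that k
      by (simp add: int_lin_zero)
    then show "\<exists>k'\<in>carrier_vec (n + m). \<exists>a\<in>A. \<forall>x\<in>carrier_vec (n + m). int_lin k (vec_first x n) = int_lin k' x + a"
      using k zero_in_A by (intro bexI[of _ "k @\<^sub>v 0\<^sub>v m"] bexI[of _ 0]) auto
  qed simp
  moreover have "{z \<in> carrier_vec (n + m). vec_last z m \<in> Y} \<in> definable A (n + m)"
  proof (rule definable_preimage[OF Y])
    fix k :: "int vec" assume k: "k \<in> carrier_vec m"
    have "int_lin k (vec_last z m) = int_lin (0\<^sub>v n @\<^sub>v k) z + 0" if "z \<in> carrier_vec (n + m)" for z :: "'g vec"
      using int_lin_append[of "0\<^sub>v n" n k m "vec_first z n" "vec_last z m"] that k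
      by (simp add: int_lin_zero)
    then show "\<exists>k'\<in>carrier_vec (n + m). \<exists>a\<in>A. \<forall>x\<in>carrier_vec (n + m). int_lin k (vec_last x m) = int_lin k' x + a"
      using k zero_in_A by (intro bexI[of _ "0\<^sub>v n @\<^sub>v k"] bexI[of _ 0]) auto
  qed simp
  ultimately show ?thesis
    using vprod_eq[OF definable_subset[OF X] definable_subset[OF Y]] by (simp add: definable_inter)
qed

section \<open>Isomorphisms of definable sets\<close>

lemma isomorphic_definable: "isomorphic A n X Y \<Longrightarrow> X \<in> definable A n \<and> Y \<in> definable A n"
  by (auto simp: isomorphic_def morphism_def)

text \<open>Stated for a preimage, since substitution into the constraints shows at once that it is
  definable; the partition has a single piece. Reflections, translations, shears and coordinate
  swaps are instances.\<close>

lemma isomorphic_affine: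
  assumes X: "X \<in> definable A n" and M: "M \<in> GL_Z n" and a: "a \<in> carrier_vec n" "\<forall>j<n. a $ j \<in> A"
  shows "isomorphic A n {x \<in> carrier_vec n. int_mat_vec M x + a \<in> X} X"
  unfolding isomorphic_def morphism_def
proof (intro exI conjI)
  let ?f = "\<lambda>x. int_mat_vec M x + a" and ?Y = "{x \<in> carrier_vec n. int_mat_vec M x + a \<in> X}"
  show "?Y \<in> definable A n"
    by (rule definable_affine_preimage) (use assms in \<open>auto simp: GL_Z_def\<close>)
  have b: "bij_betw ?f (carrier_vec n) (carrier_vec n)" by (rule GL_Z_affine_bij[OF M a(1)])
  have "?f ` ?Y = X"
    using definable_subset[OF X] bij_betw_imp_surj_on[OF b] by (auto simp: image_iff)
  with b show "bij_betw ?f ?Y X" by (auto intro: bij_betw_subset)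
  show "?Y = (\<Union>i<1. (\<lambda>_::nat. ?Y) i)" by auto
  show "disjoint_family_on (\<lambda>_::nat. ?Y) {..<1}" by (auto simp: disjoint_family_on_def)
  show "\<forall>i<1. (\<lambda>_::nat. ?Y) i \<in> definable A n \<and> (\<lambda>_::nat. M) i \<in> GL_Z n \<and>
      (\<lambda>_::nat. a) i \<in> carrier_vec n \<and> (\<forall>j<n. (\<lambda>_::nat. a) i $ j \<in> A) \<and>
      (\<forall>x\<in>(\<lambda>_::nat. ?Y) i. ?f x = int_mat_vec ((\<lambda>_::nat. M) i) x + (\<lambda>_::nat. a) i)"
    using \<open>?Y \<in> definable A n\<close> assms by auto
qed (fact X)

lemma one_GL_Z: "1\<^sub>m n \<in> GL_Z n"
  by (rule GL_Z_I[of _ _ "1\<^sub>m n"]) auto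

lemma isomorphic_refl: "X \<in> definable A n \<Longrightarrow> isomorphic A n X X"
proof -
  assume X: "X \<in> definable A n"
  have "{x \<in> carrier_vec n. int_mat_vec (1\<^sub>m n) x + 0\<^sub>v n \<in> X} = X"
    using definable_subset[OF X] by (auto simp: int_mat_vec_one)
  with isomorphic_affine[OF X one_GL_Z, of "0\<^sub>v n"] show ?thesis by (simp add: zero_in_A)
qed

text \<open>The pieces are multiplied by \<open>Z\<close>, and the affine maps are extended by the
  identity on the new coordinates.\<close>

lemma isomorphic_vprod:
  assumes iso: "isomorphic A n X Y" and Z: "Z \<in> definable A m"
  shows "isomorphic A (n + m) (vprod X Z) (vprod Y Z)"
proof -
  from iso obtain f N P M a where XY: "X \<in> definable A n" "Y \<in> definable A n" "bij_betw f X Y"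
    and P: "X = (\<Union>i<(N::nat). P i)" "disjoint_family_on P {..<N}"
      "\<And>i. i < N \<Longrightarrow> P i \<in> definable A n \<and> M i \<in> GL_Z n \<and> a i \<in> carrier_vec n \<and> (\<forall>j<n. a i $ j \<in> A) \<and>
               (\<forall>x\<in>P i. f x = int_mat_vec (M i) x + a i)"
    unfolding isomorphic_def morphism_def by metis
  note sub = definable_subset[OF XY(1)] definable_subset[OF XY(2)] definable_subset[OF Z]
  define g where "g z = f (vec_first z n) @\<^sub>v vec_last z m" for z
  have g: "g (x @\<^sub>v y) = f x @\<^sub>v y" if "x \<in> X" "y \<in> Z" for x y
  proof -
    have "x \<in> carrier_vec n" "y \<in> carrier_vec m" using that sub by auto
    then have "vec_first (x @\<^sub>v y) n = x" "vec_last (x @\<^sub>v y) m = y" by (auto simp: vec_first_def vec_last_def)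
    then show ?thesis by (simp add: g_def)
  qed
  have inj: "x = x' \<and> y = y'" if "x @\<^sub>v y = x' @\<^sub>v y'" "x \<in> carrier_vec n" "x' \<in> carrier_vec n" for x y x' y' :: "'g vec"
    using append_vec_eq[OF that(2,3)] that(1) by blast
  show ?thesis
    unfolding isomorphic_def morphism_def
  proof (intro exI conjI allI impI)
    show "vprod X Z \<in> definable A (n + m)" "vprod Y Z \<in> definable A (n + m)"
      using XY Z by (simp_all add: definable_vprod)
    have fX: "f ` X = Y" "inj_on f X" using XY(3) by (auto simp: bij_betw_def)
    show "bij_betw g (vprod X Z) (vprod Y Z)"
      unfolding bij_betw_def
    proof
      show "inj_on g (vprod X Z)"
      proof (rule inj_onI)
        fix z z' assume "z \<in> vprod X Z" "z' \<in> vprod X Z" and eq: "g z = g z'"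
        then obtain x y x' y' where z: "z = x @\<^sub>v y" "z' = x' @\<^sub>v y'" "x \<in> X" "x' \<in> X" "y \<in> Z" "y' \<in> Z"
          by (auto simp: vprod_def)
        then have "f x @\<^sub>v y = f x' @\<^sub>v y'" using eq g by simp
        then have "f x = f x'" "y = y'"
          using inj[of "f x" y "f x'" y'] fX z sub by auto
        then show "z = z'" using fX z by (auto dest: inj_onD)
      qed
      show "g ` vprod X Z = vprod Y Z"
        unfolding fX(1)[symmetric] by (auto simp: vprod_def image_iff g) (metis g)+
    qed
    show "vprod X Z = (\<Union>i<N. vprod (P i) Z)" unfolding P(1) by (auto simp: vprod_def)
    show "disjoint_family_on (\<lambda>i. vprod (P i) Z) {..<N}"
    proof (unfold disjoint_family_on_def, intro ballI impI)
      fix i j assume ij: "i \<in> {..<N}" "j \<in> {..<N}" "i \<noteq> j"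
      then have "P i \<inter> P j = {}" using P(2) by (auto simp: disjoint_family_on_def)
      moreover have "P i \<subseteq> carrier_vec n" "P j \<subseteq> carrier_vec n" using ij P(3) definable_subset by blast+
      ultimately show "vprod (P i) Z \<inter> vprod (P j) Z = {}"
        unfolding vprod_def using inj by blast
    qed
    fix i assume i: "i < N"
    note Pi = P(3)[OF i]
    \<comment> \<open>Block diagonal; the inverse is block diagonal as well, with blocks
      \<open>M'\<close> and the identity.\<close>
    let ?M = "four_block_mat (M i) (0\<^sub>m n m) (0\<^sub>m m n) (1\<^sub>m m)"
    obtain M' where M': "M i \<in> carrier_mat n n" "M' \<in> carrier_mat n n" "M i * M' = 1\<^sub>m n" "M' * M i = 1\<^sub>m n"
      using GL_Z_inverse[of "M i" n] Pi by metis
    show "vprod (P i) Z \<in> definable A (n + m)" using Pi Z by (simp add: definable_vprod)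
    show "?M \<in> GL_Z (n + m)"
    proof (rule GL_Z_I[of _ _ "four_block_mat M' (0\<^sub>m n m) (0\<^sub>m m n) (1\<^sub>m m)"])
      show "?M * four_block_mat M' (0\<^sub>m n m) (0\<^sub>m m n) (1\<^sub>m m) = 1\<^sub>m (n + m)"
        by (subst mult_four_block_mat[of _ n n _ m _ m _ _ n _ m]) (use M' in auto)
      show "four_block_mat M' (0\<^sub>m n m) (0\<^sub>m m n) (1\<^sub>m m) * ?M = 1\<^sub>m (n + m)"
        by (subst mult_four_block_mat[of _ n n _ m _ m _ _ n _ m]) (use M' in auto)
    qed (use M' in auto)
    show "a i @\<^sub>v 0\<^sub>v m \<in> carrier_vec (n + m)" using Pi by simp
    show "(a i @\<^sub>v 0\<^sub>v m) $ j \<in> A" if "j < n + m" for j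
      using Pi that zero_in_A by (cases "j < n") auto
    show "\<forall>z\<in>vprod (P i) Z. g z = int_mat_vec ?M z + (a i @\<^sub>v 0\<^sub>v m)"
    proof
      fix z assume "z \<in> vprod (P i) Z"
      then obtain x y where z: "z = x @\<^sub>v y" "x \<in> P i" "y \<in> Z" by (auto simp: vprod_def)
      have c: "x \<in> carrier_vec n" "y \<in> carrier_vec m"
        using z Pi definable_subset[of "P i" A n] sub by auto
      have "x \<in> X" using z i P(1) by auto
      have "int_mat_vec ?M z = int_mat_vec (M i) x @\<^sub>v y"
      proof (rule eq_vecI)
        fix j assume "j < dim_vec (int_mat_vec (M i) x @\<^sub>v y)"
        then have j: "j < n + m" using M' c by (simp add: int_mat_vec_def)
        show "int_mat_vec ?M z $ j = (int_mat_vec (M i) x @\<^sub>v y) $ j"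
        proof (cases "j < n")
          case True
          have "row ?M j = row (M i) j @\<^sub>v 0\<^sub>v m"
            using True M' by (subst row_four_block_mat(1)[of _ n n _ m _ m]) auto
          then show ?thesis
            using True M' c z j int_lin_append[of "row (M i) j" n "0\<^sub>v m" m x y]
            by (simp add: int_mat_vec_def int_lin_zero int_lin_unit)
        next
          case False
          have "row ?M j = 0\<^sub>v n @\<^sub>v row (1\<^sub>m m) (j - n)"
            using False M' j by (subst row_four_block_mat(2)[of _ n n _ m _ m]) auto
          then show ?thesis
            using False M' c z j int_lin_append[of "0\<^sub>v n" n "row (1\<^sub>m m) (j - n)" m x y]
            by (simp add: int_mat_vec_def int_lin_zero int_lin_unit)
        qed
      qed (use c M' in \<open>simp add: int_mat_vec_def\<close>)
      moreover have "(int_mat_vec (M i) x @\<^sub>v y) + (a i @\<^sub>v 0\<^sub>v m) = (int_mat_vec (M i) x + a i) @\<^sub>v y"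
        using append_vec_add[of "int_mat_vec (M i) x" n "a i" y m "0\<^sub>v m"] Pi c M' by simp
      ultimately show "g z = int_mat_vec ?M z + (a i @\<^sub>v 0\<^sub>v m)"
        using g[OF \<open>x \<in> X\<close> z(3)] Pi z by simp
    qed
  qed
qed

text \<open>The block permutation matrix that exchanges the two groups of coordinates is unimodular.
  This gives the semiring its commutativity, which fails for the sets themselves.\<close>

lemma isomorphic_vprod_swap:
  assumes X: "X \<in> definable A n" and Y: "Y \<in> definable A m"
  shows "isomorphic A (n + m) (vprod X Y) (vprod Y X)"
proof -
  let ?M = "four_block_mat (0\<^sub>m m n) (1\<^sub>m m) (1\<^sub>m n) (0\<^sub>m n m) :: int mat"
  let ?N = "four_block_mat (0\<^sub>m n m) (1\<^sub>m n) (1\<^sub>m m) (0\<^sub>m m n) :: int mat"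
  have c: "?M \<in> carrier_mat (n + m) (n + m)" "?N \<in> carrier_mat (n + m) (n + m)"
    by (auto simp: add.commute)
  have "?M * ?N = 1\<^sub>m (n + m)"
    by (subst mult_four_block_mat[of _ m n _ m _ n _ _ m _ n]) (auto simp: add.commute)
  moreover have "?N * ?M = 1\<^sub>m (n + m)"
    by (subst mult_four_block_mat[of _ n m _ n _ m _ _ n _ m]) auto
  ultimately have GL: "?M \<in> GL_Z (n + m)" using c by (intro GL_Z_I)
  have act: "int_mat_vec ?M (x @\<^sub>v y) = y @\<^sub>v x" if "x \<in> carrier_vec n" "y \<in> carrier_vec m" for x y :: "'g vec"
  proof (rule eq_vecI)
    fix j assume "j < dim_vec (y @\<^sub>v x)"
    then have j: "j < m + n" using that by simp
    show "int_mat_vec ?M (x @\<^sub>v y) $ j = (y @\<^sub>v x) $ j"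
    proof (cases "j < m")
      case True
      have "row ?M j = 0\<^sub>v n @\<^sub>v row (1\<^sub>m m) j"
        using True by (subst row_four_block_mat(1)[of _ m n _ m _ n]) auto
      then show ?thesis
        using True that j int_lin_append[of "0\<^sub>v n" n "row (1\<^sub>m m) j" m x y]
        by (simp add: int_mat_vec_def int_lin_zero int_lin_unit)
    next
      case False
      have "row ?M j = row (1\<^sub>m n) (j - m) @\<^sub>v 0\<^sub>v m"
        using False j by (subst row_four_block_mat(2)[of _ m n _ m _ n]) auto
      then show ?thesis
        using False that j int_lin_append[of "row (1\<^sub>m n) (j - m)" n "0\<^sub>v m" m x y]
        by (simp add: int_mat_vec_def int_lin_zero int_lin_unit)
    qed
  qed (use that in \<open>simp add: int_mat_vec_def\<close>)
  have YX: "vprod Y X \<in> definable A (n + m)" using definable_vprod[OF Y X] by (simp add: add.commute)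
  have sub: "X \<subseteq> carrier_vec n" "Y \<subseteq> carrier_vec m" using X Y definable_subset by auto
  have "{z \<in> carrier_vec (n + m). int_mat_vec ?M z + 0\<^sub>v (n + m) \<in> vprod Y X} = vprod X Y"
  proof (intro equalityI subsetI)
    fix z assume z: "z \<in> {z \<in> carrier_vec (n + m). int_mat_vec ?M z + 0\<^sub>v (n + m) \<in> vprod Y X}"
    define x where "x = vec_first z n"
    define y where "y = vec_last z m"
    have xy: "x \<in> carrier_vec n" "y \<in> carrier_vec m" "z = x @\<^sub>v y" using z by (auto simp: x_def y_def)
    have "int_mat_vec ?M z + 0\<^sub>v (n + m) = y @\<^sub>v x" using xy act[OF xy(1,2)] by (simp add: add.commute[of n m])
    then obtain y' x' where "y @\<^sub>v x = y' @\<^sub>v x'" "y' \<in> Y" "x' \<in> X" using z by (auto simp: vprod_def)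
    then have "x \<in> X" "y \<in> Y" using append_vec_eq[of y m y' x x'] xy sub by auto
    then show "z \<in> vprod X Y" using xy by (auto simp: vprod_def)
  next
    fix z assume "z \<in> vprod X Y"
    then obtain x y where xy: "z = x @\<^sub>v y" "x \<in> X" "y \<in> Y" by (auto simp: vprod_def)
    then have "x \<in> carrier_vec n" "y \<in> carrier_vec m" using sub by auto
    moreover from this have "int_mat_vec ?M z + 0\<^sub>v (n + m) = y @\<^sub>v x"
      using xy act by (simp add: add.commute[of n m])
    ultimately show "z \<in> {z \<in> carrier_vec (n + m). int_mat_vec ?M z + 0\<^sub>v (n + m) \<in> vprod Y X}"
      using xy by (auto simp: vprod_def)
  qed
  then show ?thesis
    using isomorphic_affine[OF YX GL, of "0\<^sub>v (n + m)"] zero_in_A by simp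
qed

end

section \<open>The Grothendieck rings\<close>

lemma mset_times_simps [simp]:
  "mset_times {#} b = {#}" "mset_times a {#} = {#}"
  "mset_times (add_mset p a) b = image_mset (obj_times p) b + mset_times a b"
  "mset_times (a + a') b = mset_times a b + mset_times a' b"
  "mset_times a (b + b') = mset_times a b + mset_times a b'"
  "mset_times a (add_mset q b) = image_mset (\<lambda>p. obj_times p q) a + mset_times a b"
  by (auto simp: mset_times_def, (induction a, auto)+)

lemma append_vec_assoc: "(x @\<^sub>v y) @\<^sub>v z = x @\<^sub>v y @\<^sub>v (z :: 'a vec)"
  by (rule eq_vecI) (auto simp: algebra_simps)

text \<open>Concatenation of vectors is strictly associative, so this is an equality of objects and
  needs no isomorphism.\<close>

lemma obj_times_assoc: "obj_times (obj_times p q) r = obj_times p (obj_times q r)"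
proof -
  have "vprod (vprod X Y) Z = vprod X (vprod Y Z)" for X Y Z :: "'a vec set"
    unfolding vprod_def by (auto simp: append_vec_assoc) (metis append_vec_assoc)+
  then show ?thesis by (simp add: obj_times_eq)
qed

lemma mset_times_assoc: "mset_times (mset_times a b) c = mset_times a (mset_times b c)"
proof (induction a)
  case (add p a)
  have "mset_times (image_mset (obj_times p) b) c = image_mset (obj_times p) (mset_times b c)"
  proof (induction b)
    case (add q b)
    have "obj_times (obj_times p q) = obj_times p \<circ> obj_times q"
      by (rule ext) (simp add: obj_times_assoc)
    then show ?case using add by (simp add: multiset.map_comp[symmetric])
  qed simp
  with add show ?case by simp
qed simp

lemma obj_times_one: "obj_times (0, carrier_vec 0) q = q"
proof -
  have "carrier_vec 0 = {vNil :: 'a vec}" by (auto intro: eq_vecI)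
  then have "vprod (carrier_vec 0) Y = Y" for Y :: "'a vec set"
    unfolding vprod_def by simp
  then show ?thesis by (simp add: obj_times_eq)
qed

context params
begin

section \<open>Compatibility of the defining relations with sum and product\<close>

abbreviation "objs \<equiv> {a. set_mset a \<subseteq> objects A}"

lemma in_objects [simp]: "(n, X) \<in> objects A \<longleftrightarrow> X \<in> definable A n"
  by (simp add: objects_def)

lemma kplus_eq_objs: "kplus_eq A a b \<Longrightarrow> a \<in> objs \<and> b \<in> objs"
  by (induction rule: kplus_eq.induct) (auto dest: isomorphic_definable)

lemma equiv_kplus: "equiv objs (kplus_rel A)"
proof (rule equivI)
  show "kplus_rel A \<subseteq> objs \<times> objs" using kplus_eq_objs by (auto simp: kplus_rel_def)
  show "refl_on objs (kplus_rel A)" by (auto simp: kplus_rel_def refl_on_def intro: kplus_eq.refl)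
  show "sym (kplus_rel A)" by (auto simp: kplus_rel_def sym_def intro: kplus_eq.sym)
  show "trans (kplus_rel A)" unfolding trans_def by (auto simp: kplus_rel_def intro: kplus_eq.trans)
qed

lemma kplus_eq_add2:
  assumes "kplus_eq A a a'" "kplus_eq A b b'"
  shows "kplus_eq A (a + b) (a' + b')"
proof (rule kplus_eq.trans)
  show "kplus_eq A (a + b) (a' + b)" using assms kplus_eq_objs by (auto intro: kplus_eq.add)
  show "kplus_eq A (a' + b) (a' + b')"
    using kplus_eq.add[OF assms(2), of a'] kplus_eq_objs[OF assms(1)] by (simp add: add.commute)
qed

text \<open>The relations have no separate clause for isomorphisms: one is obtained from the trivial
  splitting of \<open>X\<close> into itself and the empty set, whose class is then dropped.\<close>

lemma kplus_eq_iso: "isomorphic A n X Y \<Longrightarrow> kplus_eq A {#(n, X)#} {#(n, Y)#}"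
proof -
  assume iso: "isomorphic A n X Y"
  then have d: "X \<in> definable A n" "Y \<in> definable A n" using isomorphic_definable by blast+
  have "kplus_eq A {#(n, Y), (n, {})#} {#(n, X)#}"
    by (rule kplus_eq.split[OF d(1) d(1) definable_empty]) (use iso in \<open>auto intro: isomorphic_refl\<close>)
  moreover have "kplus_eq A ({#(n, {})#} + {#(n, Y)#}) ({#} + {#(n, Y)#})"
    by (rule kplus_eq.add[OF kplus_eq.empty]) (use d in auto)
  then have "kplus_eq A {#(n, Y), (n, {})#} {#(n, Y)#}" by (simp add: add_mset_commute)
  ultimately show ?thesis by (meson kplus_eq.sym kplus_eq.trans)
qed

lemma objects_times: "p \<in> objects A \<Longrightarrow> q \<in> objects A \<Longrightarrow> obj_times p q \<in> objects A"
  by (cases p; cases q) (simp add: obj_times_eq definable_vprod)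

lemma objs_times: "a \<in> objs \<Longrightarrow> b \<in> objs \<Longrightarrow> mset_times a b \<in> objs"
  by (induction a) (auto simp: objects_times)

text \<open>A splitting multiplied by a fixed object is again a splitting, and the isomorphisms of
  the parts extend to the products.\<close>

lemma kplus_eq_times_single:
  assumes "kplus_eq A a b" "q \<in> objects A"
  shows "kplus_eq A (mset_times a {#q#}) (mset_times b {#q#})"
  using assms(1)
proof induction
  case (refl a)
  then show ?case using objs_times[of a "{#q#}"] assms(2) by (intro kplus_eq.refl) auto
next
  case (add a b c)
  then show ?case using objs_times[of c "{#q#}"] assms(2) by (simp del: mset_times_simps(6)) (intro kplus_eq.add, auto)
next
  case (empty n)
  have "obj_times (n, {}) q = (n + fst q, {})" by (simp add: obj_times_def)
  then show ?case by (simp add: kplus_eq.empty)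
next
  case (split Z n Z1 Z2 X1 X2)
  obtain m W where [simp]: "q = (m, W)" by (cases q)
  have W: "W \<in> definable A m" using assms(2) by simp
  have "vprod Z W = vprod Z1 W \<union> vprod Z2 W" using split(4) by (auto simp: vprod_def)
  moreover have "vprod Z1 W \<inter> vprod Z2 W = {}"
  proof -
    have "x = x'" if "x @\<^sub>v y = x' @\<^sub>v y'" "x \<in> Z1" "x' \<in> Z2" for x x' y y'
      using that definable_subset[OF split(2)] definable_subset[OF split(3)] append_vec_eq[of x n x' y y'] by blast
    then show ?thesis using split(5) by (auto simp: vprod_def) blast
  qed
  ultimately have "kplus_eq A {#(n + m, vprod X1 W), (n + m, vprod X2 W)#} {#(n + m, vprod Z W)#}"
    using split W by (intro kplus_eq.split[where Z\<^sub>1 = "vprod Z1 W" and Z\<^sub>2 = "vprod Z2 W"]) (auto intro: definable_vprod isomorphic_vprod definable.union)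
  then show ?case by (simp add: obj_times_eq)
qed (auto intro: kplus_eq.sym kplus_eq.trans)

lemma kplus_eq_times_left:
  assumes "kplus_eq A a b" "c \<in> objs"
  shows "kplus_eq A (mset_times a c) (mset_times b c)"
  using assms(2)
proof (induction c)
  case (add q c)
  have "mset_times x (add_mset q c) = mset_times x {#q#} + mset_times x c" for x by simp
  then show ?case
    using add kplus_eq_times_single[OF assms(1), of q] by (simp only:) (intro kplus_eq_add2, auto)
qed (auto intro: kplus_eq.refl)

lemma kplus_eq_times_comm:
  assumes "a \<in> objs" "b \<in> objs"
  shows "kplus_eq A (mset_times a b) (mset_times b a)"
  using assms
proof (induction a)
  case (add p a)
  have "kplus_eq A (image_mset (obj_times p) b) (image_mset (\<lambda>q. obj_times q p) b)"
    using add(3)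
  proof (induction b)
    case (add q b)
    have "kplus_eq A {#obj_times p q#} {#obj_times q p#}"
      using add \<open>add_mset p a \<in> objs\<close>
      by (cases p; cases q) (auto simp: obj_times_eq isomorphic_vprod_swap add.commute intro!: kplus_eq_iso)
    then show ?case using kplus_eq_add2[of "{#obj_times p q#}"] add by fastforce
  qed (auto intro: kplus_eq.refl)
  then show ?case using add by (auto intro: kplus_eq_add2)
qed (auto intro: kplus_eq.refl)

text \<open>Compatibility is known directly in the left factor only; the right factor is handled by
  commuting, replacing and commuting back.\<close>

lemma kplus_eq_times:
  assumes "kplus_eq A a a'" "kplus_eq A b b'"
  shows "kplus_eq A (mset_times a b) (mset_times a' b')"
proof -
  note [trans] = kplus_eq.trans
  note o = kplus_eq_objs[OF assms(1)] kplus_eq_objs[OF assms(2)]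
  have "kplus_eq A (mset_times a b) (mset_times a' b)" using assms o by (blast intro: kplus_eq_times_left)
  also have "kplus_eq A (mset_times a' b) (mset_times b a')" using o by (blast intro: kplus_eq_times_comm)
  also have "kplus_eq A (mset_times b a') (mset_times b' a')" using assms o by (blast intro: kplus_eq_times_left)
  also have "kplus_eq A (mset_times b' a') (mset_times a' b')" using o by (blast intro: kplus_eq_times_comm)
  finally show ?thesis .
qed

section \<open>The graded semiring of classes\<close>

abbreviation kcl :: "'g obj multiset \<Rightarrow> 'g obj multiset set" where
  "kcl a \<equiv> kplus_rel A `` {a}"

lemma kcl_eqI: "kplus_eq A a b \<Longrightarrow> kcl a = kcl b"
  by (rule equiv_class_eq[OF equiv_kplus]) (simp add: kplus_rel_def)

lemma kcl_mem: "b \<in> kcl a \<longleftrightarrow> kplus_eq A a b"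
  by (simp add: kplus_rel_def)

lemma carrier_Kplus: "carrier (Kplus A) = kcl ` objs"
  by (auto simp: Kplus_def quotient_def)

lemma kcl_closed [simp]: "set_mset a \<subseteq> objects A \<Longrightarrow> kcl a \<in> carrier (Kplus A)"
  by (auto simp: carrier_Kplus)

lemma Kplus_zero: "\<zero>\<^bsub>Kplus A\<^esub> = kcl {#}" and Kplus_one: "\<one>\<^bsub>Kplus A\<^esub> = kcl {#(0, carrier_vec 0)#}"
  by (simp_all add: Kplus_def)

lemma UN_kcl:
  assumes "a \<in> objs" "b \<in> objs"
    "\<And>a' b'. kplus_eq A a a' \<Longrightarrow> kplus_eq A b b' \<Longrightarrow> kplus_eq A (f a b) (f a' b')"
  shows "(\<Union>a'\<in>kcl a. \<Union>b'\<in>kcl b. kcl (f a' b')) = kcl (f a b)"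
proof -
  have "kcl (f a' b') = kcl (f a b)" if "a' \<in> kcl a" "b' \<in> kcl b" for a' b'
    using that assms(3) kcl_eqI unfolding kcl_mem by blast
  moreover have "a \<in> kcl a" "b \<in> kcl b" using assms kplus_eq.refl unfolding kcl_mem by auto
  ultimately show ?thesis by blast
qed

lemma Kplus_add: "a \<in> objs \<Longrightarrow> b \<in> objs \<Longrightarrow> kcl a \<oplus>\<^bsub>Kplus A\<^esub> kcl b = kcl (a + b)"
  unfolding Kplus_def by (simp add: UN_kcl kplus_eq_add2)

lemma Kplus_mult: "a \<in> objs \<Longrightarrow> b \<in> objs \<Longrightarrow> kcl a \<otimes>\<^bsub>Kplus A\<^esub> kcl b = kcl (mset_times a b)"
  unfolding Kplus_def by (simp add: UN_kcl kplus_eq_times)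

lemma csemiring_Kplus: "csemiring (Kplus A)"
proof (rule csemiringI)
  show "\<zero>\<^bsub>Kplus A\<^esub> \<in> carrier (Kplus A)" "\<one>\<^bsub>Kplus A\<^esub> \<in> carrier (Kplus A)"
    by (simp_all add: Kplus_zero Kplus_one)
next
  fix x assume "x \<in> carrier (Kplus A)"
  then obtain a where [simp]: "x = kcl a" "a \<in> objs" by (auto simp: carrier_Kplus)
  have [simp]: "set_mset a \<subseteq> objects A" using \<open>a \<in> objs\<close> by simp
  show "\<zero>\<^bsub>Kplus A\<^esub> \<oplus>\<^bsub>Kplus A\<^esub> x = x" by (simp add: Kplus_zero Kplus_add)
  show "\<zero>\<^bsub>Kplus A\<^esub> \<otimes>\<^bsub>Kplus A\<^esub> x = \<zero>\<^bsub>Kplus A\<^esub>" by (simp add: Kplus_zero Kplus_mult)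
  have "obj_times (0, carrier_vec 0) = (\<lambda>q :: 'g obj. q)" by (rule ext) (rule obj_times_one)
  then have [simp]: "image_mset (obj_times (0, carrier_vec 0)) a = a" by simp
  show "\<one>\<^bsub>Kplus A\<^esub> \<otimes>\<^bsub>Kplus A\<^esub> x = x" by (simp add: Kplus_one Kplus_mult)
  fix y assume "y \<in> carrier (Kplus A)"
  then obtain b where [simp]: "y = kcl b" "b \<in> objs" by (auto simp: carrier_Kplus)
  have [simp]: "set_mset b \<subseteq> objects A" using \<open>b \<in> objs\<close> by simp
  show "x \<oplus>\<^bsub>Kplus A\<^esub> y \<in> carrier (Kplus A)" by (simp add: Kplus_add)
  show "x \<otimes>\<^bsub>Kplus A\<^esub> y \<in> carrier (Kplus A)" using objs_times[of a b] by (simp add: Kplus_mult)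
  show "x \<oplus>\<^bsub>Kplus A\<^esub> y = y \<oplus>\<^bsub>Kplus A\<^esub> x" by (simp add: Kplus_add add.commute)
  show "x \<otimes>\<^bsub>Kplus A\<^esub> y = y \<otimes>\<^bsub>Kplus A\<^esub> x"
    using kplus_eq_times_comm[of a b] by (simp add: Kplus_mult kcl_eqI)
  fix z assume "z \<in> carrier (Kplus A)"
  then obtain c where [simp]: "z = kcl c" "c \<in> objs" by (auto simp: carrier_Kplus)
  have [simp]: "set_mset c \<subseteq> objects A" using \<open>c \<in> objs\<close> by simp
  have [simp]: "set_mset (mset_times a' b') \<subseteq> objects A" if "set_mset a' \<subseteq> objects A" "set_mset b' \<subseteq> objects A" for a' b'
    using objs_times[of a' b'] that by simp
  show "x \<oplus>\<^bsub>Kplus A\<^esub> y \<oplus>\<^bsub>Kplus A\<^esub> z = x \<oplus>\<^bsub>Kplus A\<^esub> (y \<oplus>\<^bsub>Kplus A\<^esub> z)"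
    by (simp add: Kplus_add add.assoc)
  show "x \<otimes>\<^bsub>Kplus A\<^esub> y \<otimes>\<^bsub>Kplus A\<^esub> z = x \<otimes>\<^bsub>Kplus A\<^esub> (y \<otimes>\<^bsub>Kplus A\<^esub> z)"
    by (simp add: Kplus_mult mset_times_assoc)
  show "(x \<oplus>\<^bsub>Kplus A\<^esub> y) \<otimes>\<^bsub>Kplus A\<^esub> z = x \<otimes>\<^bsub>Kplus A\<^esub> z \<oplus>\<^bsub>Kplus A\<^esub> y \<otimes>\<^bsub>Kplus A\<^esub> z"
    by (simp add: Kplus_add Kplus_mult)
qed

abbreviation origin1 :: "'g vec set" where "origin1 \<equiv> {x \<in> carrier_vec 1. x $ 0 = 0}"

lemma definable_origin1 [simp]: "origin1 \<in> definable A 1"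
proof -
  have "int_lin (unit_vec 1 0) x = x $ 0" for x :: "'g vec" by (rule int_lin_unit) simp
  moreover have "{x \<in> carrier_vec 1. int_lin (unit_vec 1 0) x = 0} \<in> definable A 1"
    by (rule definable.lin_eq) (auto simp: zero_in_A)
  ultimately show ?thesis by simp
qed

lemmas definable_origin1' [simp] = definable_origin1[unfolded One_nat_def]

sublocale K: localized "Kplus A" "point0 A"
proof (rule csemiring.localizedI[OF csemiring_Kplus])
  show "point0 A \<in> carrier (Kplus A)" by (simp add: point0_def kplus_class_def)
qed

section \<open>Fractions of degree 0\<close>

lemma Kplus_degree_closed: "x \<in> Kplus_degree A n \<Longrightarrow> x \<in> carrier (Kplus A)"
  by (auto simp: Kplus_degree_def objects_def intro!: kcl_closed)

lemma Kplus_degreeE: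
  assumes "x \<in> Kplus_degree A n"
  obtains a where "x = kcl a" "set_mset a \<subseteq> {n} \<times> definable A n" "a \<in> objs"
  using assms by (auto simp: Kplus_degree_def objects_def)

lemma Kplus_degree_add: "x \<in> Kplus_degree A n \<Longrightarrow> y \<in> Kplus_degree A n \<Longrightarrow> x \<oplus>\<^bsub>Kplus A\<^esub> y \<in> Kplus_degree A n"
proof (elim Kplus_degreeE)
  fix a b assume "x = kcl a" "y = kcl b" "a \<in> objs" "b \<in> objs" "set_mset a \<subseteq> {n} \<times> definable A n"
    "set_mset b \<subseteq> {n} \<times> definable A n"
  then show ?thesis by (auto simp: Kplus_degree_def Kplus_add intro!: exI[of _ "a + b"])
qed

lemma Kplus_degree_mult: "x \<in> Kplus_degree A n \<Longrightarrow> y \<in> Kplus_degree A m \<Longrightarrow> x \<otimes>\<^bsub>Kplus A\<^esub> y \<in> Kplus_degree A (n + m)"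
proof (elim Kplus_degreeE)
  fix a b assume *: "x = kcl a" "y = kcl b" "a \<in> objs" "b \<in> objs" "set_mset a \<subseteq> {n} \<times> definable A n"
    "set_mset b \<subseteq> {m} \<times> definable A m"
  from *(5) have "set_mset (mset_times a b) \<subseteq> {n + m} \<times> definable A (n + m)"
  proof (induction a)
    case (add p a)
    then have "obj_times p q \<in> {n + m} \<times> definable A (n + m)" if "q \<in># b" for q
      using that *(6) by (cases p; cases q) (auto simp: obj_times_eq intro!: definable_vprod)
    then have "set_mset (image_mset (obj_times p) b) \<subseteq> {n + m} \<times> definable A (n + m)"
      unfolding set_image_mset by (rule image_subsetI)
    then show ?case using add by simp
  qed simp
  then show ?thesis unfolding Kplus_degree_def using * by (auto simp: Kplus_mult)
qed

text \<open>The inverted element is homogeneous of degree 1, so passing to a common denominator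
  keeps numerator and denominator in equal degree. Hence the fractions of degree 0 are closed under
  addition.\<close>

lemma Kplus_degree_pow: "point0 A [^]\<^bsub>Kplus A\<^esub> k \<in> Kplus_degree A k"
proof (induction k)
  case 0
  then show ?case by (auto simp: Kplus_one Kplus_degree_def intro!: exI[of _ "{#(0, carrier_vec 0)#}"])
next
  case (Suc k)
  have "point0 A \<in> Kplus_degree A 1"
    by (auto simp: point0_def kplus_class_def Kplus_degree_def intro!: exI[of _ "{#(1, origin1)#}"])
  from Kplus_degree_mult[OF Suc this] show ?case by simp
qed

abbreviation frac :: "'g obj multiset set \<Rightarrow> nat \<Rightarrow> ('g obj multiset set \<times> nat) set" where
  "frac \<equiv> fraction (Kplus A) (point0 A)"

lemma carrier_df: "carrier (Kplus_df A) = {frac a n | a n. a \<in> Kplus_degree A n}"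
  by (simp add: Kplus_df_def)

lemma df_simps:
  "\<zero>\<^bsub>Kplus_df A\<^esub> = \<zero>\<^bsub>K.L\<^esub>" "\<one>\<^bsub>Kplus_df A\<^esub> = \<one>\<^bsub>K.L\<^esub>"
  "x \<oplus>\<^bsub>Kplus_df A\<^esub> y = x \<oplus>\<^bsub>K.L\<^esub> y" "x \<otimes>\<^bsub>Kplus_df A\<^esub> y = x \<otimes>\<^bsub>K.L\<^esub> y"
  by (simp_all add: Kplus_df_def)

lemma frac_in_df [intro]: "a \<in> Kplus_degree A n \<Longrightarrow> frac a n \<in> carrier (Kplus_df A)"
  unfolding carrier_df by blast

lemma df_subset: "carrier (Kplus_df A) \<subseteq> carrier K.L"
  unfolding carrier_df using Kplus_degree_closed K.fraction_in_L by blast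

lemma csemiring_df: "csemiring (Kplus_df A)"
  unfolding Kplus_df_def
proof (rule csemiring.csemiring_carrier_update[OF K.csemiring_L], fold carrier_df)
  show "carrier (Kplus_df A) \<subseteq> carrier K.L" by (rule df_subset)
  have "kcl {#} \<in> Kplus_degree A 0" unfolding Kplus_degree_def by (auto intro!: exI[of _ "{#}"])
  then show "\<zero>\<^bsub>K.L\<^esub> \<in> carrier (Kplus_df A)" using K.L_zero[of 0] by (auto simp: Kplus_zero)
  have "\<one>\<^bsub>Kplus A\<^esub> \<in> Kplus_degree A 0" using Kplus_degree_pow[of 0] by simp
  then show "\<one>\<^bsub>K.L\<^esub> \<in> carrier (Kplus_df A)" by (auto simp: K.L_one)
  fix x y assume "x \<in> carrier (Kplus_df A)" "y \<in> carrier (Kplus_df A)"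
  then obtain a n b m where *: "x = frac a n" "y = frac b m" "a \<in> Kplus_degree A n" "b \<in> Kplus_degree A m"
    by (auto simp: carrier_df)
  note c = Kplus_degree_closed[OF *(3)] Kplus_degree_closed[OF *(4)]
  show "x \<otimes>\<^bsub>K.L\<^esub> y \<in> carrier (Kplus_df A)"
    using * c by (auto simp: K.L_mult intro: Kplus_degree_mult)
  have "b \<otimes>\<^bsub>Kplus A\<^esub> point0 A [^]\<^bsub>Kplus A\<^esub> n \<in> Kplus_degree A (n + m)"
    using Kplus_degree_mult[OF *(4) Kplus_degree_pow[of n]] by (simp add: add.commute)
  then show "x \<oplus>\<^bsub>K.L\<^esub> y \<in> carrier (Kplus_df A)"
    using * c Kplus_degree_mult[OF *(3) Kplus_degree_pow[of m]] by (auto simp: K.L_add intro: Kplus_degree_add)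
qed

sublocale D: csemiring "Kplus_df A" by (rule csemiring_df)

lemma cring_Kdf: "cring (Kdf A)"
  unfolding Kdf_def by (rule D.cring_C)

sublocale Kdf: cring "Kdf A" by (rule cring_Kdf)

lemma cring_KdfQ: "cring (KdfQ A)"
  unfolding KdfQ_def by (rule Kdf.cring_T)

sublocale Q: cring "KdfQ A" by (rule cring_KdfQ)

section \<open>Classes in the dimension-free ring\<close>

definition df_emb :: "('g obj multiset set \<times> nat) set \<Rightarrow> ((rat \<times> 'g kdf) \<Rightarrow>\<^sub>0 int) set" where
  "df_emb x = pure_tensor (Kdf A) 1 (formal_diff (Kplus_df A) x \<zero>\<^bsub>Kplus_df A\<^esub>)"

lemma formal_diff_Kdf [simp, intro]:
  "x \<in> carrier (Kplus_df A) \<Longrightarrow> y \<in> carrier (Kplus_df A) \<Longrightarrow> formal_diff (Kplus_df A) x y \<in> carrier (Kdf A)"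
  unfolding Kdf_def by (rule D.formal_diff_in_C)

lemma df_emb_hom:
  "df_emb \<in> Ring.ring_hom (Kplus_df A) (KdfQ A)"
proof (rule ring_hom_memI)
  fix x y assume xy: "x \<in> carrier (Kplus_df A)" "y \<in> carrier (Kplus_df A)"
  show "df_emb x \<in> carrier (KdfQ A)" unfolding df_emb_def KdfQ_def
    using xy by (intro Kdf.pure_tensor_closed formal_diff_Kdf D.zero_closed)
  show "df_emb (x \<otimes>\<^bsub>Kplus_df A\<^esub> y) = df_emb x \<otimes>\<^bsub>KdfQ A\<^esub> df_emb y"
    using xy D.C_mult[of x "\<zero>\<^bsub>Kplus_df A\<^esub>" y "\<zero>\<^bsub>Kplus_df A\<^esub>"] unfolding df_emb_def KdfQ_def
    by (subst Kdf.pure_tensor_mult) (auto simp: Kdf_def)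
  show "df_emb (x \<oplus>\<^bsub>Kplus_df A\<^esub> y) = df_emb x \<oplus>\<^bsub>KdfQ A\<^esub> df_emb y"
    using xy D.C_add[of x "\<zero>\<^bsub>Kplus_df A\<^esub>" y "\<zero>\<^bsub>Kplus_df A\<^esub>"] unfolding df_emb_def KdfQ_def
    by (subst Kdf.pure_tensor_add_r[symmetric]) (auto simp: Kdf_def)
next
  show "df_emb \<one>\<^bsub>Kplus_df A\<^esub> = \<one>\<^bsub>KdfQ A\<^esub>"
    unfolding df_emb_def KdfQ_def using Kdf.pure_tensor_one D.C_one by (simp add: Kdf_def)
qed

lemma df_emb_zero: "df_emb \<zero>\<^bsub>Kplus_df A\<^esub> = \<zero>\<^bsub>KdfQ A\<^esub>"
  unfolding df_emb_def KdfQ_def using Kdf.pure_tensor_zero_r[of 1] D.C_zero by (simp add: Kdf_def)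

text \<open>Division by the \<open>n\<close>-th power of the class of the origin makes classes from
  different dimensions comparable. Computations with classes use only invariance under isomorphism,
  additivity, multiplicativity and normalisation on the point.\<close>

definition cls :: "nat \<Rightarrow> 'g vec set \<Rightarrow> ((rat \<times> 'g kdf) \<Rightarrow>\<^sub>0 int) set" where
  "cls n X = df_emb (frac (kcl {#(n, X)#}) n)"

lemma df_class1_cls: "df_class1 A S = cls 1 {x \<in> carrier_vec 1. x $ 0 \<in> S}"
  by (simp add: df_class1_def cls_def df_emb_def kplus_class_def)

lemma kcl_degree [simp, intro]: "X \<in> definable A n \<Longrightarrow> kcl {#(n, X)#} \<in> Kplus_degree A n"
  unfolding Kplus_degree_def by (auto intro!: exI[of _ "{#(n, X)#}"])

lemma cls_closed [simp, intro]: "X \<in> definable A n \<Longrightarrow> cls n X \<in> carrier (KdfQ A)"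
  unfolding cls_def by (intro ring_hom_closed[OF df_emb_hom] frac_in_df kcl_degree)

lemma cls_iso: "isomorphic A n X Y \<Longrightarrow> cls n X = cls n Y"
  using kcl_eqI[OF kplus_eq_iso] by (simp add: cls_def)

lemma cls_empty [simp]: "cls n {} = \<zero>\<^bsub>KdfQ A\<^esub>"
  using kcl_eqI[OF kplus_eq.empty[of A n]] K.L_zero[of n] df_emb_zero
  by (simp add: cls_def Kplus_zero df_simps)

lemma cls_union:
  assumes "X \<in> definable A n" "Y \<in> definable A n" "X \<inter> Y = {}"
  shows "cls n (X \<union> Y) = cls n X \<oplus>\<^bsub>KdfQ A\<^esub> cls n Y"
proof -
  have "kplus_eq A {#(n, X), (n, Y)#} {#(n, X \<union> Y)#}"
    using assms by (intro kplus_eq.split[where Z\<^sub>1 = X and Z\<^sub>2 = Y]) (auto intro: isomorphic_refl definable.union)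
  then have "kcl {#(n, X \<union> Y)#} = kcl {#(n, X)#} \<oplus>\<^bsub>Kplus A\<^esub> kcl {#(n, Y)#}"
    using assms by (subst Kplus_add) (auto simp: kcl_eqI add_mset_commute)
  then show ?thesis
    using assms by (simp add: cls_def df_simps frac_in_df flip: K.L_add_same ring_hom_add[OF df_emb_hom])
qed

lemma cls_vprod:
  assumes "X \<in> definable A n" "Y \<in> definable A m"
  shows "cls (n + m) (vprod X Y) = cls n X \<otimes>\<^bsub>KdfQ A\<^esub> cls m Y"
proof -
  have "kcl {#(n + m, vprod X Y)#} = kcl {#(n, X)#} \<otimes>\<^bsub>Kplus A\<^esub> kcl {#(m, Y)#}"
    using assms by (subst Kplus_mult) (auto simp: obj_times_eq)
  then show ?thesis
    using assms by (simp add: cls_def df_simps frac_in_df flip: K.L_mult ring_hom_mult[OF df_emb_hom])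
qed

lemma cls_dim0: "cls 0 (carrier_vec 0) = \<one>\<^bsub>KdfQ A\<^esub>"
  using ring_hom_one[OF df_emb_hom] by (simp add: cls_def df_simps K.L_one Kplus_one)

lemma cls_origin1: "cls 1 origin1 = \<one>\<^bsub>KdfQ A\<^esub>"
proof -
  have "frac (\<one>\<^bsub>Kplus A\<^esub> \<otimes>\<^bsub>Kplus A\<^esub> point0 A [^]\<^bsub>Kplus A\<^esub> (1::nat)) (0 + 1) = frac \<one>\<^bsub>Kplus A\<^esub> 0"
    by (rule K.fraction_pow) simp
  then have "frac (point0 A) 1 = \<one>\<^bsub>Kplus_df A\<^esub>" by (simp add: df_simps K.L_one)
  then show ?thesis
    using ring_hom_one[OF df_emb_hom] by (simp add: cls_def point0_def kplus_class_def)
qed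

lemma cls_diff:
  assumes "X \<in> definable A n" "Y \<in> definable A n" "Y \<subseteq> X"
  shows "cls n (X - Y) = cls n X \<ominus>\<^bsub>KdfQ A\<^esub> cls n Y"
proof -
  have "X - Y \<in> definable A n" using assms by (simp add: definable_diff)
  moreover have "cls n X = cls n (X - Y) \<oplus>\<^bsub>KdfQ A\<^esub> cls n Y"
    using cls_union[of "X - Y" n Y] assms by (simp add: definable_diff Un_absorb2 Int_commute)
  ultimately show ?thesis
    using assms by (simp add: a_minus_def Q.add.m_assoc Q.r_neg)
qed

text \<open>Elements of the completed ring are differences of fractions, and the numerator of a
  fraction of degree 0 is a formal sum of objects in a single dimension \<open>n\<close>; its image
  is a sum of classes \<open>cls n X\<close>.\<close>

lemma rat_subalgebra_eqI_cls:
  assumes S: "S \<subseteq> carrier (KdfQ A)"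
    and gen: "\<And>n X. X \<in> definable A n \<Longrightarrow> cls n X \<in> rat_subalgebra (Kdf A) S"
  shows "rat_subalgebra (Kdf A) S = carrier (KdfQ A)"
  unfolding KdfQ_def
proof (rule Kdf.rat_subalgebra_eqI)
  show S': "S \<subseteq> carrier Kdf.T" using S by (simp add: KdfQ_def)
  have "subring (rat_subalgebra (Kdf A) S) (KdfQ A)"
    unfolding rat_subalgebra_def KdfQ_def
    by (rule ring.generate_ring_is_subring) (use Kdf.cring_T S' in \<open>auto simp: cring_def\<close>)
  note sub = subringE[OF this]
  have df: "df_emb x \<in> rat_subalgebra (Kdf A) S" if xc: "x \<in> carrier (Kplus_df A)" for x
  proof -
    obtain y n where x: "x = frac y n" "y \<in> Kplus_degree A n" using xc unfolding carrier_df by blast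
    then obtain a where a: "y = kcl a" "set_mset a \<subseteq> {n} \<times> definable A n" by (auto elim: Kplus_degreeE)
    have "df_emb (frac (kcl a) n) \<in> rat_subalgebra (Kdf A) S" using a(2)
    proof (induction a)
      case empty
      then show ?case using sub(2) K.L_zero[of n] df_emb_zero by (simp add: Kplus_zero df_simps)
    next
      case (add p a)
      then obtain X where p: "p = (n, X)" "X \<in> definable A n" by auto
      have a: "a \<in> objs" "kcl a \<in> Kplus_degree A n"
        using add by (auto simp: objects_def Kplus_degree_def)
      then have "kcl (add_mset p a) = kcl {#(n, X)#} \<oplus>\<^bsub>Kplus A\<^esub> kcl a"
        using p by (subst Kplus_add) auto
      then have "df_emb (frac (kcl (add_mset p a)) n) = cls n X \<oplus>\<^bsub>KdfQ A\<^esub> df_emb (frac (kcl a) n)"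
        using a p Kplus_degree_closed[OF a(2)]
        by (simp add: cls_def df_simps frac_in_df flip: K.L_add_same ring_hom_add[OF df_emb_hom])
      then show ?case using sub(7) add gen[OF p(2)] by simp
    qed
    then show ?thesis using x a by simp
  qed
  fix z assume "z \<in> carrier (Kdf A)"
  then obtain x y where z: "z = formal_diff (Kplus_df A) x y" "x \<in> carrier (Kplus_df A)" "y \<in> carrier (Kplus_df A)"
    by (auto simp: Kdf_def D.carrier_C)
  define i where "i x = formal_diff (Kplus_df A) x \<zero>\<^bsub>Kplus_df A\<^esub>" for x
  have i: "i x \<in> carrier (Kdf A)" "i y \<in> carrier (Kdf A)" using z by (auto simp: i_def)
  have "z = i x \<oplus>\<^bsub>Kdf A\<^esub> \<ominus>\<^bsub>Kdf A\<^esub> i y"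
    using z by (simp add: i_def Kdf_def D.C_uminus D.C_add)
  then have "pure_tensor (Kdf A) 1 z = df_emb x \<oplus>\<^bsub>KdfQ A\<^esub> \<ominus>\<^bsub>KdfQ A\<^esub> df_emb y"
    using i Kdf.pure_tensor_add_r[of "i x" "\<ominus>\<^bsub>Kdf A\<^esub> i y" 1] Kdf.pure_tensor_uminus_r[of "i y" 1]
    unfolding df_emb_def KdfQ_def i_def[symmetric] by simp
  then show "pure_tensor (Kdf A) 1 z \<in> rat_subalgebra (Kdf A) S"
    using df z sub(5,7) by simp
qed

text \<open>The universal property of the construction: an additive and multiplicative isomorphism
  invariant with value 1 on the origin descends through formal sums, fractions, formal differences
  and tensors.\<close>

lemma character_KdfQ_exists:
  fixes h :: "nat \<Rightarrow> 'g vec set \<Rightarrow> rat"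
  assumes emp: "\<And>n. h n {} = 0"
    and iso: "\<And>n X Y. isomorphic A n X Y \<Longrightarrow> h n X = h n Y"
    and un: "\<And>n X Y. X \<in> definable A n \<Longrightarrow> Y \<in> definable A n \<Longrightarrow> X \<inter> Y = {} \<Longrightarrow> h n (X \<union> Y) = h n X + h n Y"
    and prod: "\<And>n m X Y. X \<in> definable A n \<Longrightarrow> Y \<in> definable A m \<Longrightarrow> h (n + m) (vprod X Y) = h n X * h m Y"
    and dim0: "h 0 (carrier_vec 0) = 1" and origin: "h 1 origin1 = 1"
  obtains \<phi> where "character (KdfQ A) \<phi>" "\<And>n X. X \<in> definable A n \<Longrightarrow> \<phi> (cls n X) = h n X"
    "\<And>q. \<phi> (pure_tensor (Kdf A) q \<one>\<^bsub>Kdf A\<^esub>) = q"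
proof -
  define H where "H a = (\<Sum>p\<in>#a. h (fst p) (snd p))" for a
  have H: "H a = H b" if "kplus_eq A a b" for a b
    using that
  proof induction
    case (split Z n Z1 Z2 X1 X2)
    then show ?case using un[of Z1 n Z2] iso[of n Z1 X1] iso[of n Z2 X2] by (simp add: H_def)
  qed (auto simp: H_def emp)
  define \<phi>0 where "\<phi>0 X = the_elem (H ` X)" for X
  have \<phi>0: "\<phi>0 (kcl a) = H a" if "a \<in> objs" for a
    unfolding \<phi>0_def
    by (rule the_elem_image_const[of a]) (use that H kplus_eq.refl[of a A] in \<open>auto simp: kplus_rel_def\<close>)
  have "H (mset_times a b) = H a * H b" if "a \<in> objs" "b \<in> objs" for a b
    using that
  proof (induction a)
    case (add p a)
    have "H (image_mset (obj_times p) b) = h (fst p) (snd p) * H b"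
      using add(3)
    proof (induction b)
      case (add q b)
      then show ?case using \<open>add_mset p a \<in> objs\<close> prod
        by (cases p; cases q) (auto simp: H_def obj_times_eq algebra_simps)
    qed (simp add: H_def)
    then show ?case using add by (simp add: H_def algebra_simps)
  qed (simp add: H_def)
  then have c0: "character (Kplus A) \<phi>0"
    unfolding character_def using objs_times
    by (auto simp: carrier_Kplus Kplus_zero Kplus_one Kplus_add Kplus_mult \<phi>0) (auto simp: H_def dim0)
  \<comment> \<open>The inverted element needs the value 1 for \<open>loc_lift\<close> to be
    independent of the representative.\<close>
  have s: "\<phi>0 (point0 A) = 1"
    by (simp add: point0_def kplus_class_def \<phi>0) (simp add: H_def origin[simplified])
  let ?\<phi>1 = "K.loc_lift \<phi>0"
  have c1: "character (Kplus_df A) ?\<phi>1"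
    using K.character_loc_lift[OF c0 s] df_subset unfolding character_def df_simps by blast
  let ?\<phi>2 = "D.compl_lift ?\<phi>1"
  have c2: "character (Kdf A) ?\<phi>2"
    unfolding Kdf_def by (rule D.character_compl_lift[OF c1])
  let ?\<phi>3 = "Kdf.tensor_lift ?\<phi>2"
  show ?thesis
  proof (rule that[of ?\<phi>3])
    show "character (KdfQ A) ?\<phi>3" unfolding KdfQ_def by (rule Kdf.character_tensor_lift[OF c2])
    show "?\<phi>3 (pure_tensor (Kdf A) q \<one>\<^bsub>Kdf A\<^esub>) = q" for q
      using c2 by (simp add: Kdf.tensor_lift_pure[OF c2] character_def)
    fix n and X :: "'g vec set" assume X: "X \<in> definable A n"
    then have "frac (kcl {#(n, X)#}) n \<in> carrier (Kplus_df A)" by auto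
    then have "?\<phi>3 (cls n X) = ?\<phi>1 (frac (kcl {#(n, X)#}) n)"
      using c1 unfolding cls_def df_emb_def
      by (simp add: Kdf.tensor_lift_pure[OF c2] D.compl_lift_formal_diff[OF c1] character_def)
    also have "\<dots> = h n X"
      using X by (subst K.loc_lift_fraction[OF c0 s]) (simp_all add: \<phi>0 H_def)
    finally show "?\<phi>3 (cls n X) = h n X" .
  qed
qed

end

section \<open>Signed decomposition into unimodular boxes\<close>

text \<open>Coefficients are a function, not a vector, so that updates such as
  \<open>l(i := c)\<close> and combinations of forms are plain function expressions. Values at
  indices from \<open>n\<close> on do not enter.\<close>

definition lform :: "nat \<Rightarrow> (nat \<Rightarrow> int) \<Rightarrow> 'g::ab_group_add vec \<Rightarrow> 'g" where
  "lform n l x = (\<Sum>i<n. zscale (l i) (x $ i))"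

text \<open>\<open>s\<close> selects the strict inequality. The bound comes first, so that the
  relation can also compare lower with upper end points.\<close>

definition beyond :: "bool \<Rightarrow> 'g::linorder \<Rightarrow> 'g \<Rightarrow> bool" where
  "beyond s b y \<longleftrightarrow> (if s then b < y else b \<le> y)"

definition half :: "nat \<Rightarrow> bool \<times> (nat \<Rightarrow> int) \<times> 'g \<Rightarrow> 'g::linordered_ab_group_add vec set" where
  "half n h = {x \<in> carrier_vec n. beyond (fst h) (snd (snd h)) (lform n (fst (snd h)) x)}"

definition box :: "nat \<Rightarrow> nat set \<Rightarrow> (nat \<Rightarrow> bool) \<Rightarrow> (nat \<Rightarrow> 'g) \<Rightarrow> 'g::linordered_ab_group_add vec set" where
  "box n S s b = {x \<in> carrier_vec n. \<forall>i\<in>S. beyond (s i) (b i) (x $ i)}"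

definition coord_upd :: "nat \<Rightarrow> 'g vec \<Rightarrow> nat \<Rightarrow> 'g \<Rightarrow> 'g vec" where
  "coord_upd n x j v = vec n (\<lambda>i. if i = j then v else x $ i)"

definition shear :: "nat \<Rightarrow> nat \<Rightarrow> nat \<Rightarrow> int \<Rightarrow> 'g::ab_group_add vec \<Rightarrow> 'g vec" where
  "shear n i j k x = coord_upd n x j (x $ j + zscale k (x $ i))"

definition flip :: "nat \<Rightarrow> nat \<Rightarrow> 'g::ab_group_add vec \<Rightarrow> 'g vec" where
  "flip n j x = coord_upd n x j (- (x $ j))"

section \<open>Linear forms under shears and reflections\<close>

lemma coord_upd_simps [simp]:
  "coord_upd n x j v \<in> carrier_vec n" "i < n \<Longrightarrow> coord_upd n x j v $ i = (if i = j then v else x $ i)"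
  by (auto simp: coord_upd_def)

lemma lform_coord_upd:
  assumes "j < n"
  shows "lform n l (coord_upd n x j v) = lform n l x + zscale (l j) (v - x $ j)"
proof -
  have "lform n l (coord_upd n x j v) = (\<Sum>i<n. zscale (l i) (x $ i) + (if i = j then zscale (l j) (v - x $ j) else 0))"
    unfolding lform_def by (rule sum.cong) (auto simp: zscale.scale_right_diff_distrib)
  also have "\<dots> = lform n l x + zscale (l j) (v - x $ j)"
    using assms by (simp add: sum.distrib lform_def)
  finally show ?thesis .
qed

lemma lform_fun_upd:
  assumes "i < n"
  shows "lform n (l(i := c)) x = lform n l x + zscale (c - l i) (x $ i)"
proof -
  have "lform n (l(i := c)) x = (\<Sum>j<n. zscale (l j) (x $ j) + (if j = i then zscale (c - l i) (x $ i) else 0))"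
    unfolding lform_def by (rule sum.cong) (auto simp: zscale.scale_left_diff_distrib)
  also have "\<dots> = lform n l x + zscale (c - l i) (x $ i)"
    using assms by (simp add: sum.distrib lform_def)
  finally show ?thesis .
qed

lemma lform_comb: "lform n (\<lambda>i. p * l i + q * m i) x = zscale p (lform n l x) + zscale q (lform n m x)"
  by (simp add: lform_def zscale.scale_left_distrib zscale.scale_sum_right sum.distrib)

lemma lform_uminus: "lform n (\<lambda>i. - l i) x = - lform n l x"
  by (simp add: lform_def sum_negf)

text \<open>The shear adds \<open>zscale k (x $ i)\<close> to coordinate \<open>j\<close>, which is
  compensated by lowering the coefficient at \<open>i\<close> by \<open>k * l j\<close>. On
  coefficients, shears are thus the division steps of Euclid's algorithm.\<close>

lemma lform_shear:
  "i < n \<Longrightarrow> j < n \<Longrightarrow> i \<noteq> j \<Longrightarrow> lform n (l(i := l i - k * l j)) (shear n i j k x) = lform n l x"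
  by (simp add: shear_def lform_coord_upd lform_fun_upd mult.commute zscale.scale_right_distrib)

lemma lform_flip: "j < n \<Longrightarrow> lform n (l(j := - l j)) (flip n j x) = lform n l x"
  using zscale.scale_left_distrib[of "l j" "l j" "x $ j"]
  by (simp add: flip_def lform_coord_upd lform_fun_upd zscale.scale_right_diff_distrib)

lemma lform_single:
  assumes "j < n" "\<And>i. i \<noteq> j \<Longrightarrow> l i = 0"
  shows "lform n l x = zscale (l j) (x $ j)"
proof -
  have "lform n l x = (\<Sum>i<n. if i = j then zscale (l j) (x $ j) else 0)"
    unfolding lform_def by (rule sum.cong) (use assms in auto)
  then show ?thesis using assms(1) by simp
qed

lemma beyond_zscale: "0 < k \<Longrightarrow> beyond s (zscale k b) (zscale k y) \<longleftrightarrow> beyond s b (y :: 'g::linordered_ab_group_add)"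
  by (simp add: beyond_def zscale_less_iff zscale_le_iff)

lemma not_beyond: "\<not> beyond s b y \<longleftrightarrow> beyond (\<not> s) (- b) (- y :: 'g::linordered_ab_group_add)"
  by (auto simp: beyond_def)

text \<open>The two parts become inclusions: the intersection of two half-spaces lies in that of the
  combined form, which lies in their union. Strictness is inherited from the first constraint; from
  the second one only the weak inequality enters.\<close>

lemma beyond_comb:
  fixes x y :: "'g::linordered_ab_group_add"
  assumes "0 < p" "0 < q"
  shows "beyond s b x \<Longrightarrow> beyond t c y \<Longrightarrow> beyond s (zscale p b + zscale q c) (zscale p x + zscale q y)"
    and "\<not> beyond s b x \<Longrightarrow> \<not> beyond t c y \<Longrightarrow> \<not> beyond s (zscale p b + zscale q c) (zscale p x + zscale q y)"
proof -
  show "beyond s (zscale p b + zscale q c) (zscale p x + zscale q y)" if "beyond s b x" "beyond t c y"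
  proof -
    have "zscale q c \<le> zscale q y" using that(2) assms by (auto simp: beyond_def zscale_le_iff split: if_splits)
    then show ?thesis using that(1) assms
      by (auto simp: beyond_def zscale_le_iff zscale_less_iff add_less_le_mono add_mono split: if_splits)
  qed
  show "\<not> beyond s (zscale p b + zscale q c) (zscale p x + zscale q y)" if "\<not> beyond s b x" "\<not> beyond t c y"
  proof -
    have "zscale q y \<le> zscale q c" using that(2) assms by (auto simp: beyond_def zscale_le_iff split: if_splits)
    then show ?thesis using that(1) assms
      by (auto simp: beyond_def zscale_le_iff zscale_less_iff not_less not_le add_less_le_mono add_mono split: if_splits)
  qed
qed

locale doag_params = params A for A :: "'g::doag set"
begin

section \<open>Rational bounds and unimodular sets\<close>

abbreviation "B \<equiv> div_hull A"

lemma add_subgroup_B: "add_subgroup B"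
  unfolding add_subgroup_def div_hull_def
proof (safe)
  show "\<exists>n>0. zscale (int n) 0 \<in> A" by (rule exI[of _ 1]) (simp add: zero_in_A)
next
  fix a b m n assume *: "zscale (int m) a \<in> A" "zscale (int n) b \<in> A" "0 < m" "0 < n"
  have "zscale (int (m * n)) (a + b) = zscale (int n) (zscale (int m) a) + zscale (int m) (zscale (int n) b)"
    by (simp add: zscale.scale_right_distrib mult.commute)
  also have "\<dots> \<in> A" using zscale_in_subgroup[OF A] A * unfolding add_subgroup_def by blast
  finally show "\<exists>k>0. zscale (int k) (a + b) \<in> A" using * by (intro exI[of _ "m * n"]) simp
next
  fix a m assume "zscale (int m) a \<in> A" "0 < m"
  then show "\<exists>k>0. zscale (int k) (- a) \<in> A" using A by (intro exI[of _ m]) (simp add: add_subgroup_def)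
qed

lemma A_subset_B: "A \<subseteq> B"
  unfolding div_hull_def by (auto intro!: exI[of _ 1])

text \<open>Division takes place in the ambient group. If \<open>m\<close> times \<open>b\<close>
  lies in \<open>A\<close>, then so does \<open>m * k\<close> times the quotient of \<open>b\<close>
  by \<open>k\<close>.\<close>

lemma B_divide:
  assumes "b \<in> B" "0 < k"
  obtains c where "c \<in> B" "zscale k c = b"
proof -
  obtain c where c: "zscale k c = b"
    using divisible[of "nat k" b] assms by (auto simp: zscale_def)
  obtain m where m: "0 < m" "zscale (int m) b \<in> A" using assms by (auto simp: div_hull_def)
  have "zscale (int (m * nat k)) c \<in> A" using m c assms(2) zscale.scale_scale[of "int m" k c] by simp
  then have "c \<in> B" unfolding div_hull_def using m assms by (auto intro!: exI[of _ "m * nat k"])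
  with c show ?thesis by (rule that[rotated])
qed

lemma B_closed: "b \<in> B \<Longrightarrow> c \<in> B \<Longrightarrow> zscale p b + zscale q c \<in> B" "b \<in> B \<Longrightarrow> - b \<in> B"
  using add_subgroup_B zscale_in_subgroup[OF add_subgroup_B] by (auto simp: add_subgroup_def)

text \<open>Differences of nested sets encode subtraction of indicator functions, so the class of
  such a set is a signed sum of classes of boxes. \<open>V\<close> bounds the coordinates that may
  be constrained or moved; the elimination of variables relies on all others staying free.\<close>

inductive_set unimod :: "nat \<Rightarrow> nat set \<Rightarrow> 'g vec set set" for n V where
  box: "S \<subseteq> V \<Longrightarrow> \<forall>i\<in>S. b i \<in> B \<Longrightarrow> box n S s b \<in> unimod n V"
| diff: "X \<in> unimod n V \<Longrightarrow> Y \<in> unimod n V \<Longrightarrow> Y \<subseteq> X \<Longrightarrow> X - Y \<in> unimod n V"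
| shear: "X \<in> unimod n V \<Longrightarrow> i \<in> V \<Longrightarrow> j \<in> V \<Longrightarrow> i \<noteq> j \<Longrightarrow> {x \<in> carrier_vec n. shear n i j k x \<in> X} \<in> unimod n V"
| flip: "X \<in> unimod n V \<Longrightarrow> j \<in> V \<Longrightarrow> {x \<in> carrier_vec n. flip n j x \<in> X} \<in> unimod n V"

lemma unimod_mono: "X \<in> unimod n V \<Longrightarrow> V \<subseteq> W \<Longrightarrow> X \<in> unimod n W"
  by (induction rule: unimod.induct) (auto intro: unimod.intros)

text \<open>The relation \<open>1\<^sub>H\<^sub>1 1\<^sub>H\<^sub>2 = 1\<^sub>H\<^sub>m 1\<^sub>H\<^sub>1 + 1\<^sub>H\<^sub>m 1\<^sub>H\<^sub>2 - 1\<^sub>H\<^sub>m\<close> for a positive combination \<open>m\<close> of the two forms;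
  it replaces a pair of constraints by pairs involving \<open>m\<close>, in which a variable can be eliminated.\<close>

lemma unimod_combine:
  assumes "0 < p" "0 < q"
    and m: "m = (\<lambda>i. p * l1 i + q * l2 i)" "c = zscale p b1 + zscale q b2"
    and U: "R \<inter> half n (s1, m, c) \<in> unimod n V"
    and X: "R \<inter> half n (s1, m, c) \<inter> half n (s1, l1, b1) \<in> unimod n V"
    and Y: "R \<inter> half n (s1, m, c) \<inter> half n (s2, l2, b2) \<in> unimod n V"
  shows "R \<inter> half n (s1, l1, b1) \<inter> half n (s2, l2, b2) \<in> unimod n V"
proof -
  have 1: "half n (s1, l1, b1) \<inter> half n (s2, l2, b2) \<subseteq> half n (s1, m, c)"
    using beyond_comb(1)[OF assms(1,2)] unfolding half_def m by (auto simp: lform_comb)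
  have 2: "half n (s1, m, c) \<subseteq> half n (s1, l1, b1) \<union> half n (s2, l2, b2)"
    using beyond_comb(2)[OF assms(1,2), of s1 b1 "lform n l1 x" s2 b2 "lform n l2 x" for x]
    unfolding half_def m by (auto simp: lform_comb)
  let ?U = "R \<inter> half n (s1, m, c)"
  \<comment> \<open>The relation is arranged as X - (U - Y). Both differences are nested, the outer
    one because U is covered by the two half-spaces.\<close>
  have "R \<inter> half n (s1, l1, b1) \<inter> half n (s2, l2, b2)
      = ?U \<inter> half n (s1, l1, b1) - (?U - ?U \<inter> half n (s2, l2, b2))"
    using 1 by blast
  moreover have "?U - ?U \<inter> half n (s2, l2, b2) \<in> unimod n V" using U Y by (rule unimod.diff) blast
  then have "?U \<inter> half n (s1, l1, b1) - (?U - ?U \<inter> half n (s2, l2, b2)) \<in> unimod n V"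
    by (rule unimod.diff[OF X]) (use 2 in blast)
  ultimately show ?thesis by simp
qed

section \<open>Intersecting a unimodular set with one half-space\<close>

lemma box_shear:
  assumes "j \<notin> S" "S \<subseteq> {..<n}" "x \<in> carrier_vec n"
  shows "shear n i j k x \<in> box n S s b \<longleftrightarrow> x \<in> box n S s b"
  using assms by (auto simp: box_def shear_def subset_iff)

lemma box_flip:
  assumes "j \<notin> S" "S \<subseteq> {..<n}" "x \<in> carrier_vec n"
  shows "flip n j x \<in> box n S s b \<longleftrightarrow> x \<in> box n S s b"
  using assms by (auto simp: box_def flip_def subset_iff)

lemma half_shear:
  "i < n \<Longrightarrow> j < n \<Longrightarrow> i \<noteq> j \<Longrightarrow> x \<in> carrier_vec n \<Longrightarrow>
    shear n i j k x \<in> half n (t, l(i := l i - k * l j), c) \<longleftrightarrow> x \<in> half n (t, l, c)"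
  by (auto simp: half_def lform_shear) (auto simp: shear_def)

lemma half_flip:
  "j < n \<Longrightarrow> x \<in> carrier_vec n \<Longrightarrow>
    flip n j x \<in> half n (t, l(j := - l j), c) \<longleftrightarrow> x \<in> half n (t, l, c)"
  by (auto simp: half_def lform_flip) (auto simp: flip_def)

text \<open>\<open>g\<close> is the size of the coefficient at the one new coordinate
  \<open>j\<close>, the quantity that Euclid's algorithm decreases. Quantifying over
  \<open>V\<close> and \<open>j\<close> allows the hypothesis for smaller \<open>g\<close> to be
  used after another coordinate has taken the role of \<open>j\<close>.\<close>

definition box_half :: "nat \<Rightarrow> nat \<Rightarrow> bool" where
  "box_half n g \<longleftrightarrow> (\<forall>V j S s b t l c. V \<subseteq> {..<n} \<longrightarrow> j < n \<longrightarrow> j \<notin> V \<longrightarrow> S \<subseteq> V \<longrightarrow> (\<forall>i\<in>S. b i \<in> B) \<longrightarrow>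
     (\<forall>i. i \<notin> insert j V \<longrightarrow> l i = 0) \<longrightarrow> l j \<noteq> 0 \<longrightarrow> nat \<bar>l j\<bar> = g \<longrightarrow> c \<in> B \<longrightarrow>
     box n S s b \<inter> half n (t, l, c) \<in> unimod n (insert j V))"

lemma box_halfD:
  assumes "box_half n g" "V \<subseteq> {..<n}" "j < n" "j \<notin> V" "S \<subseteq> V" "\<forall>i\<in>S. b i \<in> B"
    "\<forall>i. i \<notin> insert j V \<longrightarrow> l i = 0" "l j \<noteq> 0" "nat \<bar>l j\<bar> = g" "c \<in> B"
  shows "box n S s b \<inter> half n (t, l, c) \<in> unimod n (insert j V)"
  using assms unfolding box_half_def by blast

text \<open>The coordinate changes that build \<open>Y\<close> take place within \<open>V\<close>.
  Moving them across the half-space alters the form but not its coefficient at \<open>j\<close>, so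
  boxes with the same \<open>g\<close> are enough.\<close>

lemma unimod_inter_half:
  assumes bh: "box_half n g" and V: "V \<subseteq> {..<n}" "j < n" "j \<notin> V"
    and "Y \<in> unimod n V" "\<forall>i. i \<notin> insert j V \<longrightarrow> l i = 0" "l j \<noteq> 0" "nat \<bar>l j\<bar> = g" "c \<in> B"
  shows "Y \<inter> half n (t, l, c) \<in> unimod n (insert j V)"
  using assms(5-)
proof (induction arbitrary: l rule: unimod.induct)
  case (box S b s)
  then show ?case using box_halfD[OF bh V] by blast
next
  case (diff X Y)
  have "(X - Y) \<inter> half n (t, l, c) = X \<inter> half n (t, l, c) - Y \<inter> half n (t, l, c)" by blast
  then show ?case using diff by (auto intro!: unimod.diff)
next
  case (shear X i i' k)
  define l' where "l' = l(i := l i - k * l i')"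
  have "X \<inter> half n (t, l', c) \<in> unimod n (insert j V)"
    by (rule shear.IH) (use shear V in \<open>auto simp: l'_def\<close>)
  from unimod.shear[OF this, of i i' k] have
    "{x \<in> carrier_vec n. shear n i i' k x \<in> X \<inter> half n (t, l', c)} \<in> unimod n (insert j V)"
    using shear by auto
  also have "{x \<in> carrier_vec n. shear n i i' k x \<in> X \<inter> half n (t, l', c)}
      = {x \<in> carrier_vec n. shear n i i' k x \<in> X} \<inter> half n (t, l, c)"
    using half_shear[of i n i' _ k t l c] shear V unfolding l'_def by (auto simp: half_def subset_iff)
  finally show ?case .
next
  case (flip X i)
  define l' where "l' = l(i := - l i)"
  have "X \<inter> half n (t, l', c) \<in> unimod n (insert j V)"
    by (rule flip.IH) (use flip V in \<open>auto simp: l'_def\<close>)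
  from unimod.flip[OF this, of i] have
    "{x \<in> carrier_vec n. flip n i x \<in> X \<inter> half n (t, l', c)} \<in> unimod n (insert j V)"
    using flip by auto
  also have "{x \<in> carrier_vec n. flip n i x \<in> X \<inter> half n (t, l', c)}
      = {x \<in> carrier_vec n. flip n i x \<in> X} \<inter> half n (t, l, c)"
    using half_flip[of i n _ t l c] flip V unfolding l'_def by (auto simp: half_def subset_iff)
  finally show ?case .
qed

text \<open>Euclid's algorithm: a shear makes the coefficient of some other variable \<open>x\<^sub>i\<close> in \<open>l\<close> a
  negative remainder modulo that of \<open>x\<^sub>j\<close>. If the box does not constrain \<open>x\<^sub>i\<close>, then \<open>x\<^sub>i\<close> takes over
  the role of \<open>x\<^sub>j\<close>; otherwise \<open>x\<^sub>i\<close> is eliminated from \<open>l\<close> by means of its lower bound.\<close>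

lemma box_half: "box_half n g"
proof (induction g rule: less_induct)
  case (less g)
  \<comment> \<open>The outer induction is on the size of the coefficient at \<open>j\<close>;
    inside it runs an induction on the number \<open>d\<close> of other nonzero
    coefficients.\<close>
  have main: "box n S s b \<inter> half n (t, l, c) \<in> unimod n (insert j V)"
    if "card {i. i \<noteq> j \<and> l i \<noteq> 0} = d" "V \<subseteq> {..<n}" "j < n" "j \<notin> V" "S \<subseteq> V" "\<forall>i\<in>S. b i \<in> B"
      "\<forall>i. i \<notin> insert j V \<longrightarrow> l i = 0" "l j \<noteq> 0" "nat \<bar>l j\<bar> = g" "c \<in> B" for d V j S s b t l c
    using that
  proof (induction d arbitrary: V j S s b t l c rule: less_induct)
    case (less d V j S s b t l c)
    note IH = less.IH[OF _ HOL.refl] and outer = \<open>\<And>y. y < g \<Longrightarrow> box_half n y\<close> and V = less.prems(2-4)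
      and S = less.prems(5,6) and l = less.prems(7-9) and c = less.prems(10)
    have Sn: "j \<notin> S" "S \<subseteq> {..<n}" using V S by auto
    have fin: "finite {i. i \<noteq> j \<and> l i \<noteq> 0}"
      by (rule finite_subset[of _ V]) (use l V finite_subset[of V "{..<n}"] in auto)
    show ?case
    proof (cases "\<forall>i. i \<noteq> j \<longrightarrow> l i = 0")
      case True
      have pos: "box n S s b \<inter> half n (t, l', c) \<in> unimod n (insert j V)"
        if l'0: "\<forall>i. i \<noteq> j \<longrightarrow> l' i = 0" "0 < l' j" for l'
      proof -
        \<comment> \<open>Normalising the coefficient to 1 divides the bound by \<open>l' j\<close>;
          this is how bounds outside \<open>A\<close> arise.\<close>
        obtain c' where c': "c' \<in> B" "zscale (l' j) c' = c" using B_divide[OF c l'0(2)] .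
        have "box n S s b \<inter> half n (t, l', c) = box n (insert j S) (s(j := t)) (b(j := c'))"
          using Sn l'0 c' V beyond_zscale[OF l'0(2), of t c']
          by (auto simp: box_def half_def lform_single[of j n l'])
        also have "\<dots> \<in> unimod n (insert j V)" by (rule unimod.box) (use S c' in auto)
        finally show ?thesis .
      qed
      show ?thesis
      proof (cases "0 < l j")
        case True
        then show ?thesis using pos \<open>\<forall>i. i \<noteq> j \<longrightarrow> l i = 0\<close> by blast
      next
        case False
        have "box n S s b \<inter> half n (t, l(j := - l j), c) \<in> unimod n (insert j V)"
          by (rule pos) (use False True l in auto)
        from unimod.flip[OF this, of j]
        have "{x \<in> carrier_vec n. flip n j x \<in> box n S s b \<inter> half n (t, l(j := - l j), c)} \<in> unimod n (insert j V)"
          by simp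
        also have "{x \<in> carrier_vec n. flip n j x \<in> box n S s b \<inter> half n (t, l(j := - l j), c)}
            = box n S s b \<inter> half n (t, l, c)"
          using half_flip[of j n _ t l c] box_flip[OF Sn, of _ s b] V by (auto simp: half_def)
        finally show ?thesis .
      qed
    next
      case False
      then obtain i where i: "i \<noteq> j" "l i \<noteq> 0" by blast
      then have iV: "i \<in> V" "i < n" using l V by auto
      \<comment> \<open>The residue of \<open>l i\<close> modulo \<open>l j\<close> is chosen
        between \<open>1 - \<bar>l j\<bar>\<close> and 0. The sign matters: \<open>- r\<close> will
        be the positive weight with which the lower bound on \<open>x $ i\<close> is added.\<close>
      define r where "r = - ((- l i) mod \<bar>l j\<bar>)"
      have "\<bar>l j\<bar> dvd - l i - (- l i) mod \<bar>l j\<bar>" by (rule dvd_minus_mod)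
      moreover have "- l i - (- l i) mod \<bar>l j\<bar> = r - l i" by (simp add: r_def)
      ultimately have "\<bar>l j\<bar> dvd r - l i" by simp
      then have "l j dvd l i - r" by (simp add: dvd_diff_commute)
      then obtain k where "l i - r = l j * k" by (rule dvdE)
      then have k: "l i - k * l j = r" by (simp add: algebra_simps)
      have r: "r \<le> 0" "- r < \<bar>l j\<bar>" using l(2) by (simp_all add: r_def)
      define l' where "l' = l(i := r)"
      have l': "l' j = l j" "\<forall>i. i \<notin> insert j V \<longrightarrow> l' i = 0" using i l iV by (auto simp: l'_def)
      have red: "box n S s b \<inter> half n (t, l', c) \<in> unimod n (insert j V)"
      proof (cases "r = 0")
        case True
        have "{i. i \<noteq> j \<and> l' i \<noteq> 0} \<subset> {i. i \<noteq> j \<and> l i \<noteq> 0}" using True i by (auto simp: l'_def)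
        then have "card {i. i \<noteq> j \<and> l' i \<noteq> 0} < d" using fin less.prems(1) by (metis psubset_card_mono)
        then show ?thesis by (rule IH) (use l' l V S c in auto)
      next
        case False
        have g': "nat \<bar>r\<bar> < g" using r l by auto
        have ins: "insert i (insert j V - {i}) = insert j V" using iV by auto
        show ?thesis
        proof (cases "i \<in> S")
          case False
          \<comment> \<open>The box leaves \<open>x $ i\<close> free, so \<open>i\<close> and
            \<open>j\<close> exchange roles: \<open>i\<close> is now the new coordinate, and its
            coefficient has size below \<open>g\<close>.\<close>
          have "box n S s b \<inter> half n (t, l', c) \<in> unimod n (insert i (insert j V - {i}))"
            by (rule box_halfD[OF outer[OF g']])
              (use iV V S False \<open>r \<noteq> 0\<close> c l' in \<open>auto simp: l'_def\<close>)
          then show ?thesis unfolding ins .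
        next
          case True
          define e where "e = (\<lambda>a. if a = i then 1 else 0 :: int)"
          \<comment> \<open>\<open>e\<close> is the form \<open>x $ i\<close>; adding
            \<open>- r\<close> times it removes this variable from \<open>l'\<close>.\<close>
          define m where "m = (\<lambda>a. 1 * l' a + (- r) * e a)"
          define c' where "c' = zscale 1 c + zscale (- r) (b i)"
          have c': "c' \<in> B" unfolding c'_def using c S True by (blast intro: B_closed)
          have m: "m i = 0" "m j = l j" "\<And>a. a \<noteq> i \<Longrightarrow> m a = l a"
            using i by (auto simp: m_def l'_def e_def)
          have "{i. i \<noteq> j \<and> m i \<noteq> 0} \<subset> {i. i \<noteq> j \<and> l i \<noteq> 0}"
          proof -
            have "{i. i \<noteq> j \<and> m i \<noteq> 0} \<subseteq> {i. i \<noteq> j \<and> l i \<noteq> 0}" using m i by force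
            moreover have "i \<notin> {i. i \<noteq> j \<and> m i \<noteq> 0}" using m by auto
            ultimately show ?thesis using i by blast
          qed
          then have lt: "card {i. i \<noteq> j \<and> m i \<noteq> 0} < d" using fin less.prems(1) by (metis psubset_card_mono)
          have m0: "\<forall>a. a \<notin> insert j V \<longrightarrow> m a = 0" using m l iV by metis
          have e: "half n (s i, e, b i) = {x \<in> carrier_vec n. beyond (s i) (b i) (x $ i)}"
          proof -
            have "lform n e x = x $ i" for x :: "'g vec"
              using lform_single[of i n e x] iV by (simp add: e_def)
            then show ?thesis by (auto simp: half_def)
          qed
          have S': "box n S s b = box n (S - {i}) s b \<inter> half n (s i, e, b i)"
            unfolding e using True by (auto simp: box_def)
          have 1: "box n (S - {i}) s b \<inter> half n (t, m, c') \<in> unimod n (insert j V)"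
            by (rule IH[OF lt]) (use V S c' m0 m l in auto)
          have 2: "box n S s b \<inter> half n (t, m, c') \<in> unimod n (insert j V)"
            by (rule IH[OF lt]) (use V S c' m0 m l in auto)
          \<comment> \<open>Neither the smaller box nor \<open>m\<close> involves
            \<open>x $ i\<close>. Their intersection is therefore unimodular without this
            coordinate, and the half-space of \<open>l'\<close> can be added with \<open>i\<close>
            as the new coordinate, by the outer hypothesis.\<close>
          have "\<forall>a. a \<notin> insert j (V - {i}) \<longrightarrow> m a = 0" using m0 m(1) by auto
          then have "box n (S - {i}) s b \<inter> half n (t, m, c') \<in> unimod n (insert j (V - {i}))"
            by (intro IH[OF lt]) (use V S c' m l in auto)
          moreover have "insert j (V - {i}) = insert j V - {i}" using i by auto
          ultimately have 4: "box n (S - {i}) s b \<inter> half n (t, m, c') \<in> unimod n (insert j V - {i})" by simp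
          have "box n (S - {i}) s b \<inter> half n (t, m, c') \<inter> half n (t, l', c)
              \<in> unimod n (insert i (insert j V - {i}))"
          proof (rule unimod_inter_half[OF outer[OF g'] _ _ _ 4])
            show "\<forall>a. a \<notin> insert i (insert j V - {i}) \<longrightarrow> l' a = 0" unfolding ins by (rule l'(2))
          qed (use iV V c \<open>r \<noteq> 0\<close> in \<open>auto simp: l'_def\<close>)
          then have 3: "box n (S - {i}) s b \<inter> half n (t, m, c') \<inter> half n (t, l', c) \<in> unimod n (insert j V)"
            unfolding ins .
          have 5: "box n (S - {i}) s b \<inter> half n (t, m, c') \<inter> half n (s i, e, b i) \<in> unimod n (insert j V)"
            using 2 unfolding S' by (simp only: Int_ac)
          have "box n (S - {i}) s b \<inter> half n (t, l', c) \<inter> half n (s i, e, b i) \<in> unimod n (insert j V)"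
            by (rule unimod_combine[of 1 "- r", OF _ _ m_def c'_def 1 3 5]) (use r \<open>r \<noteq> 0\<close> in auto)
          then show ?thesis unfolding S' by (simp only: Int_ac)
        qed
      qed
      from unimod.shear[OF this, of i j k] iV i
      have "{x \<in> carrier_vec n. shear n i j k x \<in> box n S s b \<inter> half n (t, l', c)} \<in> unimod n (insert j V)"
        by simp
      also have "{x \<in> carrier_vec n. shear n i j k x \<in> box n S s b \<inter> half n (t, l', c)}
          = box n S s b \<inter> half n (t, l, c)"
        using half_shear[of i n j _ k t l c] box_shear[OF Sn, of _ i k s b] V iV i unfolding l'_def k[symmetric]
        by (auto simp: half_def)
      finally show ?thesis .
    qed
  qed
  show ?case unfolding box_half_def using main by blast
qed

section \<open>Fourier-Motzkin elimination for polyhedra\<close>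

definition polyhedron :: "nat \<Rightarrow> (bool \<times> (nat \<Rightarrow> int) \<times> 'g) list \<Rightarrow> 'g vec set" where
  "polyhedron n hs = carrier_vec n \<inter> (\<Inter>h\<in>set hs. half n h)"

definition supported :: "nat set \<Rightarrow> bool \<times> (nat \<Rightarrow> int) \<times> 'g \<Rightarrow> bool" where
  "supported V h \<longleftrightarrow> snd (snd h) \<in> B \<and> (\<forall>i. i \<notin> V \<longrightarrow> fst (snd h) i = 0)"

lemma polyhedron_Cons: "polyhedron n (h # hs) = polyhedron n hs \<inter> half n h"
  by (auto simp: polyhedron_def)

lemma compl_half: "carrier_vec n - half n (s, l, b) = half n (\<not> s, \<lambda>i. - l i, - b)"
  by (auto simp: half_def lform_uminus not_beyond[symmetric])

text \<open>One variable \<open>x $ j\<close> is removed at a time, by an inner induction on the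
  number of constraints that contain it. Two of them with opposite signs are traded for pairs with a
  combination free of \<open>x $ j\<close>; a single one is left to Euclid's algorithm.\<close>

lemma polyhedron_unimod:
  assumes "finite V" "V \<subseteq> {..<n}" "\<forall>h\<in>set hs. supported V h"
  shows "polyhedron n hs \<in> unimod n V"
  using assms
proof (induction V arbitrary: hs rule: finite_induct)
  case empty
  have box: "carrier_vec n \<in> unimod n {}" using unimod.box[of "{}" "{}" _ n] by (simp add: box_def)
  have "polyhedron n hs = carrier_vec n \<or> polyhedron n hs = {}"
  proof (cases "\<forall>h\<in>set hs. beyond (fst h) (snd (snd h)) 0")
    case True
    then have "polyhedron n hs = carrier_vec n"
      using empty by (auto simp: polyhedron_def half_def lform_def supported_def)
    then show ?thesis ..
  next
    case False
    then have "polyhedron n hs = {}"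
      using empty by (auto simp: polyhedron_def half_def lform_def supported_def)
    then show ?thesis ..
  qed
  then show ?case using box unimod.diff[OF box box] by auto
next
  case (insert j V)
  have V: "V \<subseteq> {..<n}" "j < n" using insert by auto
  have "polyhedron n hs \<in> unimod n (insert j V)" if "length (filter (\<lambda>h. fst (snd h) j \<noteq> 0) hs) = d"
    "\<forall>h\<in>set hs. supported (insert j V) h" for d hs
    using that
  proof (induction d arbitrary: hs rule: less_induct)
    case (less d hs)
    define fs where "fs = filter (\<lambda>h. fst (snd h) j \<noteq> 0) hs"
    define gs where "gs = filter (\<lambda>h. fst (snd h) j = 0) hs"
    have hs: "set hs = set fs \<union> set gs" by (auto simp: fs_def gs_def)
    have "supported V h" if "h \<in> set gs" for h
    proof -
      have "supported (insert j V) h" "fst (snd h) j = 0" using that less.prems(2) by (auto simp: gs_def)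
      then show ?thesis unfolding supported_def by (metis insertE)
    qed
    then have gs: "\<forall>h\<in>set gs. supported V h" "\<forall>h\<in>set gs. supported (insert j V) h" "\<forall>h\<in>set fs. supported (insert j V) h"
      using less.prems(2) by (auto simp: gs_def fs_def supported_def)
    have ls: "length fs = d" using less.prems(1) by (simp add: fs_def)
    consider "fs = []" | h where "fs = [h]" | h1 h2 ts where "fs = h1 # h2 # ts"
      by (metis neq_Nil_conv)
    then show ?case
    proof cases
      case 1
      then have "polyhedron n hs = polyhedron n gs" using hs by (simp add: polyhedron_def)
      also have "\<dots> \<in> unimod n V" using insert.IH V gs by blast
      finally show ?thesis by (rule unimod_mono) auto
    next
      case (2 h)
      obtain t l c where h: "h = (t, l, c)" by (metis prod_cases3)
      have hfs: "h \<in> set fs" using 2 by simp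
      have "polyhedron n hs = polyhedron n gs \<inter> half n (t, l, c)" using hs 2 h by (auto simp: polyhedron_def)
      also have "\<dots> \<in> unimod n (insert j V)"
      proof (rule unimod_inter_half[OF box_half V])
        show "polyhedron n gs \<in> unimod n V" using insert.IH V gs by blast
      qed (use insert hfs gs h in \<open>auto simp: supported_def fs_def\<close>)
      finally show ?thesis .
    next
      case (3 h1 h2 ts)
      define R where "R = polyhedron n (ts @ gs)"
      have cnt: "length (filter (\<lambda>h. fst (snd h) j \<noteq> 0) (ts @ gs)) = length ts"
      proof -
        have "filter (\<lambda>h. fst (snd h) j \<noteq> 0) ts = ts"
          using 3 fs_def by (metis (no_types, lifting) filter_id_conv list.set_intros(2) mem_Collect_eq set_filter)
        then show ?thesis by (simp add: gs_def)
      qed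
      have supp: "\<forall>h\<in>set (ts @ gs). supported (insert j V) h" using gs 3 by auto
      \<comment> \<open>In \<open>one\<close> and \<open>two\<close> at most one constraint besides
        those of \<open>ts\<close> contains \<open>x $ j\<close>, so the count is below
        \<open>d\<close>.\<close>
      have one: "R \<inter> half n h \<in> unimod n (insert j V)" if "supported (insert j V) h" for h
      proof -
        have "polyhedron n (h # ts @ gs) \<in> unimod n (insert j V)"
          by (rule less.IH[OF _ HOL.refl]) (use that supp cnt ls 3 in \<open>auto simp del: filter_append\<close>)
        then show ?thesis by (simp add: polyhedron_Cons R_def)
      qed
      have two: "R \<inter> half n h \<inter> half n h' \<in> unimod n (insert j V)"
        if "supported (insert j V) h" "supported (insert j V) h'" "fst (snd h) j = 0" for h h'
      proof -
        have "polyhedron n (h' # h # ts @ gs) \<in> unimod n (insert j V)"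
          by (rule less.IH[OF _ HOL.refl]) (use that supp cnt ls 3 in \<open>auto simp del: filter_append\<close>)
        then show ?thesis by (simp add: polyhedron_Cons R_def)
      qed
      have opp: "R \<inter> half n (s, l, b) \<inter> half n (s', l', b') \<in> unimod n (insert j V)"
        if "supported (insert j V) (s, l, b)" "supported (insert j V) (s', l', b')" "l j * l' j < 0" for s l b s' l' b'
      proof -
        define m where "m = (\<lambda>i. \<bar>l' j\<bar> * l i + \<bar>l j\<bar> * l' i)"
        define c where "c = zscale \<bar>l' j\<bar> b + zscale \<bar>l j\<bar> b'"
        have nz: "0 < \<bar>l' j\<bar>" "0 < \<bar>l j\<bar>" using that(3) by auto
        have mj: "m j = 0" using that(3) by (auto simp: m_def mult_less_0_iff)
        have sm: "supported (insert j V) (s, m, c)"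
          using that B_closed(1) by (auto simp: supported_def m_def c_def)
        show ?thesis
          by (rule unimod_combine[OF nz m_def c_def]) (use one two sm that mj in auto)
      qed
      obtain s l b s' l' b' where h12: "h1 = (s, l, b)" "h2 = (s', l', b')" by (metis prod_cases3)
      have s12: "supported (insert j V) (s, l, b)" "supported (insert j V) (s', l', b')" using gs 3 h12 by auto
      have "h1 \<in> set fs" "h2 \<in> set fs" using 3 by auto
      then have nz: "l j \<noteq> 0" "l' j \<noteq> 0" unfolding fs_def by (auto simp: h12)
      have "polyhedron n hs = R \<inter> half n (s, l, b) \<inter> half n (s', l', b')"
        using hs 3 h12 by (auto simp: polyhedron_def R_def)
      also have "\<dots> \<in> unimod n (insert j V)"
      proof (cases "l j * l' j < 0")
        case True
        then show ?thesis using opp s12 by blast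
      next
        case False
        \<comment> \<open>With equal signs, the second half-space is replaced by its complement,
          whose form has the opposite sign, and the result is subtracted.\<close>
        have "R \<inter> half n (s, l, b) \<inter> half n (\<not> s', \<lambda>i. - l' i, - b') \<in> unimod n (insert j V)"
          by (rule opp[OF s12(1)]) (use s12 False nz B_closed in \<open>auto simp: supported_def mult_less_0_iff zero_less_mult_iff\<close>)
        then have "R \<inter> half n (s, l, b) - R \<inter> half n (s, l, b) \<inter> half n (\<not> s', \<lambda>i. - l' i, - b') \<in> unimod n (insert j V)"
          by (rule unimod.diff[OF one[OF s12(1)]]) blast
        also have "R \<inter> half n (s, l, b) - R \<inter> half n (s, l, b) \<inter> half n (\<not> s', \<lambda>i. - l' i, - b')
            = R \<inter> half n (s, l, b) \<inter> half n (s', l', b')"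
          unfolding compl_half[symmetric] by (auto simp: R_def polyhedron_def half_def)
        finally show ?thesis .
      qed
      finally show ?thesis .
    qed
  qed
  then show ?case using insert.prems by blast
qed

text \<open>Intersections are easy in this class, because constraint lists can be concatenated,
  while for \<open>unimod\<close> they are not evident. Boolean combinations are therefore formed
  here, before any elimination.\<close>

inductive_set polycomb :: "nat \<Rightarrow> 'g vec set set" for n where
  poly: "\<forall>h\<in>set hs. supported {..<n} h \<Longrightarrow> polyhedron n hs \<in> polycomb n"
| diff: "X \<in> polycomb n \<Longrightarrow> Y \<in> polycomb n \<Longrightarrow> Y \<subseteq> X \<Longrightarrow> X - Y \<in> polycomb n"

lemma polycomb_unimod: "X \<in> polycomb n \<Longrightarrow> X \<in> unimod n {..<n}"
  by (induction rule: polycomb.induct) (auto intro: polyhedron_unimod unimod.diff)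

lemma polycomb_subset: "X \<in> polycomb n \<Longrightarrow> X \<subseteq> carrier_vec n"
  by (induction rule: polycomb.induct) (auto simp: polyhedron_def)

lemma polycomb_inter:
  assumes "X \<in> polycomb n" "Y \<in> polycomb n" shows "X \<inter> Y \<in> polycomb n"
proof -
  have *: "X \<inter> polyhedron n hs \<in> polycomb n" if "\<forall>h\<in>set hs. supported {..<n} h" for hs
    using assms(1)
  proof induction
    case (poly gs)
    have "polyhedron n gs \<inter> polyhedron n hs = polyhedron n (gs @ hs)" by (auto simp: polyhedron_def)
    then show ?case using poly that polycomb.poly[of "gs @ hs" n] by auto
  next
    case (diff X Y)
    have "(X - Y) \<inter> polyhedron n hs = X \<inter> polyhedron n hs - Y \<inter> polyhedron n hs" by blast
    then show ?case using diff by (auto intro: polycomb.diff)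
  qed
  show ?thesis using assms(2)
  proof induction
    case (diff Y Z)
    have "X \<inter> (Y - Z) = X \<inter> Y - X \<inter> Z" by blast
    then show ?case using diff by (auto intro: polycomb.diff)
  qed (use * in auto)
qed

lemma polycomb_carrier: "carrier_vec n \<in> polycomb n"
  using polycomb.poly[of "[]" n] by (simp add: polyhedron_def)

text \<open>An equation is a closed half-space minus the open one inside it, and unions are
  complements of intersections; this keeps all differences nested.\<close>

lemma definable_polycomb: "X \<in> definable A n \<Longrightarrow> X \<in> polycomb n"
proof (induction rule: definable.induct)
  have half: "half n (s, \<lambda>i. if i < n then k $ i else 0, a) \<in> polycomb n" if "a \<in> A" for s k a
    using polycomb.poly[of "[(s, \<lambda>i. if i < n then k $ i else 0, a)]" n] that A_subset_B
    by (auto simp: polyhedron_def supported_def half_def Int_absorb1)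
  have lin: "lform n (\<lambda>i. if i < n then k $ i else 0) x = int_lin k x" if "k \<in> carrier_vec n" for k and x :: "'g vec"
    using that by (simp add: lform_def int_lin_def)
  {
    case (lin_eq k a)
    have "{x \<in> carrier_vec n. int_lin k x = a} = half n (False, \<lambda>i. if i < n then k $ i else 0, a)
        - half n (True, \<lambda>i. if i < n then k $ i else 0, a)"
      using lin[OF lin_eq(1)] by (auto simp: half_def beyond_def)
    also have "\<dots> \<in> polycomb n"
      by (intro polycomb.diff half lin_eq) (auto simp: half_def beyond_def)
    finally show ?case .
  next
    case (lin_less k a)
    have "{x \<in> carrier_vec n. int_lin k x < a} = carrier_vec n - half n (False, \<lambda>i. if i < n then k $ i else 0, a)"
      using lin[OF lin_less(1)] by (auto simp: half_def beyond_def)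
    also have "\<dots> \<in> polycomb n"
      by (intro polycomb.diff half lin_less polycomb_carrier) (auto simp: half_def beyond_def)
    finally show ?case .
  }
next
  case (compl X)
  then show ?case using polycomb.diff[OF polycomb_carrier] polycomb_subset by blast
next
  case (union X Y)
  have sub: "X \<subseteq> carrier_vec n" "Y \<subseteq> carrier_vec n" using union polycomb_subset by blast+
  have "X \<union> Y = carrier_vec n - ((carrier_vec n - X) \<inter> (carrier_vec n - Y))"
    using sub by blast
  also have "\<dots> \<in> polycomb n"
    by (intro polycomb.diff polycomb_carrier polycomb_inter union) (use sub in auto)
  finally show ?case .
qed

end

section \<open>Classes of unimodular sets\<close>

lemma int_mat_vec_shear:
  assumes "i < n" "j < n" "i \<noteq> j" "x \<in> carrier_vec n"
  shows "int_mat_vec (addrow_mat n k j i) x = shear n i j k x"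
proof (rule eq_vecI)
  fix a assume "a < dim_vec (shear n i j k x)"
  then have a: "a < n" by (simp add: shear_def coord_upd_def)
  have "int_mat_vec (addrow_mat n k j i) x $ a = (\<Sum>b<n. zscale (addrow_mat n k j i $$ (a, b)) (x $ b))"
    using a assms(4) by (simp add: int_mat_vec_def int_lin_def)
  also have "\<dots> = (\<Sum>b<n. (if b = a then x $ b else 0) + (if b = i then (if a = j then zscale k (x $ b) else 0) else 0))"
    by (rule sum.cong) (use a assms in \<open>auto simp: zscale.scale_left_distrib\<close>)
  finally show "int_mat_vec (addrow_mat n k j i) x $ a = shear n i j k x $ a"
    using a assms by (simp add: sum.distrib shear_def)
qed (simp add: int_mat_vec_def shear_def coord_upd_def)

lemma int_mat_vec_flip:
  assumes "j < n" "x \<in> carrier_vec n"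
  shows "int_mat_vec (multrow_mat n j (-1)) x = flip n j x"
proof (rule eq_vecI)
  fix a assume "a < dim_vec (flip n j x)"
  then have a: "a < n" by (simp add: flip_def coord_upd_def)
  have "int_mat_vec (multrow_mat n j (-1)) x $ a = (\<Sum>b<n. zscale (multrow_mat n j (-1) $$ (a, b)) (x $ b))"
    using a assms(2) by (simp add: int_mat_vec_def int_lin_def)
  also have "\<dots> = (\<Sum>b<n. (if b = a then (if a = j then - (x $ b) else x $ b) else 0))"
    by (rule sum.cong) (use a assms in auto)
  finally show "int_mat_vec (multrow_mat n j (-1)) x $ a = flip n j x $ a"
    using a assms by (simp add: flip_def)
qed (simp add: int_mat_vec_def flip_def coord_upd_def)

lemma addrow_mat_GL_Z: "i < n \<Longrightarrow> j < n \<Longrightarrow> i \<noteq> j \<Longrightarrow> addrow_mat n k j i \<in> GL_Z n"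
  using addrow_mat_inv[of j n i k] addrow_mat_inv[of j n i "- k"]
  by (intro GL_Z_I[of _ _ "addrow_mat n (- k) j i"]) auto

lemma multrow_mat_GL_Z: "j < n \<Longrightarrow> multrow_mat n j (-1) \<in> GL_Z n"
proof -
  assume j: "j < n"
  have "multrow_mat n j (-1) * multrow_mat n j (-1) = (1\<^sub>m n :: int mat)"
    by (subst multrow_mat[symmetric, of _ n n]) (use j in \<open>auto intro!: eq_matI\<close>)
  then show ?thesis by (intro GL_Z_I) auto
qed

section \<open>Classes of subsets of the line\<close>

definition line :: "'g set \<Rightarrow> 'g vec set" where
  "line T = {x \<in> carrier_vec 1. x $ 0 \<in> T}"

lemma line_diff: "line (S - T) = line S - line T" and line_union: "line (S \<union> T) = line S \<union> line T"
  and line_inter: "line (S \<inter> T) = line S \<inter> line T" and line_empty: "line {} = {}"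
  by (auto simp: line_def)

lemma line_mono: "S \<subseteq> T \<Longrightarrow> line S \<subseteq> line T"
  by (auto simp: line_def)

context params
begin

definition tame :: "'g set \<Rightarrow> bool" where
  "tame T \<longleftrightarrow> line T \<in> definable A 1"

lemma tame_diff: "tame S \<Longrightarrow> tame T \<Longrightarrow> tame (S - T)" and tame_union: "tame S \<Longrightarrow> tame T \<Longrightarrow> tame (S \<union> T)"
  by (simp_all only: tame_def line_diff line_union definable_diff definable.union)

lemma isomorphic_line_uminus:
  assumes "tame T"
  shows "isomorphic A 1 (line (uminus ` T)) (line T)"
proof -
  have "{x \<in> carrier_vec 1. int_mat_vec (multrow_mat 1 0 (-1)) x + 0\<^sub>v 1 \<in> line T} = line (uminus ` T)"
    by (auto simp: int_mat_vec_flip line_def flip_def image_iff) (metis minus_minus)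
  then show ?thesis
    using isomorphic_affine[OF assms[unfolded tame_def] multrow_mat_GL_Z[of 0 1], of "0\<^sub>v 1"] by (simp add: zero_in_A)
qed

text \<open>Translations are available for elements of \<open>A\<close> only, which is why end
  points in \<rat> \<otimes> A need generators of their own.\<close>

lemma isomorphic_line_translate:
  assumes "tame T" "a \<in> A"
  shows "isomorphic A 1 (line {x. x + a \<in> T}) (line T)"
proof -
  have "{x \<in> carrier_vec 1. int_mat_vec (1\<^sub>m 1) x + vec 1 (\<lambda>_. a) \<in> line T} = line {x. x + a \<in> T}"
    by (auto simp: int_mat_vec_one line_def)
  then show ?thesis
    using isomorphic_affine[OF assms(1)[unfolded tame_def] one_GL_Z, of "vec 1 (\<lambda>_. a)"] assms(2) by simp
qed

end

context doag_params
begin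

text \<open>A bound in \<rat> \<otimes> A need not be a parameter itself, but multiplying the
  condition by a suitable positive integer moves the bound into \<open>A\<close> without changing
  the solutions.\<close>

lemma
  assumes "b \<in> B"
  shows definable_line_less: "tame {..<b}"
    and definable_line_single: "tame {b}"
proof -
  obtain m where m: "0 < m" "zscale (int m) b \<in> A" using assms by (auto simp: div_hull_def)
  have *: "int_lin (vec 1 (\<lambda>_. int m)) x = zscale (int m) (x $ 0)" for x :: "'g vec"
    by (simp add: int_lin_def)
  have "{x \<in> carrier_vec 1. int_lin (vec 1 (\<lambda>_. int m)) x < zscale (int m) b} \<in> definable A 1"
    by (rule definable.lin_less) (use m in auto)
  then show "tame {..<b}"
    unfolding * tame_def line_def using m by (simp only: zscale_less_iff of_nat_0_less_iff lessThan_iff)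
  have "{x \<in> carrier_vec 1. int_lin (vec 1 (\<lambda>_. int m)) x = zscale (int m) b} \<in> definable A 1"
    by (rule definable.lin_eq) (use m in auto)
  then show "tame {b}"
    unfolding * tame_def line_def using m by (simp only: zscale_eq_iff of_nat_0_less_iff singleton_iff)
qed

lemma definable_line_UNIV: "tame UNIV"
  using definable_carrier[of 1] by (simp only: tame_def line_def UNIV_I simp_thms Collect_mem_eq)

lemma
  assumes "b \<in> B"
  shows definable_line_atLeast: "tame {b..}"
    and definable_line_greaterThan: "tame {b<..}"
proof -
  have "{b..} = UNIV - {..<b}" "{b<..} = UNIV - {..<b} - {b}" by auto
  then show "tame {b..}" "tame {b<..}"
    using definable_line_less[OF assms] definable_line_single[OF assms] definable_line_UNIV
    by (simp_all add: tame_diff)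
qed

lemma zero_in_B: "0 \<in> B"
  using A_subset_B zero_in_A by blast

lemma definable_line_ivl: "b \<in> B \<Longrightarrow> c \<in> B \<Longrightarrow> tame {b..<c}"
proof -
  assume "b \<in> B" "c \<in> B"
  moreover have "{b..<c} = {b..} - {c..}" by auto
  ultimately show ?thesis using definable_line_atLeast by (simp add: tame_diff)
qed

lemmas definable_line = definable_line_less definable_line_single definable_line_UNIV
  definable_line_atLeast definable_line_greaterThan definable_line_ivl

definition lcls :: "'g set \<Rightarrow> ((rat \<times> 'g kdf) \<Rightarrow>\<^sub>0 int) set" where
  "lcls T = cls 1 (line T)"

lemma lcls_closed [simp]: "tame T \<Longrightarrow> lcls T \<in> carrier (KdfQ A)"
  unfolding lcls_def tame_def by (rule cls_closed)

lemma lcls_union: "tame S \<Longrightarrow> tame T \<Longrightarrow> S \<inter> T = {} \<Longrightarrow>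
    lcls (S \<union> T) = lcls S \<oplus>\<^bsub>KdfQ A\<^esub> lcls T"
  using cls_union[of "line S" 1 "line T"] unfolding lcls_def tame_def line_union
  by (simp only: line_inter[symmetric] line_empty)

lemma lcls_diff: "tame S \<Longrightarrow> tame T \<Longrightarrow> T \<subseteq> S \<Longrightarrow>
    lcls (S - T) = lcls S \<ominus>\<^bsub>KdfQ A\<^esub> lcls T"
  using cls_diff[of "line S" 1 "line T"] unfolding lcls_def tame_def line_diff by (simp only: line_mono)

lemma lcls_uminus: "tame T \<Longrightarrow> lcls (uminus ` T) = lcls T"
  unfolding lcls_def by (rule cls_iso[OF isomorphic_line_uminus])

lemma e_class_lcls: "e_class A a = lcls {a}"
  by (simp only: e_class_def df_class1_cls line_def lcls_def)

lemma iota_cases: "iota A a = (if 0 < a then lcls {0..<a} else if a = 0 then \<zero>\<^bsub>KdfQ A\<^esub>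
    else \<ominus>\<^bsub>KdfQ A\<^esub> lcls {0..<- a})"
  by (simp only: iota_def df_class1_cls line_def lcls_def)

lemma iota_lcls: "0 < a \<Longrightarrow> iota A a = lcls {0..<a}"
  by (simp add: iota_cases)

lemma iota_inf_lcls: "iota_inf A = lcls {0..}"
  by (simp only: iota_inf_def df_class1_cls line_def lcls_def)

lemma lcls_zero: "lcls {0} = \<one>\<^bsub>KdfQ A\<^esub>"
  using cls_origin1 by (simp only: line_def lcls_def singleton_iff)

lemma lcls_greater0: "lcls {0<..} = iota_inf A \<ominus>\<^bsub>KdfQ A\<^esub> \<one>\<^bsub>KdfQ A\<^esub>"
proof -
  have "{0<..} = {0..} - {0 :: 'g}" by auto
  then show ?thesis using lcls_diff[of "{0..}" "{0}"] zero_in_B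
    by (simp add: definable_line lcls_zero iota_inf_lcls)
qed

lemma lcls_less0: "lcls {..<0} = iota_inf A \<ominus>\<^bsub>KdfQ A\<^esub> \<one>\<^bsub>KdfQ A\<^esub>"
proof -
  have "uminus ` {0<..} = {..<0 :: 'g}" by auto
  then show ?thesis using lcls_uminus[of "{0<..}"] zero_in_B lcls_greater0 by (simp add: definable_line)
qed

lemma generators_closed:
  "(e_class A ` B \<union> iota A ` B \<union> {iota_inf A}) \<subseteq> carrier (KdfQ A)"
proof -
  have "iota A a \<in> carrier (KdfQ A)" if "a \<in> B" for a
  proof -
    have "- a \<in> B" using that by (rule B_closed)
    then have "lcls {0..<a} \<in> carrier (KdfQ A)" "lcls {0..<- a} \<in> carrier (KdfQ A)"
      using that zero_in_B by (simp_all add: definable_line)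
    then show ?thesis by (simp add: iota_cases)
  qed
  then show ?thesis using zero_in_B by (auto simp del: One_nat_def simp: e_class_lcls iota_inf_lcls definable_line)
qed

lemma Collect_beyond: "{y. beyond s b y} = (if s then {b<..} else {b..})"
  by (auto simp: beyond_def)

text \<open>A ray starting at \<open>b\<close> differs from the one starting at 0 by a half-open
  interval. For positive \<open>b\<close> its class is \<iota>(b); for negative \<open>b\<close> it
  has to be reflected first.\<close>

lemma
  assumes sub: "subring U (KdfQ A)" and e: "\<And>b. b \<in> B \<Longrightarrow> e_class A b \<in> U"
    and i: "\<And>b. b \<in> B \<Longrightarrow> iota A b \<in> U" and inf: "iota_inf A \<in> U"
  shows lcls_beyond_mem: "b \<in> B \<Longrightarrow> lcls {y. beyond s b y} \<in> U"
    and lcls_UNIV_mem: "lcls UNIV \<in> U"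
proof -
  note sub = subringE[OF sub]
  have minus: "x \<ominus>\<^bsub>KdfQ A\<^esub> y \<in> U" if "x \<in> U" "y \<in> U" for x y
    using that sub(5,7) by (simp add: a_minus_def)
  have less0: "lcls {..<0} \<in> U" unfolding lcls_less0 by (intro minus inf sub(3))
  have "lcls ({..<0} \<union> {0..}) = lcls {..<0} \<oplus>\<^bsub>KdfQ A\<^esub> lcls {0..}"
    by (rule lcls_union) (use zero_in_B in \<open>auto simp: definable_line\<close>)
  moreover have "{..<0} \<union> {0..} = (UNIV :: 'g set)" by auto
  ultimately show "lcls UNIV \<in> U" using less0 inf sub(7) by (simp add: iota_inf_lcls)
  have ge: "lcls {b..} \<in> U" if b: "b \<in> B" for b
  proof (cases b "0 :: 'g" rule: linorder_cases)
    case equal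
    then show ?thesis using inf by (simp add: iota_inf_lcls)
  next
    case greater
    have "lcls ({0..} - {0..<b}) = lcls {0..} \<ominus>\<^bsub>KdfQ A\<^esub> lcls {0..<b}"
      by (rule lcls_diff) (use b zero_in_B in \<open>auto simp: definable_line\<close>)
    moreover have "{0..} - {0..<b} = {b..}" using greater by auto
    ultimately show ?thesis using inf i[OF b] greater minus by (simp add: iota_inf_lcls iota_lcls)
  next
    case less
    have nb: "- b \<in> B" using b by (rule B_closed)
    \<comment> \<open>Reflection of \<open>{b..<0}\<close> gives an interval that is open at 0 and
      closed at \<open>- b\<close>. Compared with \<open>{0..<- b}\<close> one end point is lost and
      one gained: e(0) = 1 is subtracted and e(-b) is added.\<close>
    have "lcls ({0..<- b} - {0} \<union> {- b}) = lcls ({0..<- b} - {0}) \<oplus>\<^bsub>KdfQ A\<^esub> lcls {- b}"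
      by (rule lcls_union) (use nb zero_in_B in \<open>auto simp: definable_line tame_diff\<close>)
    moreover have "lcls ({0..<- b} - {0}) = lcls {0..<- b} \<ominus>\<^bsub>KdfQ A\<^esub> lcls {0}"
      by (rule lcls_diff) (use nb zero_in_B less in \<open>auto simp: definable_line\<close>)
    moreover have "lcls (uminus ` ({0..<- b} - {0} \<union> {- b})) = lcls ({0..<- b} - {0} \<union> {- b})"
      by (rule lcls_uminus)
        (intro tame_union tame_diff definable_line nb zero_in_B)
    moreover have "uminus ` ({0..<- b} - {0} \<union> {- b}) = {b..<0}"
    proof -
      have "{0..<- b} - {0} \<union> {- b} = {0<..- b}" using less by auto
      then show ?thesis by simp
    qed
    moreover have "lcls ({b..<0} \<union> {0..}) = lcls {b..<0} \<oplus>\<^bsub>KdfQ A\<^esub> lcls {0..}"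
      by (rule lcls_union) (use b zero_in_B in \<open>auto simp: definable_line\<close>)
    moreover have "{b..<0} \<union> {0..} = {b..}" using less by auto
    moreover have "lcls {0..<- b} \<in> U" using i[OF nb] less by (simp add: iota_lcls)
    moreover have "lcls {- b} \<in> U" using e[OF nb] by (simp add: e_class_lcls)
    ultimately show ?thesis using inf minus sub(3,7) by (simp add: iota_inf_lcls lcls_zero)
  qed
  assume b: "b \<in> B"
  have "lcls ({b..} - {b}) = lcls {b..} \<ominus>\<^bsub>KdfQ A\<^esub> lcls {b}"
    by (rule lcls_diff) (use b in \<open>auto simp: definable_line\<close>)
  moreover have "{b..} - {b} = {b<..}" by auto
  ultimately show "lcls {y. beyond s b y} \<in> U"
    using ge[OF b] e[OF b] minus by (simp add: Collect_beyond e_class_lcls)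
qed

section \<open>Generation of the ring\<close>

lemma box_Suc:
  fixes b :: "nat \<Rightarrow> 'g"
  assumes "S \<subseteq> {..<Suc n}"
  shows "box (Suc n) S s b = vprod (box n (S \<inter> {..<n}) s b) (line (if n \<in> S then {y. beyond (s n) (b n) y} else UNIV))"
proof -
  have f: "vec_first z n $ i = z $ i" if "i < n" for z :: "'g vec" and i
    using that by (simp add: vec_first_def)
  have l: "vec_last z (Suc 0) $ 0 = z $ n" if "z \<in> carrier_vec (Suc n)" for z :: "'g vec"
    using that by (simp add: vec_last_def)
  have sub: "box n (S \<inter> {..<n}) s b \<subseteq> carrier_vec n" "line T \<subseteq> carrier_vec 1" for T :: "'g set"
    by (auto simp: box_def line_def)
  have S: "(\<forall>i\<in>S. P i) \<longleftrightarrow> (\<forall>i\<in>S \<inter> {..<n}. P i) \<and> (n \<in> S \<longrightarrow> P n)" for P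
  proof -
    have "i < n \<or> i = n" if "i \<in> S" for i using assms that by auto
    then show ?thesis by auto
  qed
  show ?thesis
    unfolding vprod_eq[OF sub]
    by (auto simp: box_def line_def f l S[of "\<lambda>i. beyond (s i) (b i) (_ $ i)"])
qed

text \<open>Definability is carried along because additivity of classes presupposes it. Shears and
  reflections preserve the class, nested differences subtract, and boxes are products of lines and
  rays.\<close>

lemma unimod_definable_mem:
  assumes sub: "subring U (KdfQ A)" and e: "\<And>b. b \<in> B \<Longrightarrow> e_class A b \<in> U"
    and i: "\<And>b. b \<in> B \<Longrightarrow> iota A b \<in> U" and inf: "iota_inf A \<in> U"
    and X: "X \<in> unimod n V" and V: "V \<subseteq> {..<n}"
  shows "X \<in> definable A n \<and> cls n X \<in> U"
  using X
proof induction
  note sub' = subringE[OF sub]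
  have boxes: "box m S s b \<in> definable A m \<and> cls m (box m S s b) \<in> U"
    if "S \<subseteq> {..<m}" "\<forall>i\<in>S. b i \<in> B" for m S s b
    using that
  proof (induction m arbitrary: S)
    case 0
    then have "box 0 S s b = carrier_vec 0" by (auto simp: box_def)
    then show ?case using cls_dim0 sub'(3) by simp
  next
    case (Suc m)
    define T where "T = (if m \<in> S then {y. beyond (s m) (b m) y} else UNIV)"
    have T: "tame T \<and> lcls T \<in> U"
      using Suc.prems(2) lcls_beyond_mem[OF sub e i inf] lcls_UNIV_mem[OF sub e i inf]
      by (auto simp: T_def definable_line Collect_beyond)
    moreover have "box m (S \<inter> {..<m}) s b \<in> definable A m \<and> cls m (box m (S \<inter> {..<m}) s b) \<in> U"
      by (rule Suc.IH) (use Suc.prems in auto)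
    ultimately show ?case
      using definable_vprod[of "box m (S \<inter> {..<m}) s b" m "line T" 1]
        cls_vprod[of "box m (S \<inter> {..<m}) s b" m "line T" 1] sub'(6) T
      unfolding box_Suc[OF Suc.prems(1)] T_def[symmetric] tame_def lcls_def by simp
  qed
  {
    case (box S b s)
    then show ?case using boxes V by blast
  next
    case (diff X Y)
    then show ?case using cls_diff[of X n Y] sub'(5,7) by (simp add: definable_diff a_minus_def)
  next
    case (shear X i j k)
    then have ij: "i < n" "j < n" using V by auto
    have "{x \<in> carrier_vec n. int_mat_vec (addrow_mat n k j i) x + 0\<^sub>v n \<in> X} = {x \<in> carrier_vec n. shear n i j k x \<in> X}"
      using ij shear by (auto simp: int_mat_vec_shear shear_def)
    then have iso: "isomorphic A n {x \<in> carrier_vec n. shear n i j k x \<in> X} X"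
      using isomorphic_affine[of X n "addrow_mat n k j i" "0\<^sub>v n"] ij shear addrow_mat_GL_Z[OF ij] zero_in_A
      by simp
    then show ?case using shear.IH cls_iso[OF iso] isomorphic_definable[OF iso] by simp
  next
    case (flip X j)
    then have j: "j < n" using V by auto
    have "{x \<in> carrier_vec n. int_mat_vec (multrow_mat n j (-1)) x + 0\<^sub>v n \<in> X} = {x \<in> carrier_vec n. flip n j x \<in> X}"
      using j by (auto simp: int_mat_vec_flip flip_def)
    then have iso: "isomorphic A n {x \<in> carrier_vec n. flip n j x \<in> X} X"
      using isomorphic_affine[of X n "multrow_mat n j (-1)" "0\<^sub>v n"] j flip multrow_mat_GL_Z[OF j] zero_in_A
      by simp
    then show ?case using flip.IH cls_iso[OF iso] isomorphic_definable[OF iso] by simp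
  }
qed

lemma KdfQ_generated:
  "rat_subalgebra (Kdf A) (e_class A ` B \<union> iota A ` B \<union> {iota_inf A}) = carrier (KdfQ A)"
proof (rule rat_subalgebra_eqI_cls[OF generators_closed])
  fix n and X :: "'g vec set" assume X: "X \<in> definable A n"
  let ?S = "e_class A ` B \<union> iota A ` B \<union> {iota_inf A}"
  let ?U = "rat_subalgebra (Kdf A) ?S"
  have "range (\<lambda>q. pure_tensor (Kdf A) q \<one>\<^bsub>Kdf A\<^esub>) \<union> ?S \<subseteq> carrier (KdfQ A)"
    using generators_closed unfolding KdfQ_def by auto
  then have sub: "subring ?U (KdfQ A)"
    unfolding rat_subalgebra_def KdfQ_def[symmetric] by (rule Q.generate_ring_is_subring)
  have incl: "s \<in> ?U" if "s \<in> ?S" for s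
    unfolding rat_subalgebra_def by (rule generate_ring.incl) (use that in blast)
  have "X \<in> definable A n \<and> cls n X \<in> ?U"
    by (rule unimod_definable_mem[OF sub incl incl incl polycomb_unimod[OF definable_polycomb[OF X]]]) auto
  then show "cls n X \<in> ?U" ..
qed

section \<open>Relations between the generators\<close>

lemma iota_eq_zero:
  assumes "a \<in> A" shows "iota A a = \<zero>\<^bsub>KdfQ A\<^esub>"
proof -
  have pos: "lcls {0..<a} = \<zero>\<^bsub>KdfQ A\<^esub>" if a: "a \<in> A" "0 < a" for a
  proof -
    have B: "a \<in> B" using a A_subset_B by blast
    have c: "lcls {0..} \<in> carrier (KdfQ A)" "lcls {0..<a} \<in> carrier (KdfQ A)" "lcls {a..} \<in> carrier (KdfQ A)"
      using B zero_in_B by (auto simp: definable_line)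
    have "lcls ({0..<a} \<union> {a..}) = lcls {0..<a} \<oplus>\<^bsub>KdfQ A\<^esub> lcls {a..}"
      by (rule lcls_union) (use B zero_in_B in \<open>auto simp: definable_line\<close>)
    moreover have "{0..<a} \<union> {a..} = {0..}" using a by auto
    \<comment> \<open>A translate of the ray is a proper part of it; cancelling the common class
      leaves 0 for the interval in between.\<close>
    moreover have "lcls {x. x + a \<in> {a..}} = lcls {a..}"
      unfolding lcls_def by (rule cls_iso, rule isomorphic_line_translate) (use a B in \<open>auto simp: definable_line\<close>)
    moreover have "{x. x + a \<in> {a..}} = {0..}" by auto
    ultimately show ?thesis using c Q.add.r_cancel_one'[of "lcls {0..}" "lcls {0..<a}"] by (auto simp: Q.a_comm)
  qed
  show ?thesis
  proof (cases a "0 :: 'g" rule: linorder_cases)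
    case less
    then show ?thesis using pos[of "- a"] assms A
      by (auto simp: iota_cases add_subgroup_def)
  next
    case greater
    then show ?thesis using pos[of a] assms by (simp add: iota_lcls)
  qed (simp add: iota_def)
qed

text \<open>Split the quadrant \<open>[0, \<infinity>)\<^sup>2\<close> along the diagonal; each half is unimodularly a quadrant again,
  one of them with an open side.\<close>

lemma iota_inf_idem: "iota_inf A \<otimes>\<^bsub>KdfQ A\<^esub> iota_inf A = iota_inf A"
proof -
  let ?R = "KdfQ A" and ?Q = "vprod (line {0 :: 'g..}) (line {0..})" and ?O = "vprod (line {0 :: 'g..}) (line {0<..})"
  have t: "line {0..} \<in> definable A 1" "line {0<..} \<in> definable A 1"
    using definable_line zero_in_B by (auto simp only: tame_def)
  have d: "?Q \<in> definable A 2" "?O \<in> definable A 2"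
    using definable_vprod[OF t(1,1)] definable_vprod[OF t] unfolding one_add_one .
  have sub: "line T \<subseteq> carrier_vec 1" for T :: "'g set" by (auto simp: line_def)
  have mem: "z \<in> vprod (line S) (line T) \<longleftrightarrow> z \<in> carrier_vec 2 \<and> z $ 0 \<in> S \<and> z $ 1 \<in> T" for z :: "'g vec" and S T
    unfolding vprod_eq[OF sub sub] one_add_one by (auto simp: line_def vec_first_def vec_last_def)
  \<comment> \<open>\<open>f1\<close> maps (x, y) to (x - y, y) and \<open>f2\<close> maps it to (x,
    y - x). The preimages are the part of the quadrant on and below the diagonal and the part
    strictly above it.\<close>
  define f1 where "f1 = addrow_mat 2 (-1 :: int) 0 1"
  define f2 where "f2 = addrow_mat 2 (-1 :: int) 1 0"
  have f1: "int_mat_vec f1 x = shear 2 1 0 (-1) x" if "x \<in> carrier_vec 2" for x :: "'g vec"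
    using int_mat_vec_shear[of 1 2 0 x "-1"] that by (simp add: f1_def shear_def)
  have f2: "int_mat_vec f2 x = shear 2 0 1 (-1) x" if "x \<in> carrier_vec 2" for x :: "'g vec"
    using int_mat_vec_shear[of 0 2 1 x "-1"] that by (simp add: f2_def shear_def)
  let ?Q1 = "{x \<in> carrier_vec 2. int_mat_vec f1 x + 0\<^sub>v 2 \<in> ?Q}" and ?Q2 = "{x \<in> carrier_vec 2. int_mat_vec f2 x + 0\<^sub>v 2 \<in> ?O}"
  have i: "isomorphic A 2 ?Q1 ?Q" "isomorphic A 2 ?Q2 ?O"
    by (rule isomorphic_affine, use d zero_in_A in \<open>auto simp: f1_def f2_def addrow_mat_GL_Z\<close>)+
  have Q1: "?Q1 = {x \<in> carrier_vec 2. 0 \<le> x $ 1 \<and> x $ 1 \<le> x $ 0}"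
    by (auto simp: f1 mem) (auto simp: shear_def)
  have Q2: "?Q2 = {x \<in> carrier_vec 2. 0 \<le> x $ 0 \<and> x $ 0 < x $ 1}"
    by (auto simp: f2 mem) (auto simp: shear_def)
  have "?Q = ?Q1 \<union> ?Q2" unfolding Q1 Q2 by (auto simp: mem)
  moreover have "cls 2 (?Q1 \<union> ?Q2) = cls 2 ?Q1 \<oplus>\<^bsub>?R\<^esub> cls 2 ?Q2"
    by (rule cls_union) (use isomorphic_definable[OF i(1)] isomorphic_definable[OF i(2)] in \<open>auto simp: Q1 Q2\<close>)
  ultimately have *: "cls 2 ?Q = cls 2 ?Q \<oplus>\<^bsub>?R\<^esub> cls 2 ?O" using cls_iso[OF i(1)] cls_iso[OF i(2)] by simp
  \<comment> \<open>The splitting reads q = q + o, so o vanishes; as a product, o is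
    \<iota>(\<infinity>) times \<iota>(\<infinity>) - 1.\<close>
  have "cls 2 ?O = \<zero>\<^bsub>?R\<^esub>" using * d Q.add.r_cancel_one'[of "cls 2 ?Q" "cls 2 ?O"] by (auto simp: Q.a_comm)
  moreover have "cls 2 ?O = iota_inf A \<otimes>\<^bsub>?R\<^esub> (iota_inf A \<ominus>\<^bsub>?R\<^esub> \<one>\<^bsub>?R\<^esub>)"
    using cls_vprod[OF t] lcls_greater0 unfolding iota_inf_lcls lcls_def one_add_one by (simp only:)
  ultimately have "iota_inf A \<otimes>\<^bsub>?R\<^esub> (iota_inf A \<ominus>\<^bsub>?R\<^esub> \<one>\<^bsub>?R\<^esub>) = \<zero>\<^bsub>?R\<^esub>" by simp
  moreover have c: "iota_inf A \<in> carrier ?R" using generators_closed by auto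
  ultimately have "iota_inf A \<otimes>\<^bsub>?R\<^esub> iota_inf A \<ominus>\<^bsub>?R\<^esub> iota_inf A = \<zero>\<^bsub>?R\<^esub>"
    by (simp add: a_minus_def Q.r_distr Q.r_minus)
  then show ?thesis using c Q.r_right_minus_eq by simp
qed

end

section \<open>Euler characteristics\<close>

lemma doag_divide: "0 < k \<Longrightarrow> \<exists>c. zscale k c = (b :: 'g::doag)"
  using divisible[of "nat k" b] by (auto simp: zscale_def)

lemma doag_pos: "\<exists>d :: 'g::doag. 0 < d"
  using nontrivial[where 'a = 'g] by (metis neg_0_less_iff_less neqE)

lemma doag_dense: "a < b \<Longrightarrow> \<exists>c. a < c \<and> c < (b :: 'g::doag)"
proof -
  assume ab: "a < b"
  obtain c where "zscale 2 c = a + b" using doag_divide[of 2 "a + b"] by auto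
  moreover have "zscale 2 x = x + x" for x :: 'g
    using zscale.scale_left_distrib[of 1 1 x] by simp
  ultimately have c: "c + c = a + b" by simp
  have "a < c"
  proof (rule ccontr)
    assume "\<not> a < c"
    then have "c + c \<le> a + a" by (simp add: add_mono)
    also have "\<dots> < a + b" using ab by simp
    finally show False using c by simp
  qed
  moreover have "c < b"
  proof (rule ccontr)
    assume "\<not> c < b"
    then have "b + b \<le> c + c" by (simp add: add_mono)
    moreover have "a + b < b + b" using ab by simp
    ultimately show False using c by simp
  qed
  ultimately show ?thesis by blast
qed

text \<open>This is exactness of Fourier-Motzkin elimination in one variable. Density supplies a
  point between strict bounds; if one side has no bounds, a point past the others exists because the
  group is nontrivial.\<close>

lemma doag_between:
  fixes S T :: "'g::doag set"
  assumes "finite S" "finite T" "\<forall>p\<in>S. \<forall>q\<in>T. beyond s p q"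
  shows "\<exists>y. (\<forall>p\<in>S. beyond s p y) \<and> (\<forall>q\<in>T. beyond s y q)"
proof -
  obtain d :: 'g where d: "0 < d" using doag_pos by blast
  consider "S = {}" "T = {}" | "S = {}" "T \<noteq> {}" | "S \<noteq> {}" "T = {}" | "S \<noteq> {}" "T \<noteq> {}" by blast
  then show ?thesis
  proof cases
    case 2
    have "Min T - d < q" if "q \<in> T" for q
    proof -
      have "Min T \<le> q" using that assms by simp
      then show ?thesis using d by (simp add: diff_less_eq add_strict_increasing add.commute[of q])
    qed
    then have "\<forall>q\<in>T. beyond s (Min T - d) q" by (simp add: beyond_def less_imp_le)
    then show ?thesis using 2 by blast
  next
    case 3
    have "p < Max S + d" if "p \<in> S" for p
    proof -
      have "p \<le> Max S" using that assms by simp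
      then show ?thesis using d by (simp add: add_strict_increasing add.commute[of "Max S"])
    qed
    then have "\<forall>p\<in>S. beyond s p (Max S + d)" by (simp add: beyond_def less_imp_le)
    then show ?thesis using 3 by blast
  next
    case 4
    then have m: "Max S \<in> S" "Min T \<in> T" using assms by simp_all
    then have b: "beyond s (Max S) (Min T)" using assms by blast
    obtain y where y: "beyond s (Max S) y" "beyond s y (Min T)"
      using b doag_dense[of "Max S" "Min T"] by (cases s) (auto simp: beyond_def)
    have "beyond s p y" if "p \<in> S" for p
    proof -
      have "p \<le> Max S" using that assms by simp
      then show ?thesis using y(1) by (auto simp: beyond_def split: if_splits)
    qed
    moreover have "beyond s y q" if "q \<in> T" for q
    proof -
      have "Min T \<le> q" using that assms by simp
      then show ?thesis using y(2) by (auto simp: beyond_def split: if_splits)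
    qed
    ultimately show ?thesis by blast
  qed auto
qed

text \<open>An empty \<open>S\<close> or \<open>T\<close> means that the interval is unbounded on
  that side, so rays and the whole line are included.\<close>

definition ivl :: "bool \<Rightarrow> 'g::linorder set \<Rightarrow> 'g set \<Rightarrow> 'g set" where
  "ivl s S T = {y. (\<forall>p\<in>S. beyond s p y) \<and> (\<forall>q\<in>T. beyond s y q)}"

lemma small_step:
  fixes E :: "'g::doag set"
  assumes "finite E"
  obtains d where "0 < d" "\<And>x y. x \<in> E \<Longrightarrow> y \<in> E \<Longrightarrow> x < y \<Longrightarrow> x + d < y"
proof -
  let ?D = "(\<lambda>(x, y). y - x) ` {(x, y) \<in> E \<times> E. x < y}"
  have fin: "finite ?D" by (rule finite_imageI, rule finite_subset[of _ "E \<times> E"]) (use assms in auto)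
  then obtain d where d: "0 < d" "\<forall>q\<in>?D. d < q"
    using doag_between[of "{0}" ?D True] by (auto simp: beyond_def)
  show ?thesis
  proof (rule that[OF d(1)])
    fix x y assume "x \<in> E" "y \<in> E" "x < y"
    then have "d < y - x" using d(2) by force
    then show "x + d < y" by (simp add: less_diff_eq add.commute)
  qed
qed

text \<open>A closed interval is left just after its upper end point, and an open one is entered just after its
  lower end point.\<close>

lemma ivl_evaluation:
  fixes E :: "'g::doag set"
  assumes E: "finite E"
  obtains f :: "'g \<Rightarrow> int" and G where "finite G"
    "\<And>S T. S \<subseteq> E \<Longrightarrow> T \<subseteq> E \<Longrightarrow> of_bool (ivl s S T \<noteq> {}) = (\<Sum>y\<in>G. f y * of_bool (y \<in> ivl s S T))"
proof -
  obtain d where d: "0 < d" and gap: "\<And>x y. x \<in> E \<Longrightarrow> y \<in> E \<Longrightarrow> x < y \<Longrightarrow> x + d < y"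
    using small_step[OF E] by blast
  have xd: "x < x + d" for x using d by simp
  obtain hi where hi: "\<forall>e\<in>E. e < hi" using doag_between[of E "{}" True] E by (auto simp: beyond_def)
  obtain lo where lo: "\<forall>e\<in>E. lo < e" using doag_between[of "{}" E True] E by (auto simp: beyond_def)
  \<comment> \<open>\<open>w\<close> accounts for intervals that lack the end where the others are
    detected: those unbounded above in the closed case, those unbounded below in the open
    case.\<close>
  define w where "w = (if s then lo else hi)"
  \<comment> \<open>Leaving a closed interval is a drop from 1 to 0, entering an open one is a rise;
    the sign makes both count as 1.\<close>
  define \<sigma> where "\<sigma> = (if s then -1 else 1 :: int)"
  have key: "of_bool (ivl s S T \<noteq> {}) = of_bool (w \<in> ivl s S T)
      + (\<Sum>t\<in>E. \<sigma> * (of_bool (t \<in> ivl s S T) - of_bool (t + d \<in> ivl s S T)))"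
    if ST: "S \<subseteq> E" "T \<subseteq> E" for S T
  proof -
    have fin: "finite S" "finite T" using ST E finite_subset by blast+
    show ?thesis
    proof (cases s)
      case False
      have mem: "y \<in> ivl s S T \<longleftrightarrow> (\<forall>p\<in>S. p \<le> y) \<and> (\<forall>q\<in>T. y \<le> q)" for y
        using False by (simp add: ivl_def beyond_def)
      \<comment> \<open>By the choice of \<open>d\<close>, closed lower bounds do not separate
        \<open>t\<close> from \<open>t + d\<close>; only an upper bound can.\<close>
      have low: "(\<forall>p\<in>S. p \<le> t + d) \<longleftrightarrow> (\<forall>p\<in>S. p \<le> t)" if "t \<in> E" for t
      proof (rule ball_cong[OF HOL.refl])
        fix p assume "p \<in> S"
        then have p: "p \<in> E" using ST by blast
        show "p \<le> t + d \<longleftrightarrow> p \<le> t"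
        proof (cases "p \<le> t")
          case True
          then show ?thesis using xd[of t] by (simp add: order_trans[OF _ less_imp_le])
        next
          case False
          then have "t + d < p" using gap[OF that p] by simp
          then show ?thesis using False leD by blast
        qed
      qed
      show ?thesis
      proof (cases "T = {}")
        case True
        have "hi \<in> ivl s S T" using True False hi ST by (auto simp: ivl_def beyond_def intro: less_imp_le)
        moreover have "(t \<in> ivl s S T) = (t + d \<in> ivl s S T)" if "t \<in> E" for t
          using low[OF that] True unfolding mem by simp
        then have "(\<Sum>t\<in>E. \<sigma> * (of_bool (t \<in> ivl s S T) - of_bool (t + d \<in> ivl s S T))) = 0"
          by (intro sum.neutral) auto
        ultimately show ?thesis using False by (auto simp: w_def)
      next
        case nonempty: False
        define q where "q = Min T"
        have q: "q \<in> T" unfolding q_def by (rule Min_in[OF fin(2) nonempty])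
        then have qE: "q \<in> E" using ST by blast
        have qle: "(\<forall>r\<in>T. y \<le> r) \<longleftrightarrow> y \<le> q" for y
          unfolding q_def using Min_ge_iff[OF fin(2) nonempty] by simp
        have out: "hi \<notin> ivl s S T" using hi qE by (auto simp: mem qle)
        have iff: "ivl s S T \<noteq> {} \<longleftrightarrow> q \<in> ivl s S T"
        proof
          assume "ivl s S T \<noteq> {}"
          then obtain y where "\<forall>p\<in>S. p \<le> y" "y \<le> q" unfolding ex_in_conv[symmetric] mem qle by blast
          then show "q \<in> ivl s S T" unfolding mem qle using order_trans by blast
        qed blast
        have d1: "of_bool (t \<in> ivl s S T) - of_bool (t + d \<in> ivl s S T)
            = (if t = q then of_bool (q \<in> ivl s S T) else 0 :: int)" if t: "t \<in> E" for t
        proof -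
          have a: "t \<in> ivl s S T \<longleftrightarrow> (\<forall>p\<in>S. p \<le> t) \<and> t \<le> q" unfolding mem qle ..
          have b: "t + d \<in> ivl s S T \<longleftrightarrow> (\<forall>p\<in>S. p \<le> t) \<and> t + d \<le> q" unfolding mem qle low[OF t] ..
          consider "t < q" "t \<le> q" "t + d \<le> q" | "t = q" "\<not> t + d \<le> q" | "\<not> t \<le> q" "\<not> t + d \<le> q"
          proof (cases t q rule: linorder_cases)
            case less
            then show ?thesis using gap[OF t qE less] that(1) by (simp add: less_imp_le)
          next
            case equal
            then show ?thesis using xd[of t] that(2) by simp
          next
            case greater
            moreover have "q < t + d" using greater xd[of t] by (rule less_trans)
            ultimately show ?thesis using that(3) by (simp add: not_le)
          qed
          then show ?thesis
          proof cases
            case 2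
            then show ?thesis unfolding b using a by simp
          qed (auto simp: a b)
        qed
        have "(\<Sum>t\<in>E. \<sigma> * (of_bool (t \<in> ivl s S T) - of_bool (t + d \<in> ivl s S T)))
            = (\<Sum>t\<in>E. if t = q then of_bool (q \<in> ivl s S T) else 0)"
        proof (rule sum.cong[OF HOL.refl])
          fix t assume "t \<in> E"
          then show "\<sigma> * (of_bool (t \<in> ivl s S T) - of_bool (t + d \<in> ivl s S T))
              = (if t = q then of_bool (q \<in> ivl s S T) else 0)"
            unfolding d1[OF \<open>t \<in> E\<close>] using False by (simp add: \<sigma>_def)
        qed
        also have "\<dots> = of_bool (q \<in> ivl s S T)" by (simp only: sum.delta[OF E] qE if_True)
        finally show ?thesis using iff out False by (simp only: w_def if_False of_bool_eq add_0)
      qed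
    next
      case True
      have mem: "y \<in> ivl s S T \<longleftrightarrow> (\<forall>p\<in>S. p < y) \<and> (\<forall>q\<in>T. y < q)" for y
        using True by (simp add: ivl_def beyond_def)
      \<comment> \<open>Dually, strict upper bounds do not separate \<open>t\<close> from
        \<open>t + d\<close>, so a change of membership comes from a lower bound.\<close>
      have up: "(\<forall>q\<in>T. t + d < q) \<longleftrightarrow> (\<forall>q\<in>T. t < q)" if "t \<in> E" for t
      proof (rule ball_cong[OF HOL.refl])
        fix q assume "q \<in> T"
        then have q: "q \<in> E" using ST by blast
        show "t + d < q \<longleftrightarrow> t < q" using gap[OF that q] less_trans[OF xd[of t]] by blast
      qed
      show ?thesis
      proof (cases "S = {}")
        case empty: True
        have "lo \<in> ivl s S T" using True empty lo ST by (auto simp: ivl_def beyond_def)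
        moreover have "(t \<in> ivl s S T) = (t + d \<in> ivl s S T)" if "t \<in> E" for t
          using up[OF that] empty unfolding mem by simp
        then have "(\<Sum>t\<in>E. \<sigma> * (of_bool (t \<in> ivl s S T) - of_bool (t + d \<in> ivl s S T))) = 0"
          by (intro sum.neutral) auto
        ultimately show ?thesis using True by (auto simp: w_def)
      next
        case False
        define p where "p = Max S"
        have p: "p \<in> S" unfolding p_def by (rule Max_in[OF fin(1) False])
        then have pE: "p \<in> E" using ST by blast
        have ple: "(\<forall>r\<in>S. r < y) \<longleftrightarrow> p < y" for y
          unfolding p_def using Max_less_iff[OF fin(1) False] by simp
        have out: "lo \<notin> ivl s S T" using lo pE by (auto simp: mem ple)
        have iff: "ivl s S T \<noteq> {} \<longleftrightarrow> p + d \<in> ivl s S T"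
        proof
          assume "ivl s S T \<noteq> {}"
          then obtain y where "p < y" "\<forall>q\<in>T. y < q" unfolding ex_in_conv[symmetric] mem ple by blast
          then have "\<forall>q\<in>T. p < q" using less_trans by blast
          then show "p + d \<in> ivl s S T" unfolding mem ple up[OF pE] using xd[of p] by blast
        qed blast
        have d1: "of_bool (t \<in> ivl s S T) - of_bool (t + d \<in> ivl s S T)
            = (if t = p then - of_bool (p + d \<in> ivl s S T) else 0 :: int)" if t: "t \<in> E" for t
        proof -
          have a: "t \<in> ivl s S T \<longleftrightarrow> p < t \<and> (\<forall>q\<in>T. t < q)" unfolding mem ple ..
          have b: "t + d \<in> ivl s S T \<longleftrightarrow> p < t + d \<and> (\<forall>q\<in>T. t < q)" unfolding mem ple up[OF t] ..
          show ?thesis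
          proof (cases t p rule: linorder_cases)
            case less
            then have "\<not> p < t" "\<not> p < t + d" using gap[OF t pE less] by (simp_all add: not_less less_imp_le)
            then show ?thesis unfolding a b using less by auto
          next
            case equal
            then show ?thesis unfolding a by simp
          next
            case greater
            moreover have "p < t + d" using greater xd[of t] by (rule less_trans)
            ultimately show ?thesis unfolding a b by auto
          qed
        qed
        have "(\<Sum>t\<in>E. \<sigma> * (of_bool (t \<in> ivl s S T) - of_bool (t + d \<in> ivl s S T)))
            = (\<Sum>t\<in>E. if t = p then of_bool (p + d \<in> ivl s S T) else 0)"
        proof (rule sum.cong[OF HOL.refl])
          fix t assume "t \<in> E"
          have "\<sigma> = -1" using True by (simp only: \<sigma>_def if_True)
          then show "\<sigma> * (of_bool (t \<in> ivl s S T) - of_bool (t + d \<in> ivl s S T))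
              = (if t = p then of_bool (p + d \<in> ivl s S T) else 0)"
            using d1[OF \<open>t \<in> E\<close>] by (simp only: mult_minus1 minus_minus minus_zero if_distrib[of uminus])
        qed
        also have "\<dots> = of_bool (p + d \<in> ivl s S T)" by (simp only: sum.delta[OF E] pE if_True)
        finally show ?thesis using iff out True by (simp only: w_def if_True of_bool_eq add_0)
      qed
    qed
  qed
  define G where "G = insert w (E \<union> (\<lambda>t. t + d) ` E)"
  have G: "finite G" using E by (simp add: G_def)
  have inG: "w \<in> G" "t \<in> E \<Longrightarrow> t \<in> G" "t \<in> E \<Longrightarrow> t + d \<in> G" for t by (auto simp: G_def)
  \<comment> \<open>The point evaluations of \<open>key\<close> are collected into one weight
    function. It does not depend on \<open>S\<close> and \<open>T\<close>, which makes nonemptiness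
    a linear functional of the indicator function.\<close>
  define f where "f y = of_bool (y = w) + (\<Sum>t\<in>E. \<sigma> * (of_bool (y = t) - of_bool (y = t + d)))" for y
  show ?thesis
  proof (rule that[OF G])
    fix S T assume ST: "S \<subseteq> E" "T \<subseteq> E"
    let ?I = "ivl s S T"
    have one: "(\<Sum>y\<in>G. of_bool (y = z) * of_bool (y \<in> ?I)) = (of_bool (z \<in> ?I) :: int)" if "z \<in> G" for z
    proof -
      have "(\<Sum>y\<in>G. of_bool (y = z) * of_bool (y \<in> ?I)) = (\<Sum>y\<in>G. if y = z then of_bool (z \<in> ?I) else 0 :: int)"
        by (rule sum.cong) auto
      then show ?thesis using G that by simp
    qed
    have "(\<Sum>y\<in>G. f y * of_bool (y \<in> ?I)) = (\<Sum>y\<in>G. of_bool (y = w) * of_bool (y \<in> ?I))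
        + (\<Sum>y\<in>G. \<Sum>t\<in>E. \<sigma> * (of_bool (y = t) * of_bool (y \<in> ?I) - of_bool (y = t + d) * of_bool (y \<in> ?I)))"
      by (simp add: f_def distrib_right sum.distrib sum_distrib_right left_diff_distrib mult.assoc)
    also have "(\<Sum>y\<in>G. \<Sum>t\<in>E. \<sigma> * (of_bool (y = t) * of_bool (y \<in> ?I) - of_bool (y = t + d) * of_bool (y \<in> ?I)))
        = (\<Sum>t\<in>E. \<sigma> * ((\<Sum>y\<in>G. of_bool (y = t) * of_bool (y \<in> ?I)) - (\<Sum>y\<in>G. of_bool (y = t + d) * of_bool (y \<in> ?I))))"
      by (subst sum.swap) (simp only: sum_subtractf sum_distrib_left[symmetric])
    also have "\<dots> = (\<Sum>t\<in>E. \<sigma> * (of_bool (t \<in> ?I) - of_bool (t + d \<in> ?I)))"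
      by (rule sum.cong[OF HOL.refl]) (simp only: one inG)
    finally show "of_bool (?I \<noteq> {}) = (\<Sum>y\<in>G. f y * of_bool (y \<in> ?I))"
      unfolding key[OF ST] by (simp only: one inG)
  qed
qed

text \<open>For finitely many intervals, nonemptiness is one fixed weighted sum of values of the
  indicator function, so it inherits linear relations.\<close>

lemma ivl_relation:
  fixes L :: "(int \<times> 'g::doag set \<times> 'g set) list"
  assumes fin: "\<And>c S T. (c, S, T) \<in> set L \<Longrightarrow> finite S \<and> finite T"
    and rel: "\<And>y. (\<Sum>(c, S, T)\<leftarrow>L. c * of_bool (y \<in> ivl s S T)) = 0"
  shows "(\<Sum>(c, S, T)\<leftarrow>L. c * of_bool (ivl s S T \<noteq> {})) = 0"
proof -
  define E where "E = (\<Union>(c, S, T)\<in>set L. S \<union> T)"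
  have "finite E" unfolding E_def
  proof (rule finite_UN_I)
    fix z assume "z \<in> set L"
    moreover obtain c S T where "z = (c, S, T)" by (metis prod_cases3)
    ultimately show "finite (case z of (c, S, T) \<Rightarrow> S \<union> T)" using fin[of c S T] by simp
  qed simp
  then obtain f :: "'g \<Rightarrow> int" and G where G: "finite G"
    "\<And>S T. S \<subseteq> E \<Longrightarrow> T \<subseteq> E \<Longrightarrow> of_bool (ivl s S T \<noteq> {}) = (\<Sum>y\<in>G. f y * of_bool (y \<in> ivl s S T))"
    by (rule ivl_evaluation[where s = s]) (rule that)
  have "(\<Sum>(c, S, T)\<leftarrow>L. c * of_bool (ivl s S T \<noteq> {}))
      = (\<Sum>(c, S, T)\<leftarrow>L. \<Sum>y\<in>G. f y * (c * of_bool (y \<in> ivl s S T)))"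
  proof (rule arg_cong[of _ _ sum_list], rule map_cong[OF HOL.refl])
    fix z assume z: "z \<in> set L"
    obtain c S T where zeq: "z = (c, S, T)" by (metis prod_cases3)
    have ST: "S \<subseteq> E" "T \<subseteq> E" using z unfolding zeq E_def by auto
    show "(case z of (c, S, T) \<Rightarrow> c * of_bool (ivl s S T \<noteq> {}))
        = (case z of (c, S, T) \<Rightarrow> \<Sum>y\<in>G. f y * (c * of_bool (y \<in> ivl s S T)))"
      unfolding zeq prod.case G(2)[OF ST] by (simp only: sum_distrib_left mult.left_commute)
  qed
  also have "\<dots> = (\<Sum>y\<in>G. \<Sum>(c, S, T)\<leftarrow>L. f y * (c * of_bool (y \<in> ivl s S T)))"
    by (induction L) (auto simp: sum.distrib)
  also have "\<dots> = (\<Sum>y\<in>G. f y * (\<Sum>(c, S, T)\<leftarrow>L. c * of_bool (y \<in> ivl s S T)))"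
    by (simp add: sum_list_const_mult case_prod_unfold)
  also have "\<dots> = 0" by (simp add: rel)
  finally show ?thesis .
qed

section \<open>Projections of polyhedra\<close>

text \<open>Unlike in \<open>polyhedron\<close>, all constraints share one strictness. Combinations
  then have the same strictness, and projections stay in the class.\<close>

definition spoly :: "bool \<Rightarrow> nat \<Rightarrow> ((nat \<Rightarrow> int) \<times> 'g) list \<Rightarrow> 'g::linordered_ab_group_add vec set" where
  "spoly s n hs = {x \<in> carrier_vec n. \<forall>(l, b)\<in>set hs. beyond s b (lform n l x)}"

definition snoc_vec :: "nat \<Rightarrow> 'g vec \<Rightarrow> 'g \<Rightarrow> 'g vec" where
  "snoc_vec n x y = vec (Suc n) (\<lambda>i. if i = n then y else x $ i)"

lemma snoc_vec_carrier [simp]: "snoc_vec n x y \<in> carrier_vec (Suc n)"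
  by (simp add: snoc_vec_def)

lemma carrier_vec_SucE:
  assumes "z \<in> carrier_vec (Suc n)"
  obtains x y where "x \<in> carrier_vec n" "z = snoc_vec n x y"
proof (rule that[of "vec_first z n" "z $ n"])
  show "z = snoc_vec n (vec_first z n) (z $ n)"
    by (rule eq_vecI) (use assms in \<open>auto simp: snoc_vec_def vec_first_def less_Suc_eq\<close>)
qed simp

lemma lform_snoc: "lform (Suc n) l (snoc_vec n x y) = lform n l x + zscale (l n) y"
  by (simp add: lform_def snoc_vec_def)

text \<open>The coefficient at \<open>n\<close> cancels. Both weights are positive if
  \<open>h\<close> has a positive and \<open>g\<close> a negative coefficient there.\<close>

definition comb_constr :: "nat \<Rightarrow> (nat \<Rightarrow> int) \<times> 'g \<Rightarrow> (nat \<Rightarrow> int) \<times> 'g \<Rightarrow> (nat \<Rightarrow> int) \<times> 'g::ab_group_add" where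
  "comb_constr n h g = (\<lambda>i. (- fst g n) * fst h i + fst h n * fst g i, zscale (- fst g n) (snd h) + zscale (fst h n) (snd g))"

definition proj_constr :: "nat \<Rightarrow> ((nat \<Rightarrow> int) \<times> 'g) list \<Rightarrow> ((nat \<Rightarrow> int) \<times> 'g::ab_group_add) list" where
  "proj_constr n hs = filter (\<lambda>h. fst h n = 0) hs
     @ [comb_constr n h g. h \<leftarrow> filter (\<lambda>h. 0 < fst h n) hs, g \<leftarrow> filter (\<lambda>h. fst h n < 0) hs]"

text \<open>The bound that a constraint imposes on the last coordinate above \<open>x\<close>; it
  exists by divisibility if the coefficient at \<open>n\<close> is nonzero.\<close>

definition solve :: "nat \<Rightarrow> 'g vec \<Rightarrow> (nat \<Rightarrow> int) \<times> 'g::doag \<Rightarrow> 'g" where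
  "solve n x h = (SOME y. zscale (fst h n) y = snd h - lform n (fst h) x)"

lemma zscale_solve: "fst h n \<noteq> 0 \<Longrightarrow> zscale (fst h n) (solve n x h) = snd h - lform n (fst h) x"
proof -
  assume nz: "fst h n \<noteq> 0"
  have "\<exists>y. zscale (fst h n) y = snd h - lform n (fst h) x"
  proof (cases "0 < fst h n")
    case True
    then show ?thesis by (rule doag_divide)
  next
    case False
    then obtain y where "zscale (- fst h n) y = - (snd h - lform n (fst h) x)"
      using doag_divide[of "- fst h n"] nz by fastforce
    then show ?thesis by (intro exI[of _ y]) (metis neg_equal_iff_equal zscale.scale_minus_left)
  qed
  then show ?thesis unfolding solve_def by (rule someI_ex)
qed

lemma beyond_solve:
  shows beyond_solve_pos: "0 < fst h n \<Longrightarrow>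
      beyond s (snd h) (lform n (fst h) x + zscale (fst h n) y) \<longleftrightarrow> beyond s (solve n x h) y"
    and beyond_solve_neg: "fst h n < 0 \<Longrightarrow>
      beyond s (snd h) (lform n (fst h) x + zscale (fst h n) y) \<longleftrightarrow> beyond s y (solve n x h)"
proof -
  have *: "beyond s (snd h) (lform n (fst h) x + z) \<longleftrightarrow> beyond s (snd h - lform n (fst h) x) z" for z
    by (auto simp: beyond_def algebra_simps)
  show "beyond s (snd h) (lform n (fst h) x + zscale (fst h n) y) \<longleftrightarrow> beyond s (solve n x h) y" if "0 < fst h n"
    using that beyond_zscale[OF that, of s "solve n x h" y] zscale_solve[of h n x] by (simp add: *)
  show "beyond s (snd h) (lform n (fst h) x + zscale (fst h n) y) \<longleftrightarrow> beyond s y (solve n x h)" if neg: "fst h n < 0"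
  proof -
    have "beyond s (zscale (fst h n) (solve n x h)) (zscale (fst h n) y)
        \<longleftrightarrow> beyond s (zscale (- fst h n) y) (zscale (- fst h n) (solve n x h))"
      by (simp add: beyond_def)
    then show ?thesis
      using neg beyond_zscale[of "- fst h n" s y "solve n x h"] zscale_solve[of h n x] by (simp add: *)
  qed
qed

text \<open>A fibre of the projection is empty or an interval, which makes the one-dimensional
  relation applicable.\<close>

lemma fibre_eq:
  fixes hs :: "((nat \<Rightarrow> int) \<times> 'g::doag) list"
  assumes x: "x \<in> carrier_vec n"
  shows "snoc_vec n x y \<in> spoly s (Suc n) hs \<longleftrightarrow>
    x \<in> spoly s n (filter (\<lambda>h. fst h n = 0) hs) \<and>
    y \<in> ivl s (solve n x ` {h \<in> set hs. 0 < fst h n}) (solve n x ` {h \<in> set hs. fst h n < 0})"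
proof -
  have "(\<forall>h\<in>set hs. P h) \<longleftrightarrow> (\<forall>h\<in>set hs. fst h n = 0 \<longrightarrow> P h)
      \<and> (\<forall>h\<in>set hs. 0 < fst h n \<longrightarrow> P h) \<and> (\<forall>h\<in>set hs. fst h n < 0 \<longrightarrow> P h)" for P :: "_ \<Rightarrow> bool"
    by (meson linorder_neqE)
  note split3 = this
  have "snoc_vec n x y \<in> spoly s (Suc n) hs \<longleftrightarrow>
      (\<forall>h\<in>set hs. beyond s (snd h) (lform n (fst h) x + zscale (fst h n) y))"
    by (simp add: spoly_def lform_snoc case_prod_unfold)
  also have "\<dots> \<longleftrightarrow> x \<in> spoly s n (filter (\<lambda>h. fst h n = 0) hs) \<and>
    y \<in> ivl s (solve n x ` {h \<in> set hs. 0 < fst h n}) (solve n x ` {h \<in> set hs. fst h n < 0})"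
    by (subst split3) (use x in \<open>auto simp: spoly_def case_prod_unfold ivl_def beyond_solve_pos beyond_solve_neg\<close>)
  finally show ?thesis .
qed

text \<open>A fibre is nonempty iff every lower bound is compatible with every upper bound; cleared
  of denominators, these comparisons are the combined constraints.\<close>

lemma proj_spoly:
  fixes hs :: "((nat \<Rightarrow> int) \<times> 'g::doag) list"
  assumes x: "x \<in> carrier_vec n"
  shows "x \<in> spoly s n (proj_constr n hs) \<longleftrightarrow> (\<exists>y. snoc_vec n x y \<in> spoly s (Suc n) hs)"
proof -
  let ?S = "solve n x ` {h \<in> set hs. 0 < fst h n}" and ?T = "solve n x ` {h \<in> set hs. fst h n < 0}"
  have comb: "beyond s (snd (comb_constr n h g)) (lform n (fst (comb_constr n h g)) x)
      \<longleftrightarrow> beyond s (solve n x h) (solve n x g)" if "0 < fst h n" "fst g n < 0" for h g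
  proof -
    define p where "p = fst h n"
    define q where "q = - fst g n"
    have pq: "0 < p" "0 < q" using that by (simp_all add: p_def q_def)
    have b: "snd h = lform n (fst h) x + zscale p (solve n x h)" "snd g = lform n (fst g) x + zscale (- q) (solve n x g)"
      using zscale_solve[of h n x] zscale_solve[of g n x] that by (simp_all add: p_def q_def)
    have "beyond s (snd (comb_constr n h g)) (lform n (fst (comb_constr n h g)) x)
      \<longleftrightarrow> beyond s (zscale (p * q) (solve n x h)) (zscale (p * q) (solve n x g))"
      unfolding comb_constr_def fst_conv snd_conv lform_comb p_def[symmetric] q_def[symmetric] b
      by (auto simp: beyond_def zscale.scale_right_distrib zscale.scale_right_diff_distrib algebra_simps)
    then show ?thesis using pq by (simp add: beyond_zscale)
  qed
  have "x \<in> spoly s n (proj_constr n hs) \<longleftrightarrow> x \<in> spoly s n (filter (\<lambda>h. fst h n = 0) hs) \<and>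
      (\<forall>h\<in>set hs. 0 < fst h n \<longrightarrow> (\<forall>g\<in>set hs. fst g n < 0 \<longrightarrow>
        beyond s (snd (comb_constr n h g)) (lform n (fst (comb_constr n h g)) x)))"
  proof -
    have "set (proj_constr n hs) = {h \<in> set hs. fst h n = 0}
        \<union> {comb_constr n h g | h g. h \<in> set hs \<and> 0 < fst h n \<and> g \<in> set hs \<and> fst g n < 0}"
      unfolding proj_constr_def by auto
    then show ?thesis
      unfolding spoly_def case_prod_unfold
      by (simp only: mem_Collect_eq Un_iff set_filter x simp_thms Ball_def) blast
  qed
  also have "\<dots> \<longleftrightarrow> x \<in> spoly s n (filter (\<lambda>h. fst h n = 0) hs) \<and> (\<forall>p\<in>?S. \<forall>q\<in>?T. beyond s p q)"
    using comb by auto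
  also have "(\<forall>p\<in>?S. \<forall>q\<in>?T. beyond s p q) \<longleftrightarrow> (\<exists>y. y \<in> ivl s ?S ?T)"
  proof
    show "\<exists>y. y \<in> ivl s ?S ?T" if "\<forall>p\<in>?S. \<forall>q\<in>?T. beyond s p q"
      using doag_between[OF _ _ that] by (auto simp: ivl_def)
  next
    assume "\<exists>y. y \<in> ivl s ?S ?T"
    then obtain y where y: "\<And>p. p \<in> ?S \<Longrightarrow> beyond s p y" "\<And>q. q \<in> ?T \<Longrightarrow> beyond s y q"
      unfolding ivl_def by blast
    have "beyond s p q" if "beyond s p y" "beyond s y q" for p q
      using that by (auto simp: beyond_def split: if_splits)
    then show "\<forall>p\<in>?S. \<forall>q\<in>?T. beyond s p q" using y by blast
  qed
  finally show ?thesis using fibre_eq[OF x] by auto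
qed

text \<open>By induction on the dimension: the case of intervals, applied to the fibres of the projection along
  the last coordinate, gives a relation between the projections.\<close>

lemma spoly_relation:
  fixes L :: "(int \<times> ((nat \<Rightarrow> int) \<times> 'g::doag) list) list"
  assumes "\<And>x. x \<in> carrier_vec n \<Longrightarrow> (\<Sum>(c, hs)\<leftarrow>L. c * of_bool (x \<in> spoly s n hs)) = 0"
  shows "(\<Sum>(c, hs)\<leftarrow>L. c * of_bool (spoly s n hs \<noteq> {})) = 0"
  using assms
proof (induction n arbitrary: L)
  case 0
  have e: "carrier_vec 0 = {vNil :: 'g vec}" by (auto intro!: eq_vecI)
  have "spoly s 0 hs \<noteq> {} \<longleftrightarrow> vNil \<in> spoly s 0 hs" for hs :: "((nat \<Rightarrow> int) \<times> 'g) list"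
    by (auto simp: spoly_def e)
  then show ?case using 0[of vNil] by simp
next
  case (Suc n)
  define L' where "L' = map (\<lambda>(c, hs). (c, proj_constr n hs)) L"
  have "(\<Sum>(c, hs)\<leftarrow>L'. c * of_bool (spoly s n hs \<noteq> {})) = 0"
  proof (rule Suc.IH)
    fix x :: "'g vec" assume x: "x \<in> carrier_vec n"
    define F where "F hs = (if x \<in> spoly s n (filter (\<lambda>h. fst h n = 0) hs)
      then ivl s (solve n x ` {h \<in> set hs. 0 < fst h n}) (solve n x ` {h \<in> set hs. fst h n < 0}) else {})" for hs
    \<comment> \<open>Polyhedra whose constraints without the last coordinate already fail at
      \<open>x\<close> have an empty fibre and are dropped.\<close>
    define M where "M = map (\<lambda>(c, hs). (c, solve n x ` {h \<in> set hs. 0 < fst h n}, solve n x ` {h \<in> set hs. fst h n < 0}))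
      (filter (\<lambda>(c, hs). x \<in> spoly s n (filter (\<lambda>h. fst h n = 0) hs)) L)"
    have M1: "(\<Sum>(c, S, T)\<leftarrow>M. c * of_bool (y \<in> ivl s S T)) = (\<Sum>(c, hs)\<leftarrow>L. c * of_bool (y \<in> F hs))" for y
      unfolding M_def F_def by (induction L) auto
    have M2: "(\<Sum>(c, S, T)\<leftarrow>M. c * of_bool (ivl s S T \<noteq> {})) = (\<Sum>(c, hs)\<leftarrow>L. c * of_bool (F hs \<noteq> {}))"
      unfolding M_def F_def by (induction L) auto
    have F: "y \<in> F hs \<longleftrightarrow> snoc_vec n x y \<in> spoly s (Suc n) hs" for y hs
      by (simp add: F_def fibre_eq[OF x])
    have "(\<Sum>(c, hs)\<leftarrow>L. c * of_bool (F hs \<noteq> {})) = 0"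
      unfolding M2[symmetric]
    proof (rule ivl_relation)
      show "(\<Sum>(c, S, T)\<leftarrow>M. c * of_bool (y \<in> ivl s S T)) = 0" for y
        unfolding M1 F using Suc.prems[of "snoc_vec n x y"] by simp
    qed (auto simp: M_def)
    moreover have "F hs \<noteq> {} \<longleftrightarrow> x \<in> spoly s n (proj_constr n hs)" for hs
      using F by (auto simp: proj_spoly[OF x])
    ultimately show "(\<Sum>(c, hs)\<leftarrow>L'. c * of_bool (x \<in> spoly s n hs)) = 0"
      by (simp add: L'_def comp_def case_prod_unfold)
  qed
  moreover have "spoly s n (proj_constr n hs) \<noteq> {} \<longleftrightarrow> spoly s (Suc n) hs \<noteq> {}" for hs :: "((nat \<Rightarrow> int) \<times> 'g) list"
  proof
    assume "spoly s n (proj_constr n hs) \<noteq> {}"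
    then obtain x where "x \<in> spoly s n (proj_constr n hs)" "x \<in> carrier_vec n" by (auto simp: spoly_def)
    then show "spoly s (Suc n) hs \<noteq> {}" using proj_spoly[of x n s hs] by auto
  next
    assume "spoly s (Suc n) hs \<noteq> {}"
    then obtain z where z: "z \<in> spoly s (Suc n) hs" "z \<in> carrier_vec (Suc n)" by (auto simp: spoly_def)
    obtain x y where "x \<in> carrier_vec n" "z = snoc_vec n x y" using carrier_vec_SucE[OF z(2)] .
    then show "spoly s n (proj_constr n hs) \<noteq> {}" using proj_spoly[of x n s hs] z by auto
  qed
  ultimately show ?case by (simp add: L'_def comp_def case_prod_unfold)
qed

section \<open>The Euler characteristics of a definable set\<close>

text \<open>A list encodes an integral combination of indicator functions. With membership of a
  point as \<open>P\<close> the sum is the value of this function there; with nonemptiness it is the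
  Euler characteristic.\<close>

definition wsum :: "(int \<times> 'h) list \<Rightarrow> ('h \<Rightarrow> bool) \<Rightarrow> int" where
  "wsum L P = (\<Sum>(c, h)\<leftarrow>L. c * of_bool (P h))"

definition wprod :: "('h \<Rightarrow> 'h \<Rightarrow> 'h) \<Rightarrow> (int \<times> 'h) list \<Rightarrow> (int \<times> 'h) list \<Rightarrow> (int \<times> 'h) list" where
  "wprod f L M = concat (map (\<lambda>(c, h). map (\<lambda>(d, g). (c * d, f h g)) M) L)"

lemma wsum_simps [simp]:
  "wsum [] P = 0" "wsum ((c, h) # L) P = c * of_bool (P h) + wsum L P" "wsum (L @ M) P = wsum L P + wsum M P"
  by (simp_all add: wsum_def)

lemma wsum_neg: "wsum (map (\<lambda>(c, h). (- c, h)) L) P = - wsum L P"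
  by (induction L) auto

lemma wsum_map: "wsum (map (\<lambda>(c, h). (c, f h)) L) P = wsum L (\<lambda>h. P (f h))"
  by (induction L) auto

lemma wsum_prod:
  assumes "\<And>h g. R (f h g) \<longleftrightarrow> P h \<and> Q g"
  shows "wsum (wprod f L M) R = wsum L P * wsum M Q"
proof (induction L)
  case (Cons a L)
  obtain c h where a: "a = (c, h)" by (cases a)
  have "wsum (map (\<lambda>(d, g). (c * d, f h g)) M) R = c * of_bool (P h) * wsum M Q"
    by (induction M) (auto simp: assms algebra_simps)
  then show ?case using Cons by (simp add: a wprod_def distrib_right)
qed (simp add: wprod_def)

definition represents :: "bool \<Rightarrow> nat \<Rightarrow> (int \<times> ((nat \<Rightarrow> int) \<times> 'g) list) list \<Rightarrow> 'g::doag vec set \<Rightarrow> bool" where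
  "represents s n L X \<longleftrightarrow> (\<forall>x\<in>carrier_vec n. wsum L (\<lambda>hs. x \<in> spoly s n hs) = of_bool (x \<in> X))"

text \<open>\<open>euler False\<close> is the Euler characteristic that takes the value 1 on nonempty closed polyhedra, bounded or
  not; \<open>euler True\<close> takes the value 1 on nonempty open polyhedra and is thus \<open>(-1)\<^sup>n\<close> times the Euler
  characteristic with compact supports.\<close>

definition euler :: "bool \<Rightarrow> nat \<Rightarrow> 'g::doag vec set \<Rightarrow> int" where
  "euler s n X = (THE v. \<exists>L. represents s n L X \<and> v = wsum L (\<lambda>hs. spoly s n hs \<noteq> {}))"

text \<open>Two representations of a set differ by a linear relation between polyhedra, and
  \<open>spoly_relation\<close> says that the counts then agree.\<close>

lemma euler_eqI:
  assumes "represents s n L X" shows "euler s n X = wsum L (\<lambda>hs. spoly s n hs \<noteq> {})"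
  unfolding euler_def
proof (rule the_equality)
  show "\<exists>M. represents s n M X \<and> wsum L (\<lambda>hs. spoly s n hs \<noteq> {}) = wsum M (\<lambda>hs. spoly s n hs \<noteq> {})"
    using assms by blast
  fix v assume "\<exists>M. represents s n M X \<and> v = wsum M (\<lambda>hs. spoly s n hs \<noteq> {})"
  then obtain M where M: "represents s n M X" "v = wsum M (\<lambda>hs. spoly s n hs \<noteq> {})" by blast
  have "wsum (L @ map (\<lambda>(c, h). (- c, h)) M) (\<lambda>hs. spoly s n hs \<noteq> {}) = 0"
    unfolding wsum_def
  proof (rule spoly_relation)
    fix x :: "'a vec" assume "x \<in> carrier_vec n"
    then have "wsum (L @ map (\<lambda>(c, h). (- c, h)) M) (\<lambda>hs. x \<in> spoly s n hs) = 0"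
      using assms M(1) by (simp add: wsum_neg represents_def)
    then show "(\<Sum>(c, hs)\<leftarrow>L @ map (\<lambda>(c, h). (- c, h)) M. c * of_bool (x \<in> spoly s n hs)) = 0"
      by (simp only: wsum_def)
  qed
  then show "v = wsum L (\<lambda>hs. spoly s n hs \<noteq> {})" unfolding M(2) by (simp add: wsum_neg)
qed

lemma spoly_append: "spoly s n (hs @ gs) = spoly s n hs \<inter> spoly s n gs"
  by (auto simp: spoly_def)

lemma spoly_Nil: "spoly s n [] = carrier_vec n"
  by (simp add: spoly_def)

lemma represents_carrier: "represents s n [(1, [])] (carrier_vec n)"
  by (simp add: represents_def spoly_Nil)

lemma represents_compl:
  "represents s n L X \<Longrightarrow> represents s n ((1, []) # map (\<lambda>(c, h). (- c, h)) L) (carrier_vec n - X)"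
  by (simp add: represents_def spoly_Nil wsum_neg)

lemma represents_inter:
  "represents s n L X \<Longrightarrow> represents s n M Y \<Longrightarrow> represents s n (wprod (@) L M) (X \<inter> Y)"
  unfolding represents_def
proof
  assume *: "\<forall>x\<in>carrier_vec n. wsum L (\<lambda>hs. x \<in> spoly s n hs) = of_bool (x \<in> X)"
    "\<forall>x\<in>carrier_vec n. wsum M (\<lambda>hs. x \<in> spoly s n hs) = of_bool (x \<in> Y)"
  fix x :: "'a vec" assume x: "x \<in> carrier_vec n"
  have "wsum (wprod (@) L M) (\<lambda>hs. x \<in> spoly s n hs)
      = wsum L (\<lambda>hs. x \<in> spoly s n hs) * wsum M (\<lambda>hs. x \<in> spoly s n hs)"
    by (rule wsum_prod) (simp add: spoly_append)
  then show "wsum (wprod (@) L M) (\<lambda>hs. x \<in> spoly s n hs) = of_bool (x \<in> X \<inter> Y)"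
    using * x by simp
qed

lemma represents_cong: "represents s n L X \<Longrightarrow> X \<inter> carrier_vec n = Y \<inter> carrier_vec n \<Longrightarrow> represents s n L Y"
proof -
  assume *: "represents s n L X" and "X \<inter> carrier_vec n = Y \<inter> carrier_vec n"
  then have "x \<in> X \<longleftrightarrow> x \<in> Y" if "x \<in> carrier_vec n" for x using that by blast
  with * show ?thesis by (simp add: represents_def)
qed

text \<open>A half-space of the wrong strictness is the complement of one with the prescribed
  strictness and the negated form.\<close>

lemma represents_half: "\<exists>L. represents s n L (half n (t, l, b))"
proof (cases "t = s")
  case True
  have "represents s n [(1, [(l, b)])] (half n (t, l, b))"
    using True by (simp add: represents_def spoly_def half_def)
  then show ?thesis by blast
next
  case False
  have "represents s n [(1, []), (- 1, [(\<lambda>i. - l i, - b)])] (half n (t, l, b))"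
    using False by (cases s; cases t) (auto simp: represents_def spoly_def half_def beyond_def lform_uminus not_le not_less)
  then show ?thesis by blast
qed

lemma represents_definable:
  assumes "X \<in> definable A n" shows "\<exists>L. represents s n L X"
  using assms
proof (induction rule: definable.induct)
  have lin: "lform n (\<lambda>i. if i < n then k $ i else 0) x = int_lin k x" if "k \<in> carrier_vec n" for k and x :: "'a vec"
    using that by (simp add: lform_def int_lin_def)
  {
    case (lin_eq k a)
    obtain L M where "represents s n L (half n (False, \<lambda>i. if i < n then k $ i else 0, a))"
      "represents s n M (half n (True, \<lambda>i. if i < n then k $ i else 0, a))" using represents_half by metis
    note LM = represents_inter[OF this(1) represents_compl[OF this(2)]]
    show ?case
      by (rule exI, rule represents_cong[OF LM]) (use lin[OF lin_eq(1)] in \<open>auto simp: half_def beyond_def\<close>)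
  next
    case (lin_less k a)
    obtain L where "represents s n L (half n (False, \<lambda>i. if i < n then k $ i else 0, a))" using represents_half by metis
    note L = represents_compl[OF this]
    show ?case
      by (rule exI, rule represents_cong[OF L]) (use lin[OF lin_less(1)] in \<open>auto simp: half_def beyond_def\<close>)
  }
next
  case (compl X)
  then show ?case using represents_compl by blast
next
  case (union X Y)
  then obtain L M where "represents s n L X" "represents s n M Y" by blast
  note LM = represents_compl[OF represents_inter[OF represents_compl[OF this(1)] represents_compl[OF this(2)]]]
  show ?case by (rule exI, rule represents_cong[OF LM]) auto
qed

lemma euler_empty: "euler s n {} = 0"
  using euler_eqI[of s n "[]" "{}"] by (simp add: represents_def)

lemma euler_union:
  assumes "X \<in> definable A n" "Y \<in> definable A n" "X \<inter> Y = {}"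
  shows "euler s n (X \<union> Y) = euler s n X + euler s n Y"
proof -
  obtain L M where LM: "represents s n L X" "represents s n M Y"
    using represents_definable[OF assms(1)] represents_definable[OF assms(2)] by metis
  then have "represents s n (L @ M) (X \<union> Y)" using assms(3) by (auto simp: represents_def)
  then show ?thesis using LM by (simp add: euler_eqI)
qed

lemma lform_append:
  assumes "x \<in> carrier_vec n" "y \<in> carrier_vec m"
  shows "lform (n + m) l (x @\<^sub>v y) = lform n l x + lform m (\<lambda>i. l (n + i)) y"
proof -
  have *: "(\<Sum>i<n + m. f i) = (\<Sum>i<n. f i) + (\<Sum>i<m. f (n + i))" for f :: "nat \<Rightarrow> 'a"
    by (induction m) (simp_all add: add.assoc)
  show ?thesis using assms unfolding lform_def * by simp
qed

lemma vprod_append_iff: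
  assumes "X \<subseteq> carrier_vec n" "x \<in> carrier_vec n"
  shows "x @\<^sub>v y \<in> vprod X Y \<longleftrightarrow> x \<in> X \<and> y \<in> Y"
proof
  assume "x @\<^sub>v y \<in> vprod X Y"
  then obtain x' y' where *: "x @\<^sub>v y = x' @\<^sub>v y'" "x' \<in> X" "y' \<in> Y" by (auto simp: vprod_def)
  have "x' \<in> carrier_vec n" using *(2) assms(1) by (rule subsetD[rotated])
  from append_vec_eq[OF assms(2) this] have "x = x' \<and> y = y'" using *(1) by simp
  then show "x \<in> X \<and> y \<in> Y" using * by simp
next
  assume "x \<in> X \<and> y \<in> Y"
  then show "x @\<^sub>v y \<in> vprod X Y" unfolding vprod_def by blast
qed

text \<open>The joined constraints describe the product of two polyhedra, which is nonempty iff both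
  factors are; so representations and their counts multiply together.\<close>

lemma euler_vprod:
  assumes X: "X \<in> definable A n" and Y: "Y \<in> definable A m"
  shows "euler s (n + m) (vprod X Y) = euler s n X * euler s m Y"
proof -
  define join where "join hs gs = map (\<lambda>(l, b). (\<lambda>i. if i < n then l i else 0, b)) hs
      @ map (\<lambda>(l, b). (\<lambda>i. if i < n then 0 else l (i - n), b)) gs" for hs gs :: "((nat \<Rightarrow> int) \<times> 'a) list"
  have lf: "lform (n + m) (\<lambda>i. if i < n then l i else 0) (x @\<^sub>v y) = lform n l x"
    "lform (n + m) (\<lambda>i. if i < n then 0 else l (i - n)) (x @\<^sub>v y) = lform m l y"
    if "x \<in> carrier_vec n" "y \<in> carrier_vec m" for l and x y :: "'a vec"
    unfolding lform_append[OF that] by (simp_all add: lform_def)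
  have join: "x @\<^sub>v y \<in> spoly s (n + m) (join hs gs) \<longleftrightarrow> x \<in> spoly s n hs \<and> y \<in> spoly s m gs"
    if "x \<in> carrier_vec n" "y \<in> carrier_vec m" for x y hs gs
    unfolding join_def spoly_append using that by (simp add: spoly_def lf case_prod_unfold)
  have dec: "\<exists>x y. z = x @\<^sub>v y \<and> x \<in> carrier_vec n \<and> y \<in> carrier_vec m" if "z \<in> carrier_vec (n + m)" for z :: "'a vec"
    using vec_first_last_append[OF that] vec_first_carrier vec_last_carrier by metis
  have nonempty: "spoly s (n + m) (join hs gs) \<noteq> {} \<longleftrightarrow> spoly s n hs \<noteq> {} \<and> spoly s m gs \<noteq> {}" for hs gs
  proof
    assume "spoly s (n + m) (join hs gs) \<noteq> {}"
    then obtain z where z: "z \<in> spoly s (n + m) (join hs gs)" "z \<in> carrier_vec (n + m)" by (auto simp: spoly_def)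
    then obtain x y where "z = x @\<^sub>v y" "x \<in> carrier_vec n" "y \<in> carrier_vec m" using dec by blast
    then show "spoly s n hs \<noteq> {} \<and> spoly s m gs \<noteq> {}" using z join by blast
  next
    assume "spoly s n hs \<noteq> {} \<and> spoly s m gs \<noteq> {}"
    then obtain x y where "x \<in> spoly s n hs" "y \<in> spoly s m gs" by blast
    moreover from this have "x \<in> carrier_vec n" "y \<in> carrier_vec m" by (auto simp: spoly_def)
    ultimately show "spoly s (n + m) (join hs gs) \<noteq> {}" using join by blast
  qed
  obtain L M where LM: "represents s n L X" "represents s m M Y"
    using represents_definable[OF assms(1)] represents_definable[OF assms(2)] by metis
  have sub: "X \<subseteq> carrier_vec n" "Y \<subseteq> carrier_vec m" using assms definable_subset by auto
  have "represents s (n + m) (wprod join L M) (vprod X Y)"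
    unfolding represents_def
  proof
    fix z :: "'a vec" assume "z \<in> carrier_vec (n + m)"
    then obtain x y where z: "z = x @\<^sub>v y" "x \<in> carrier_vec n" "y \<in> carrier_vec m" using dec by blast
    have "z \<in> vprod X Y \<longleftrightarrow> x \<in> X \<and> y \<in> Y"
      unfolding z(1) by (rule vprod_append_iff[OF sub(1) z(2)])
    moreover have "wsum (wprod join L M) (\<lambda>hs. z \<in> spoly s (n + m) hs)
        = wsum L (\<lambda>hs. x \<in> spoly s n hs) * wsum M (\<lambda>hs. y \<in> spoly s m hs)"
      by (rule wsum_prod) (simp add: z join)
    ultimately show "wsum (wprod join L M) (\<lambda>hs. z \<in> spoly s (n + m) hs) = of_bool (z \<in> vprod X Y)"
      using LM z by (simp add: represents_def)
  qed
  then have "euler s (n + m) (vprod X Y) = wsum (wprod join L M) (\<lambda>hs. spoly s (n + m) hs \<noteq> {})"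
    by (rule euler_eqI)
  also have "\<dots> = wsum L (\<lambda>hs. spoly s n hs \<noteq> {}) * wsum M (\<lambda>hs. spoly s m hs \<noteq> {})"
    by (rule wsum_prod) (rule nonempty)
  finally show ?thesis using LM by (simp add: euler_eqI)
qed

section \<open>Invariance under isomorphisms\<close>

lemma vec_add_minus_cancel:
  "x \<in> carrier_vec n \<Longrightarrow> a \<in> carrier_vec n \<Longrightarrow> x + a + - a = (x :: 'a::ab_group_add vec)"
  "x \<in> carrier_vec n \<Longrightarrow> a \<in> carrier_vec n \<Longrightarrow> x + - a + a = (x :: 'a::ab_group_add vec)"
  by (auto intro!: eq_vecI)

text \<open>Constraints are pulled back by the transposed matrix, and since the affine map is
  bijective, nonemptiness of the polyhedra does not change.\<close>

lemma euler_affine: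
  assumes X: "X \<in> definable A n" and M: "M \<in> GL_Z n" and a: "a \<in> carrier_vec n"
  shows "euler s n {x \<in> carrier_vec n. int_mat_vec M x + a \<in> X} = euler s n X"
proof -
  have Mc: "M \<in> carrier_mat n n" using M by (simp add: GL_Z_def)
  define pull where "pull hs = map (\<lambda>(l, b). (\<lambda>i. (M\<^sup>T *\<^sub>v vec n l) $ i, b - lform n l a)) hs"
    for hs :: "((nat \<Rightarrow> int) \<times> 'a) list"
  have lf: "lform n l (int_mat_vec M x + a) = lform n (\<lambda>i. (M\<^sup>T *\<^sub>v vec n l) $ i) x + lform n l a"
    if x: "x \<in> carrier_vec n" for l x
  proof -
    have e: "lform n k y = int_lin (vec n k) y" for k and y :: "'a vec" by (simp add: lform_def int_lin_def)
    have v: "vec n (\<lambda>i. (M\<^sup>T *\<^sub>v vec n l) $ i) = M\<^sup>T *\<^sub>v vec n l" by (rule eq_vecI) (use Mc in auto)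
    show ?thesis
      unfolding e v using int_lin_add_right[of "vec n l" n "int_mat_vec M x" a] int_lin_mat_vec[of "vec n l" n M n x] Mc a x
      by simp
  qed
  have sub: "beyond s (b - c) y \<longleftrightarrow> beyond s b (y + c)" for b c y :: 'a
    by (auto simp: beyond_def algebra_simps)
  have pull: "x \<in> spoly s n (pull hs) \<longleftrightarrow> int_mat_vec M x + a \<in> spoly s n hs" if "x \<in> carrier_vec n" for x hs
    using that Mc a by (auto simp: spoly_def pull_def lf sub split_beta)
  have nonempty: "spoly s n (pull hs) \<noteq> {} \<longleftrightarrow> spoly s n hs \<noteq> {}" for hs
  proof
    assume "spoly s n (pull hs) \<noteq> {}"
    then obtain x where "x \<in> spoly s n (pull hs)" "x \<in> carrier_vec n" by (auto simp: spoly_def)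
    then show "spoly s n hs \<noteq> {}" using pull by blast
  next
    assume "spoly s n hs \<noteq> {}"
    then obtain y where y: "y \<in> spoly s n hs" "y \<in> carrier_vec n" by (auto simp: spoly_def)
    then have "y \<in> (\<lambda>x. int_mat_vec M x + a) ` carrier_vec n"
      unfolding bij_betw_imp_surj_on[OF GL_Z_affine_bij[OF M a]] by simp
    then obtain x where "x \<in> carrier_vec n" "y = int_mat_vec M x + a" by (rule imageE) (rule that)
    then show "spoly s n (pull hs) \<noteq> {}" using pull y by blast
  qed
  obtain L where L: "represents s n L X" using represents_definable[OF X] by blast
  have "represents s n (map (\<lambda>(c, h). (c, pull h)) L) {x \<in> carrier_vec n. int_mat_vec M x + a \<in> X}"
    using L Mc a by (auto simp: represents_def wsum_map pull)
  then show ?thesis using L by (simp add: euler_eqI wsum_map nonempty)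
qed

context doag_params
begin

lemma euler_UN:
  assumes "\<And>i. i < N \<Longrightarrow> P i \<in> definable A n" "disjoint_family_on P {..<N}"
  shows "(\<Union>i<N. P i) \<in> definable A n \<and> euler s n (\<Union>i<N. P i) = (\<Sum>i<(N::nat). euler s n (P i))"
  using assms
proof (induction N)
  case (Suc N)
  have dis: "disjoint_family_on P {..<N}"
    using Suc.prems(2) by (simp add: disjoint_family_on_def)
  have "P i \<in> definable A n" if "i < N" for i using Suc.prems(1) that by simp
  from Suc.IH[OF this dis] have IH: "(\<Union>i<N. P i) \<in> definable A n"
    "euler s n (\<Union>i<N. P i) = (\<Sum>i<N. euler s n (P i))" by blast+
  have "P i \<inter> P N = {}" if "i < N" for i
    using disjoint_family_onD[OF Suc.prems(2), of i N] that by simp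
  then have "(\<Union>i<N. P i) \<inter> P N = {}" by blast
  then have "euler s n ((\<Union>i<N. P i) \<union> P N) = (\<Sum>i<Suc N. euler s n (P i))"
    using euler_union[OF IH(1) Suc.prems(1)[of N]] IH(2) by simp
  moreover have "(\<Union>i<Suc N. P i) = (\<Union>i<N. P i) \<union> P N" by (simp add: lessThan_Suc Un_commute)
  ultimately show ?case using IH(1) Suc.prems(1)[of N] by (simp add: definable.union)
qed (simp add: euler_empty)

text \<open>Additivity reduces the claim to single pieces. The image of a piece is rewritten as a
  preimage under the inverse affine map, the form for which definability and invariance are
  known.\<close>

lemma euler_isomorphic:
  assumes "isomorphic A n X Y" shows "euler s n X = euler s n Y"
proof -
  from assms obtain f N P M a where XY: "X \<in> definable A n" "Y \<in> definable A n" "bij_betw f X Y"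
    and P: "X = (\<Union>i<(N::nat). P i)" "disjoint_family_on P {..<N}"
      "\<And>i. i < N \<Longrightarrow> P i \<in> definable A n \<and> M i \<in> GL_Z n \<and> a i \<in> carrier_vec n \<and> (\<forall>j<n. a i $ j \<in> A) \<and>
               (\<forall>x\<in>P i. f x = int_mat_vec (M i) x + a i)"
    unfolding isomorphic_def morphism_def by metis
  have Q: "f ` P i \<in> definable A n \<and> euler s n (f ` P i) = euler s n (P i)" if i: "i < N" for i
  proof -
    note Pi = P(3)[OF i]
    obtain N' where N': "N' \<in> GL_Z n" "M i \<in> carrier_mat n n" "N' \<in> carrier_mat n n" "M i * N' = 1\<^sub>m n" "N' * M i = 1\<^sub>m n"
      using GL_Z_inverse[of "M i" n] Pi by metis
    \<comment> \<open>The translation part of the inverse map; its entries lie in \<open>A\<close>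
      because \<open>N'\<close> is integral.\<close>
    define b where "b = int_mat_vec N' (- a i)"
    have b: "b \<in> carrier_vec n" "\<forall>j<n. b $ j \<in> A"
    proof -
      have "\<forall>j<n. (- a i) $ j \<in> A" using Pi A by (auto simp: add_subgroup_def)
      then show "\<forall>j<n. b $ j \<in> A"
        using N'(3) by (auto simp: b_def int_mat_vec_def intro!: int_lin_in_subgroup[OF A, of _ n])
    qed (use N' in \<open>simp add: b_def\<close>)
    have inv: "int_mat_vec N' y + b = int_mat_vec N' (y + - a i)" if "y \<in> carrier_vec n" for y
      using that N' Pi by (simp add: b_def int_mat_vec_add)
    have "f ` P i = {y \<in> carrier_vec n. int_mat_vec N' y + b \<in> P i}"
    proof (intro equalityI subsetI)
      fix y assume "y \<in> f ` P i"
      then obtain x where x: "x \<in> P i" "y = int_mat_vec (M i) x + a i" using Pi by auto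
      have xc: "x \<in> carrier_vec n" using x Pi definable_subset by blast
      then have yc: "y \<in> carrier_vec n" using x N' Pi by simp
      have "y + - a i = int_mat_vec (M i) x" unfolding x(2) by (rule vec_add_minus_cancel) (use N' Pi in auto)
      then have "int_mat_vec N' y + b = x"
        using inv[OF yc] N' xc by (simp add: int_mat_vec_one flip: int_mat_vec_mult)
      then show "y \<in> {y \<in> carrier_vec n. int_mat_vec N' y + b \<in> P i}" using x yc by simp
    next
      fix y assume "y \<in> {y \<in> carrier_vec n. int_mat_vec N' y + b \<in> P i}"
      then have y: "y \<in> carrier_vec n" "int_mat_vec N' (y + - a i) \<in> P i" using inv by auto
      have MN: "int_mat_vec (M i) (int_mat_vec N' (y + - a i)) = y + - a i"
        using y N' Pi by (simp add: int_mat_vec_one flip: int_mat_vec_mult[of _ n n _ n])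
      have "f (int_mat_vec N' (y + - a i)) = int_mat_vec (M i) (int_mat_vec N' (y + - a i)) + a i"
        using y(2) Pi by blast
      also have "\<dots> = y" unfolding MN by (rule vec_add_minus_cancel(2)[OF y(1)]) (use Pi in blast)
      finally have "f (int_mat_vec N' (y + - a i)) = y" .
      then show "y \<in> f ` P i" using y(2) by force
    qed
    then show ?thesis
      using definable_affine_preimage[OF conjunct1[OF Pi] N'(3) b]
        euler_affine[OF conjunct1[OF Pi] N'(1) b(1), of s] by simp
  qed
  have inj: "inj_on f X" "f ` X = Y" using XY(3) by (auto simp: bij_betw_def)
  have dis: "disjoint_family_on (\<lambda>i. f ` P i) {..<N}"
    unfolding disjoint_family_on_def
  proof (intro ballI impI)
    fix i j assume ij: "i \<in> {..<N}" "j \<in> {..<N}" "i \<noteq> j"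
    then have "P i \<inter> P j = {}" "P i \<subseteq> X" "P j \<subseteq> X" using P by (auto simp: disjoint_family_on_def)
    then show "f ` P i \<inter> f ` P j = {}" using inj_on_image_Int[OF inj(1), of "P i" "P j"] by simp
  qed
  have "euler s n (\<Union>i<N. f ` P i) = (\<Sum>i<N. euler s n (f ` P i))"
    by (rule conjunct2[OF euler_UN[OF conjunct1[OF Q] dis]])
  moreover have "euler s n X = (\<Sum>i<N. euler s n (P i))"
    unfolding P(1) by (rule conjunct2[OF euler_UN[OF conjunct1[OF P(3)] P(2)]])
  moreover have "Y = (\<Union>i<N. f ` P i)" using inj(2) P(1) by blast
  ultimately show ?thesis using Q by simp
qed

section \<open>Values on the point and on the ray\<close>

lemma lform_1: "lform 1 l x = zscale (l 0) (x $ 0)"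
  by (simp add: lform_def)

text \<open>With strict inequalities the origin is the line minus two open half-lines, giving 1 - 1
  - 1 = -1, and the closed ray is the line minus one of them, giving 1 - 1 = 0.\<close>

lemma euler_values:
  shows "euler False 1 origin1 = 1" "euler True 1 origin1 = -1"
    "euler False 1 (line {0 :: 'g..}) = 1" "euler True 1 (line {0 :: 'g..}) = 0"
    "euler s 0 (carrier_vec 0 :: 'g vec set) = 1"
proof -
  obtain d :: 'g where d: "0 < d" using doag_pos by blast
  let ?p = "(\<lambda>_. 1 :: int, 0 :: 'g)" and ?m = "(\<lambda>_. - 1 :: int, 0 :: 'g)"
  have in1: "x \<in> carrier_vec 1 \<Longrightarrow> P x \<Longrightarrow> {x \<in> carrier_vec 1. P x} \<noteq> {}" for x :: "'g vec" and P by blast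
  have sp: "spoly s 1 [] = carrier_vec 1" "spoly s 1 [?p] = {x \<in> carrier_vec 1. beyond s 0 (x $ 0)}"
    "spoly s 1 [?m] = {x \<in> carrier_vec 1. beyond s 0 (- (x $ 0))}"
    "spoly s 1 [?p, ?m] = {x \<in> carrier_vec 1. beyond s 0 (x $ 0) \<and> beyond s 0 (- (x $ 0))}" for s
    unfolding spoly_def lform_1 by simp_all
  have ne: "spoly s 1 [] \<noteq> ({} :: 'g vec set)" "spoly s 1 [?p] \<noteq> {}" "spoly s 1 [?m] \<noteq> {}" "spoly False 1 [?p, ?m] \<noteq> {}" for s
  proof -
    show "spoly s 1 [] \<noteq> ({} :: 'g vec set)" unfolding sp using zero_carrier_vec by blast
    show "spoly s 1 [?p] \<noteq> {}" unfolding sp by (rule in1[of "vec 1 (\<lambda>_. d)"]) (use d in \<open>auto simp: beyond_def\<close>)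
    show "spoly s 1 [?m] \<noteq> {}" unfolding sp by (rule in1[of "vec 1 (\<lambda>_. - d)"]) (use d in \<open>auto simp: beyond_def\<close>)
    show "spoly False 1 [?p, ?m] \<noteq> {}" unfolding sp by (rule in1[of "vec 1 (\<lambda>_. 0)"]) (auto simp: beyond_def)
  qed
  have "represents False 1 [(1, [?p, ?m])] origin1"
    unfolding represents_def by (auto simp: sp beyond_def simp del: One_nat_def)
  from euler_eqI[OF this] show "euler False 1 origin1 = 1" by (simp add: ne del: One_nat_def)
  have "represents True 1 [(1, []), (-1, [?p]), (-1, [?m])] origin1"
    unfolding represents_def by (auto simp: sp beyond_def simp del: One_nat_def)
  from euler_eqI[OF this] show "euler True 1 origin1 = -1" by (simp add: ne del: One_nat_def)
  have "represents False 1 [(1, [?p])] (line {0..})"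
    unfolding represents_def by (auto simp: sp beyond_def line_def simp del: One_nat_def)
  from euler_eqI[OF this] show "euler False 1 (line {0 :: 'g..}) = 1" by (simp add: ne del: One_nat_def)
  have "represents True 1 [(1, []), (-1, [?m])] (line {0..})"
    unfolding represents_def by (auto simp: sp beyond_def line_def simp del: One_nat_def)
  from euler_eqI[OF this] show "euler True 1 (line {0 :: 'g..}) = 0" by (simp add: ne del: One_nat_def)
  have "carrier_vec 0 \<noteq> ({} :: 'g vec set)" using zero_carrier_vec by blast
  moreover have "represents s 0 [(1, [])] (carrier_vec 0 :: 'g vec set)" by (rule represents_carrier)
  note euler_eqI[OF this]
  ultimately show "euler s 0 (carrier_vec 0 :: 'g vec set) = 1"
    by (simp add: spoly_Nil)
qed

section \<open>Divisible parameter groups\<close>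

lemma characters_exist:
  obtains \<phi> \<psi> where "character (KdfQ A) \<phi>" "\<phi> (iota_inf A) = 1" "\<And>q. \<phi> (pure_tensor (Kdf A) q \<one>\<^bsub>Kdf A\<^esub>) = q"
    "character (KdfQ A) \<psi>" "\<psi> (iota_inf A) = 0" "\<And>q. \<psi> (pure_tensor (Kdf A) q \<one>\<^bsub>Kdf A\<^esub>) = q"
proof -
  have inf: "line {0 :: 'g..} \<in> definable A 1" "iota_inf A = cls 1 (line {0..})"
    using definable_line_atLeast[OF zero_in_B] iota_inf_lcls by (simp_all only: tame_def lcls_def)
  \<comment> \<open>The sign turns the value -1 of \<open>euler True\<close> on the origin into 1,
    as \<open>character_KdfQ_exists\<close> demands, and it is multiplicative since dimensions
    add.\<close>
  define h where "h s n X = (of_int ((if s then (- 1) ^ n else 1) * euler s n X) :: rat)" for s n and X :: "'g vec set"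
  have ex: "\<exists>\<phi>. character (KdfQ A) \<phi> \<and> \<phi> (iota_inf A) = h s 1 (line {0..})
      \<and> (\<forall>q. \<phi> (pure_tensor (Kdf A) q \<one>\<^bsub>Kdf A\<^esub>) = q)" for s
  proof (rule character_KdfQ_exists[of "h s"])
    show "h s n {} = 0" for n by (simp add: h_def euler_empty)
    show "h s n X = h s n Y" if "isomorphic A n X Y" for n X Y
      using euler_isomorphic[OF that] by (simp add: h_def)
    show "h s n (X \<union> Y) = h s n X + h s n Y"
      if "X \<in> definable A n" "Y \<in> definable A n" "X \<inter> Y = {}" for n X Y
      using euler_union[OF that] by (simp add: h_def algebra_simps)
    show "h s (n + m) (vprod X Y) = h s n X * h s m Y"
      if "X \<in> definable A n" "Y \<in> definable A m" for n m X Y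
      using euler_vprod[OF that] by (simp add: h_def power_add)
    show "h s 0 (carrier_vec 0) = 1" using euler_values(5) by (simp add: h_def)
    show "h s 1 origin1 = 1" using euler_values(1,2) unfolding h_def by (cases s) simp_all
    fix \<phi> assume \<phi>: "character (KdfQ A) \<phi>" "\<And>n X. X \<in> definable A n \<Longrightarrow> \<phi> (cls n X) = h s n X"
      "\<And>q. \<phi> (pure_tensor (Kdf A) q \<one>\<^bsub>Kdf A\<^esub>) = q"
    show ?thesis by (intro exI[of _ \<phi>] conjI allI) (simp_all only: \<phi> inf)
  qed
  have "h False 1 (line {0..}) = 1" "h True 1 (line {0..}) = 0"
    using euler_values(3,4) unfolding h_def by simp_all
  then show ?thesis using ex[of False] ex[of True] that by metis
qed

text \<open>Here e(a) = 1 and \<iota>(a) = 0 for all generators, so the ring consists of the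
  elements q + r t with t idempotent. The two characters take the values q + r and q on them; these
  determine q and r, so no separate proof of linear independence is required.\<close>

lemma KdfQ_iso:
  assumes "divisible_subgroup A"
  shows "KdfQ A \<simeq> RDirProd rat_ring rat_ring"
proof -
  let ?R = "KdfQ A" and ?t = "iota_inf A"
  define c where "c q = pure_tensor (Kdf A) q \<one>\<^bsub>Kdf A\<^esub>" for q
  have c: "c q \<in> carrier ?R" for q unfolding c_def KdfQ_def by auto
  have c_ops: "c q \<oplus>\<^bsub>?R\<^esub> c r = c (q + r)" "c q \<otimes>\<^bsub>?R\<^esub> c r = c (q * r)" "\<ominus>\<^bsub>?R\<^esub> c q = c (- q)"
    "c 1 = \<one>\<^bsub>?R\<^esub>" "c 0 = \<zero>\<^bsub>?R\<^esub>" for q r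
    unfolding c_def KdfQ_def
    by (simp_all add: Kdf.pure_tensor_add_l Kdf.pure_tensor_mult Kdf.pure_tensor_uminus_l Kdf.pure_tensor_one Kdf.pure_tensor_zero_l)
  have t: "?t \<in> carrier ?R" using generators_closed by auto
  have tt: "?t \<otimes>\<^bsub>?R\<^esub> ?t = ?t" by (rule iota_inf_idem)
  have BA: "B = A"
  proof
    show "B \<subseteq> A"
    proof
      fix b assume "b \<in> B"
      then obtain n where n: "0 < n" "zscale (int n) b \<in> A" by (auto simp: div_hull_def)
      \<comment> \<open>\<open>A\<close> contains a quotient of this multiple by \<open>n\<close>,
        and by uniqueness of division it is \<open>b\<close>.\<close>
      then obtain b' where "b' \<in> A" "zscale (int n) b' = zscale (int n) b"
        using assms by (auto simp: divisible_subgroup_def)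
      then show "b \<in> A" using n zscale_eq_iff[of "int n" b' b] by simp
    qed
  qed (rule A_subset_B)
  define E where "E = {c q \<oplus>\<^bsub>?R\<^esub> c r \<otimes>\<^bsub>?R\<^esub> ?t | q r. True}"
  have EI: "x \<in> E" if "x = c q \<oplus>\<^bsub>?R\<^esub> c r \<otimes>\<^bsub>?R\<^esub> ?t" for x q r using that by (auto simp: E_def)
  have cE: "c q \<in> E" for q by (rule EI[of _ q 0]) (simp add: c_ops c t)
  have e1: "e_class A a = \<one>\<^bsub>?R\<^esub>" if "a \<in> A" for a
  proof -
    have "lcls {x. x + a \<in> {a}} = lcls {a}"
      unfolding lcls_def by (rule cls_iso, rule isomorphic_line_translate) (use that BA in \<open>auto simp: definable_line\<close>)
    moreover have "{x. x + a \<in> {a}} = {0}" by auto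
    ultimately show ?thesis by (simp add: e_class_lcls lcls_zero)
  qed
  have "x \<in> E" if "x \<in> carrier ?R" for x
  proof -
    have "x \<in> generate_ring ?R (range c \<union> (e_class A ` B \<union> iota A ` B \<union> {?t}))"
      using that KdfQ_generated unfolding rat_subalgebra_def KdfQ_def[symmetric] c_def[abs_def] by simp
    then show ?thesis
    proof induction
      case one
      then show ?case using cE[of 1] by (simp add: c_ops)
    next
      case (incl h)
      then consider q where "h = c q" | "h = \<one>\<^bsub>?R\<^esub>" | "h = \<zero>\<^bsub>?R\<^esub>" | "h = ?t"
        using e1 iota_eq_zero BA by auto
      then show ?case
      proof cases
        case 4
        then show ?thesis using EI[of h 0 1] by (simp add: c_ops t)
      qed (use cE cE[of 1] cE[of 0] c_ops in auto)
    next
      case (a_inv h)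
      then obtain q r where "h = c q \<oplus>\<^bsub>?R\<^esub> c r \<otimes>\<^bsub>?R\<^esub> ?t" by (auto simp: E_def)
      then have "\<ominus>\<^bsub>?R\<^esub> h = c (- q) \<oplus>\<^bsub>?R\<^esub> c (- r) \<otimes>\<^bsub>?R\<^esub> ?t"
        using c t by (simp add: Q.minus_add Q.l_minus flip: c_ops(3))
      then show ?case by (rule EI)
    next
      case (eng_add g h)
      then obtain q r q' r' where "g = c q \<oplus>\<^bsub>?R\<^esub> c r \<otimes>\<^bsub>?R\<^esub> ?t" "h = c q' \<oplus>\<^bsub>?R\<^esub> c r' \<otimes>\<^bsub>?R\<^esub> ?t"
        by (auto simp: E_def)
      then have "g \<oplus>\<^bsub>?R\<^esub> h = c (q + q') \<oplus>\<^bsub>?R\<^esub> c (r + r') \<otimes>\<^bsub>?R\<^esub> ?t"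
        using c t by (simp add: Q.l_distr Q.a_ac flip: c_ops(1))
      then show ?case by (rule EI)
    next
      case (eng_mult g h)
      then obtain q r q' r' where gh: "g = c q \<oplus>\<^bsub>?R\<^esub> c r \<otimes>\<^bsub>?R\<^esub> ?t" "h = c q' \<oplus>\<^bsub>?R\<^esub> c r' \<otimes>\<^bsub>?R\<^esub> ?t"
        by (auto simp: E_def)
      have "g \<otimes>\<^bsub>?R\<^esub> h = c q \<otimes>\<^bsub>?R\<^esub> c q' \<oplus>\<^bsub>?R\<^esub> (c q \<otimes>\<^bsub>?R\<^esub> c r' \<otimes>\<^bsub>?R\<^esub> ?t \<oplus>\<^bsub>?R\<^esub> c r \<otimes>\<^bsub>?R\<^esub> c q' \<otimes>\<^bsub>?R\<^esub> ?t
          \<oplus>\<^bsub>?R\<^esub> c r \<otimes>\<^bsub>?R\<^esub> c r' \<otimes>\<^bsub>?R\<^esub> (?t \<otimes>\<^bsub>?R\<^esub> ?t))"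
        unfolding gh using c t by (simp add: Q.l_distr Q.r_distr Q.a_ac Q.m_ac)
      also have "\<dots> = c (q * q') \<oplus>\<^bsub>?R\<^esub> c (q * r' + r * q' + r * r') \<otimes>\<^bsub>?R\<^esub> ?t"
        using c t by (simp add: tt Q.l_distr Q.a_ac c_ops(2) flip: c_ops(1))
      finally show ?case by (rule EI)
    qed
  qed
  then have carr: "carrier ?R = E" using c t by (auto simp: E_def)
  obtain \<phi> \<psi> where \<phi>: "character ?R \<phi>" "\<phi> ?t = 1" "\<And>q. \<phi> (c q) = q"
    and \<psi>: "character ?R \<psi>" "\<psi> ?t = 0" "\<And>q. \<psi> (c q) = q"
    using characters_exist unfolding c_def by blast
  have val: "\<phi> (c q \<oplus>\<^bsub>?R\<^esub> c r \<otimes>\<^bsub>?R\<^esub> ?t) = q + r" "\<psi> (c q \<oplus>\<^bsub>?R\<^esub> c r \<otimes>\<^bsub>?R\<^esub> ?t) = q" for q r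
    using \<phi> \<psi> c t by (simp_all add: character_def)
  let ?S = "RDirProd rat_ring rat_ring"
  have S: "carrier ?S = UNIV" "\<one>\<^bsub>?S\<^esub> = (1, 1)" "(a, b) \<otimes>\<^bsub>?S\<^esub> (a', b') = (a * a', b * b')"
    "(a, b) \<oplus>\<^bsub>?S\<^esub> (a', b') = (a + a', b + b')" for a b a' b'
    by (simp_all add: RDirProd_def DirProd_def monoid.defs rat_ring_def)
  have "(\<lambda>x. (\<phi> x, \<psi> x)) \<in> ring_iso ?R ?S"
  proof (rule ring_iso_memI)
    show "bij_betw (\<lambda>x. (\<phi> x, \<psi> x)) (carrier ?R) (carrier ?S)"
      unfolding bij_betw_def S
    proof
      show "inj_on (\<lambda>x. (\<phi> x, \<psi> x)) (carrier ?R)"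
        by (rule inj_onI) (auto simp: carr E_def val)
      \<comment> \<open>The preimage solves q + r = u and q = v.\<close>
      have "(u, v) \<in> (\<lambda>x. (\<phi> x, \<psi> x)) ` carrier ?R" for u v
        by (rule image_eqI[of _ _ "c v \<oplus>\<^bsub>?R\<^esub> c (u - v) \<otimes>\<^bsub>?R\<^esub> ?t"]) (use val[of v "u - v"] c t in auto)
      then show "(\<lambda>x. (\<phi> x, \<psi> x)) ` carrier ?R = UNIV" by auto
    qed
  qed (use \<phi>(1) \<psi>(1) in \<open>auto simp: S character_def\<close>)
  then show ?thesis unfolding is_ring_iso_def by blast
qed

end

theorem theorem3p13:
  fixes A :: "'g::doag set"
  assumes "add_subgroup A"
    and "saturated_over A"
  shows "cring (KdfQ A)
    \<and> rat_subalgebra (Kdf A)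
        (e_class A ` div_hull A \<union> iota A ` div_hull A \<union> {iota_inf A}) = carrier (KdfQ A)
    \<and> (\<forall>a\<in>A. iota A a = \<zero>\<^bsub>KdfQ A\<^esub>)
    \<and> iota_inf A [^]\<^bsub>KdfQ A\<^esub> (2::nat) = iota_inf A
    \<and> (divisible_subgroup A \<longrightarrow> is_ring_iso (KdfQ A) (RDirProd rat_ring rat_ring))"
proof -
  interpret doag_params A by unfold_locales (rule assms(1))
  have "iota_inf A \<in> carrier (KdfQ A)" using generators_closed by auto
  then have "iota_inf A [^]\<^bsub>KdfQ A\<^esub> (2::nat) = iota_inf A"
    using iota_inf_idem by (simp add: numeral_2_eq_2)
  then show ?thesis
    using cring_KdfQ KdfQ_generated iota_eq_zero KdfQ_iso by blast
qed

end
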